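(* Consider the planar system $$\dot x=\epsilon f(x,z,\epsilon),\qquad \dot z=g(x,z,\epsilon)\,z, \qquad (\ast)$$ with $x\in\mathbb R$, $z\in\mathbb R$, where $f$ and $g$ are $C^{r+1}$ functions, $r\ge 1$, satisfying $$f(x,0,0)>0;\qquad g(x,0,0)<0 \text{ for } x<0\quad\text{and}\quad g(x,0,0)>0 \text{ for } x>0.$$ Choose $x_0<0$ such that there exists $x_1>0$ satisfying $$\int_{x_0}^{x_1}\frac{g(x,0,0)}{f(x,0,0)}\,dx=0. \qquad (\ast\ast)$$ If $z_0>0$ is small enough, then the following holds. Let $\bar\gamma_\epsilon$ be the trajectory of $(\ast)$ that starts at the point $(x_0,z_0)$ and ends at the cross section $\{x>0,\ z=z_0\}$. Then $$\bar\gamma_\epsilon\to \bar\gamma_1\cup\bar\gamma_0\cup\bar\gamma_2\equiv\big(\{x_0\}\times[0,z_0]\big)\cup\big([x_0,x_1]\times\{0\}\big)\cup\big(\{x_1\}\times[0,z_0]\big)\quad\text{as }\epsilon\to 0$$ in the sense of point-sets, and $$\min_{(x,z)\in\bar\gamma_\epsilon} z=\exp\left(\frac{-\zeta_0+o(1)}{\epsilon}\right),\qquad\text{where}\quad \zeta_0=\int_{x_0}^0\frac{|g(x,0,0)|}{f(x,0,0)}\,dx.$$ Moreover, for any compact interval $K\subset(-\infty,0)$ such that $x_1$ is well-defined by $(\ast\ast)$ for each $x_0\in K$, there exists $\epsilon_0>0$ such that if we set $x_{1,\epsilon}$ by $x_{1,0}=x_1$ and $$(x_{1,\epsilon},z_0)=\bar\gamma_\epsilon\cap\{x>0,\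 z=z_0\},\qquad \epsilon\in(0,\epsilon_0],$$ then $x_{1,\epsilon}$ is a $C^r$ function of $(x_0,\epsilon)$ on $K\times[0,\epsilon_0]$.
   Context: Here $\epsilon>0$ is a small parameter, and the trajectory $\bar\gamma_\epsilon$ is regarded as a set of points in the $(x,z)$-plane. In the last assertion, $x_0$ varies over $K$: $x_1=x_1(x_0)>0$ is the number determined by $(\ast\ast)$ and $\bar\gamma_\epsilon$ is the trajectory of $(\ast)$ starting at $(x_0,z_0)$ and ending at $\{x>0,\ z=z_0\}$.
   Formalization: In the "Moreover" part, how small z0 must be may depend on K; with z0 fixed before K the claim fails, e.g. f=1, g=x(1-x^2 z): if x0 in K has x0^2 z0 > 1, the trajectory blows up before reaching the cross section. *)

theory Defs
  imports "HOL-Analysis.Analysis"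
begin

text \<open>
  Functions of class C^k on a set that need not be open. On the sets used below (convex, and except
  for a degenerate box with nonempty interior) the derivative within the set is unique, so that at
  boundary points this is the usual one-sided notion.
\<close>

primrec C_k_on :: "nat \<Rightarrow> ('a::euclidean_space \<Rightarrow> real) \<Rightarrow> 'a set \<Rightarrow> bool" where
  "C_k_on 0 F S \<longleftrightarrow> continuous_on S F"
| "C_k_on (Suc k) F S \<longleftrightarrow>
     (\<exists>F'. (\<forall>p\<in>S. (F has_derivative F' p) (at p within S)) \<and>
           (\<forall>b\<in>Basis. C_k_on k (\<lambda>p. F' p b) S))"

definition hausdorff_distance :: "'a::metric_space set \<Rightarrow> 'a set \<Rightarrow> real" where
  "hausdorff_distance A B = max (SUP a\<in>A. infdist a B) (SUP b\<in>B. infdist b A)"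

definition entry_exit ::
  "(real \<Rightarrow> real \<Rightarrow> real \<Rightarrow> real) \<Rightarrow> (real \<Rightarrow> real \<Rightarrow> real \<Rightarrow> real) \<Rightarrow> real \<Rightarrow> real \<Rightarrow> bool" where
  "entry_exit f g x0 x1 \<longleftrightarrow>
     x0 < 0 \<and> 0 < x1 \<and> integral {x0..x1} (\<lambda>x. g x 0 0 / f x 0 0) = 0"

definition cross_section :: "real \<Rightarrow> (real \<times> real) set" where
  "cross_section z0 = {(x, z). 0 < x \<and> z = z0}"

text \<open>
  The trajectory ends when it first reaches the cross section; this makes the point set unique.
\<close>

definition is_trajectory ::
  "(real \<Rightarrow> real \<Rightarrow> real \<Rightarrow> real) \<Rightarrow> (real \<Rightarrow> real \<Rightarrow> real \<Rightarrow> real) \<Rightarrow>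
   real \<Rightarrow> real \<Rightarrow> real \<Rightarrow> (real \<times> real) set \<Rightarrow> bool" where
  "is_trajectory f g x0 z0 \<epsilon> \<gamma> \<longleftrightarrow>
     (\<exists>X Z T. 0 < T \<and> X 0 = x0 \<and> Z 0 = z0 \<and>
        (\<forall>t\<in>{0..T}.
           (X has_real_derivative \<epsilon> * f (X t) (Z t) \<epsilon>) (at t within {0..T}) \<and>
           (Z has_real_derivative g (X t) (Z t) \<epsilon> * Z t) (at t within {0..T})) \<and>
        (X T, Z T) \<in> cross_section z0 \<and>
        (\<forall>t\<in>{0..<T}. (X t, Z t) \<notin> cross_section z0) \<and>
        \<gamma> = (\<lambda>t. (X t, Z t)) ` {0..T})"

definition trajectory ::
  "(real \<Rightarrow> real \<Rightarrow> real \<Rightarrow> real) \<Rightarrow> (real \<Rightarrow> real \<Rightarrow> real \<Rightarrow> real) \<Rightarrow>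
   real \<Rightarrow> real \<Rightarrow> real \<Rightarrow> (real \<times> real) set" where
  "trajectory f g x0 z0 \<epsilon> = (THE \<gamma>. is_trajectory f g x0 z0 \<epsilon> \<gamma>)"

definition singular_orbit :: "real \<Rightarrow> real \<Rightarrow> real \<Rightarrow> (real \<times> real) set" where
  "singular_orbit x0 x1 z0 = {x0} \<times> {0..z0} \<union> {x0..x1} \<times> {0} \<union> {x1} \<times> {0..z0}"

end

theory Submission
  imports Defs
begin

text \<open>
  Along a trajectory \<open>\<epsilon> * dz/dx = h * z\<close> with \<open>h = g / f\<close>. Write \<open>h (x, z, \<epsilon>) = h (x, 0, \<epsilon>) + z * h1 (x, z, \<epsilon>)\<close>
  and \<open>ln (z / z0) = \<theta> + u\<close>, where \<open>\<epsilon> * \<theta>\<close> is the integral of \<open>h (x, 0, \<epsilon>)\<close> from \<open>x0\<close>. Only \<open>u\<close> feels the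
  nonlinearity, and between \<open>x0 < 0\<close> and \<open>0\<close> its derivative carries the factor \<open>z\<close>, which is exponentially
  small outside a layer of width of order \<open>\<epsilon>\<close> at \<open>x0\<close>. In the stretched time \<open>(x - x0) / (\<epsilon> * \<bar>x0\<bar>)\<close>,
  compactified to the unit interval, the equation for \<open>u\<close> therefore has a right-hand side that is of class
  \<open>C^r\<close> up to \<open>\<epsilon> = 0\<close>: it is flat at its only singular corner. Hence the total contribution
  \<open>\<eta>m (x0, \<epsilon>)\<close> of the nonlinearity on the way to \<open>x = 0\<close> is of class \<open>C^r\<close>; reversing \<open>x\<close> gives the analogous
  \<open>\<eta>p\<close> for the way from \<open>x = 0\<close> to the exit point \<open>x1\<close>. Matching the two halves at \<open>x = 0\<close> means that the
  integral of \<open>h (x, 0, \<epsilon>)\<close> over \<open>{x0..x1}\<close> plus \<open>\<epsilon> * (\<eta>m (x0, \<epsilon>) - \<eta>p (- x1, \<epsilon>))\<close> vanishes, and the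
  implicit function theorem solves this for \<open>x1\<close>.
\<close>

section \<open>Calculus of functions of class C^k\<close>

text \<open>The obstacle is the turning point: \<open>h (x, 0, 0)\<close> vanishes at
  \<open>x = 0\<close>, and for \<epsilon> > 0 the sign of \<open>h (x, 0, \<epsilon>)\<close> near
  0 is arbitrary, so the decay of z cannot come from a pointwise bound on h. It comes from the mean
  of h over \<open>{x0..x}\<close>, which stays below a negative constant for all x up to 0 because
  x0 is bounded away from 0. The stretched time runs over an interval of length 1/\<epsilon>; its
  compactification moves the whole passage to a fixed compact box, where dependence on parameters
  can be differentiated up to \<epsilon> = 0. The price is the Jacobian 1/q^2, which the flat factor
  \<open>exp (\<theta> y)\<close> absorbs. Dividing by z to form h1 costs the one derivative between
  C^(r+1) and C^r. Smallness of z0, uniform in \<epsilon>, keeps |u| below 1, makes the Picard map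
  contract, and keeps |u| below half of the decay of \<theta>, so that z < z0 after entry and the
  section is not met too early.\<close>

abbreviation has_partials :: "('a::euclidean_space \<Rightarrow> real) \<Rightarrow> ('a \<Rightarrow> 'a \<Rightarrow> real) \<Rightarrow> 'a \<Rightarrow> 'a set \<Rightarrow> bool" where
  "has_partials F A p S \<equiv> (F has_derivative (\<lambda>d. \<Sum>b\<in>Basis. (d \<bullet> b) * A b p)) (at p within S)"

text \<open>
  The class \<open>W\<close> constrains the function and all its partial derivatives up to order \<open>k\<close>:
  \<open>W = UNIV\<close> gives \<open>C_k_on\<close>, and growth or decay conditions near a singular set are
  propagated through the calculus rules in the same way.
\<close>

primrec C_k_class :: "nat \<Rightarrow> ('a::euclidean_space \<Rightarrow> real) set \<Rightarrow> ('a \<Rightarrow> real) \<Rightarrow> 'a set \<Rightarrow> bool" where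
  "C_k_class 0 W F S \<longleftrightarrow> F \<in> W \<and> continuous_on S F"
| "C_k_class (Suc k) W F S \<longleftrightarrow> F \<in> W \<and>
     (\<exists>A. (\<forall>p\<in>S. has_partials F A p S) \<and>
          (\<forall>b\<in>Basis. C_k_class k W (A b) S))"

lemma C_k_class_continuous: "C_k_class k W F S \<Longrightarrow> continuous_on S F"
  by (cases k) (auto simp: continuous_on_eq_continuous_within intro: has_derivative_continuous)

lemma C_k_class_Suc_imp: "C_k_class (Suc k) W F S \<Longrightarrow> C_k_class k W F S"
proof (induction k arbitrary: F)
  case 0
  then show ?case using C_k_class_continuous[OF 0] by auto
next
  case (Suc k)
  from Suc.prems obtain A where A: "\<forall>p\<in>S. has_partials F A p S"
    "\<forall>b\<in>Basis. C_k_class (Suc k) W (A b) S" "F \<in> W"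
    by (subst (asm) C_k_class.simps(2)) blast
  have "\<forall>b\<in>Basis. C_k_class k W (A b) S" using A(2) Suc.IH by blast
  with A(1,3) show ?case by (subst C_k_class.simps(2)) blast
qed

lemma C_k_class_mono: "C_k_class k W F S \<Longrightarrow> T \<subseteq> S \<Longrightarrow> W \<subseteq> W' \<Longrightarrow> C_k_class k W' F T"
proof (induction k arbitrary: F)
  case 0
  then show ?case by (auto intro: continuous_on_subset)
next
  case (Suc k)
  from Suc.prems(1) obtain A where A: "\<forall>p\<in>S. has_partials F A p S"
    "\<forall>b\<in>Basis. C_k_class k W (A b) S" and "F \<in> W" by auto
  then have "\<forall>p\<in>T. has_partials F A p T"
    using Suc.prems(2) by (blast intro: has_derivative_subset)
  then show ?case using A \<open>F \<in> W\<close> Suc by auto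
qed

lemma C_k_class_const:
  assumes "\<And>c. (\<lambda>_. c) \<in> W"
  shows "C_k_class k W (\<lambda>_. c) S"
proof (induction k arbitrary: c)
  case 0 then show ?case using assms by auto
next
  case (Suc k)
  show ?case using assms Suc
    by (auto intro!: exI[where x="\<lambda>b p. 0"])
qed

lemma C_k_class_add:
  assumes W: "\<And>F G. F \<in> W \<Longrightarrow> G \<in> W \<Longrightarrow> (\<lambda>p. F p + G p) \<in> W"
  shows "C_k_class k W F S \<Longrightarrow> C_k_class k W G S \<Longrightarrow> C_k_class k W (\<lambda>p. F p + G p) S"
proof (induction k arbitrary: F G)
  case 0
  then show ?case using W by (auto intro: continuous_intros)
next
  case (Suc k)
  obtain A where A: "\<forall>p\<in>S. has_partials F A p S"
    "\<forall>b\<in>Basis. C_k_class k W (A b) S" using Suc.prems by auto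
  obtain B where B: "\<forall>p\<in>S. has_partials G B p S"
    "\<forall>b\<in>Basis. C_k_class k W (B b) S" using Suc.prems by auto
  have "\<forall>p\<in>S. ((\<lambda>p. F p + G p) has_derivative (\<lambda>d. \<Sum>b\<in>Basis. (d \<bullet> b) * (A b p + B b p))) (at p within S)"
    using A(1) B(1) by (auto simp: distrib_left sum.distrib intro: has_derivative_add)
  moreover have "\<forall>b\<in>Basis. C_k_class k W (\<lambda>p. A b p + B b p) S"
    using A B Suc.IH by auto
  moreover have "(\<lambda>p. F p + G p) \<in> W" using W Suc.prems by auto
  ultimately show ?case by (auto intro!: exI[where x="\<lambda>b p. A b p + B b p"])
qed

lemma C_k_class_sum:
  assumes W: "\<And>F G. F \<in> W \<Longrightarrow> G \<in> W \<Longrightarrow> (\<lambda>p. F p + G p) \<in> W"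
    and I: "finite I" "I \<noteq> {}" and F: "\<And>i. i \<in> I \<Longrightarrow> C_k_class k W (F i) S"
  shows "C_k_class k W (\<lambda>p. \<Sum>i\<in>I. F i p) S"
  using I F
  by (induction I rule: finite_ne_induct) (auto intro!: C_k_class_add[OF W])

text \<open>Three classes are kept apart so that one induction covers both products inside a class
  and products of a flat factor with a factor of polynomial growth. In the product rule every term
  has one factor from \<open>W1\<close> and one from \<open>W2\<close>, so sums are formed only in
  \<open>W3\<close>.\<close>

lemma C_k_class_mult:
  assumes W3: "\<And>F G. F \<in> W3 \<Longrightarrow> G \<in> W3 \<Longrightarrow> (\<lambda>p. F p + G p) \<in> W3"
    and W: "\<And>F G. F \<in> W1 \<Longrightarrow> G \<in> W2 \<Longrightarrow> (\<lambda>p. F p * G p) \<in> W3"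
  shows "C_k_class k W1 F S \<Longrightarrow> C_k_class k W2 G S \<Longrightarrow> C_k_class k W3 (\<lambda>p. F p * G p) S"
proof (induction k arbitrary: F G)
  case 0
  then show ?case using W by (auto intro: continuous_intros)
next
  case (Suc k)
  obtain A where A: "\<forall>p\<in>S. has_partials F A p S"
    "\<forall>b\<in>Basis. C_k_class k W1 (A b) S" using Suc.prems by auto
  obtain B where B: "\<forall>p\<in>S. has_partials G B p S"
    "\<forall>b\<in>Basis. C_k_class k W2 (B b) S" using Suc.prems by auto
  have "((\<lambda>p. F p * G p) has_derivative (\<lambda>d. \<Sum>b\<in>Basis. (d \<bullet> b) * (F p * B b p + A b p * G p))) (at p within S)" if "p \<in> S" for p
  proof -
    have "((\<lambda>p. F p * G p) has_derivative (\<lambda>d. F p * (\<Sum>b\<in>Basis. (d \<bullet> b) * B b p) + (\<Sum>b\<in>Basis. (d \<bullet> b) * A b p) * G p)) (at p within S)"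
      using A(1) B(1) that by (intro has_derivative_mult) auto
    moreover have "F p * (\<Sum>b\<in>Basis. (d \<bullet> b) * B b p) + (\<Sum>b\<in>Basis. (d \<bullet> b) * A b p) * G p
       = (\<Sum>b\<in>Basis. (d \<bullet> b) * (F p * B b p + A b p * G p))" for d
      by (simp add: sum_distrib_left sum_distrib_right sum.distrib algebra_simps)
    ultimately show ?thesis by simp
  qed
  moreover have "\<forall>b\<in>Basis. C_k_class k W3 (\<lambda>p. F p * B b p + A b p * G p) S"
    using A(2) B(2) by (intro ballI C_k_class_add[OF W3] Suc.IH C_k_class_Suc_imp[OF Suc.prems(1)] C_k_class_Suc_imp[OF Suc.prems(2)]) auto
  moreover have "(\<lambda>p. F p * G p) \<in> W3" using W Suc.prems by auto
  ultimately show ?case by (auto intro!: exI[where x="\<lambda>b p. F p * B b p + A b p * G p"])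
qed

lemma linear_basis_expansion:
  fixes L :: "'a::euclidean_space \<Rightarrow> real"
  assumes "linear L" shows "L d = (\<Sum>b\<in>Basis. (d \<bullet> b) * L b)"
proof -
  have "L d = L (\<Sum>b\<in>Basis. (d \<bullet> b) *\<^sub>R b)" by (simp add: euclidean_representation)
  also have "\<dots> = (\<Sum>b\<in>Basis. (d \<bullet> b) * L b)"
    using assms by (simp add: linear_sum linear_cmul)
  finally show ?thesis .
qed

lemma C_k_class_linear:
  assumes "bounded_linear L" "L \<in> W" "\<And>c. (\<lambda>_. c) \<in> W"
  shows "C_k_class k W L S"
proof (cases k)
  case 0 then show ?thesis using assms linear_continuous_on by auto
next
  case (Suc n)
  have "(L has_derivative (\<lambda>d. \<Sum>b\<in>Basis. (d \<bullet> b) * L b)) (at p within S)" for p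
  proof -
    have "L = (\<lambda>d. \<Sum>b\<in>Basis. (d \<bullet> b) * L b)"
      using linear_basis_expansion[OF bounded_linear.linear[OF assms(1)]] by (rule ext)
    then show ?thesis using bounded_linear_imp_has_derivative[OF assms(1), of "at p within S"] by simp
  qed
  then show ?thesis using Suc assms by (auto intro!: exI[where x="\<lambda>b p. L b"] C_k_class_const)
qed

text \<open>The class constrains only the inner map. The outer function and its partial derivatives
  enter through \<open>bd\<close>, which turns their continuity on \<open>T\<close> into membership;
  for compact \<open>T\<close> this will be boundedness along \<Psi>.\<close>

lemma C_k_class_compose:
  fixes \<Psi> :: "'a::euclidean_space \<Rightarrow> 'b::euclidean_space"
  assumes add: "\<And>F G. F \<in> W \<Longrightarrow> G \<in> W \<Longrightarrow> (\<lambda>p. F p + G p) \<in> W"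
    and mult: "\<And>F G. F \<in> W \<Longrightarrow> G \<in> W \<Longrightarrow> (\<lambda>p. F p * G p) \<in> W"
    and bd: "\<And>\<phi>. continuous_on T \<phi> \<Longrightarrow> (\<lambda>p. \<phi> (\<Psi> p)) \<in> W"
    and T: "\<Psi> ` S \<subseteq> T"
  shows "C_k_class k UNIV \<phi> T \<Longrightarrow> (\<And>b. b \<in> Basis \<Longrightarrow> C_k_class k W (\<lambda>p. \<Psi> p \<bullet> b) S) \<Longrightarrow>
    C_k_class k W (\<lambda>p. \<phi> (\<Psi> p)) S"
proof (induction k arbitrary: \<phi>)
  case 0
  have "continuous_on S \<Psi>"
    by (rule continuous_on_componentwise[THEN iffD2]) (use 0 in auto)
  moreover have "continuous_on (\<Psi> ` S) \<phi>" using 0 T continuous_on_subset by auto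
  ultimately have "continuous_on S (\<lambda>p. \<phi> (\<Psi> p))" using continuous_on_compose2 by blast
  then show ?case using 0 bd by auto
next
  case (Suc k)
  obtain A where A: "\<forall>y\<in>T. (\<phi> has_derivative (\<lambda>e. \<Sum>c\<in>Basis. (e \<bullet> c) * A c y)) (at y within T)"
    "\<forall>c\<in>Basis. C_k_class k UNIV (A c) T" using Suc.prems(1) by auto
  have "\<forall>c\<in>Basis. \<exists>B. (\<forall>p\<in>S. ((\<lambda>p. \<Psi> p \<bullet> c) has_derivative (\<lambda>d. \<Sum>b\<in>Basis. (d \<bullet> b) * B b p)) (at p within S)) \<and>
    (\<forall>b\<in>Basis. C_k_class k W (B b) S)" using Suc.prems(2) by auto
  from bchoice[OF this] obtain B where "\<forall>c\<in>Basis. (\<forall>p\<in>S. ((\<lambda>p. \<Psi> p \<bullet> c) has_derivative (\<lambda>d. \<Sum>b\<in>Basis. (d \<bullet> b) * B c b p)) (at p within S)) \<and>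
    (\<forall>b\<in>Basis. C_k_class k W (B c b) S)" by (elim exE)
  then have B: "\<And>c p. c\<in>Basis \<Longrightarrow> p\<in>S \<Longrightarrow> ((\<lambda>p. \<Psi> p \<bullet> c) has_derivative (\<lambda>d. \<Sum>b\<in>Basis. (d \<bullet> b) * B c b p)) (at p within S)"
    "\<And>c b. c\<in>Basis \<Longrightarrow> b\<in>Basis \<Longrightarrow> C_k_class k W (B c b) S" by auto
  have lower: "\<And>b. b \<in> Basis \<Longrightarrow> C_k_class k W (\<lambda>p. \<Psi> p \<bullet> b) S"
    by (rule C_k_class_Suc_imp[OF Suc.prems(2)])
  have "((\<lambda>p. \<phi> (\<Psi> p)) has_derivative (\<lambda>d. \<Sum>b\<in>Basis. (d \<bullet> b) * (\<Sum>c\<in>Basis. B c b p * A c (\<Psi> p)))) (at p within S)" if p: "p \<in> S" for p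
  proof -
    have 1: "(\<Psi> has_derivative (\<lambda>d. \<Sum>c\<in>Basis. (\<Sum>b\<in>Basis. (d \<bullet> b) * B c b p) *\<^sub>R c)) (at p within S)"
      unfolding has_derivative_componentwise_within[of \<Psi>]
      using B(1)[OF _ p] by (simp add: inner_sum_left inner_Basis if_distrib cong: if_cong)
    have "(\<phi> has_derivative (\<lambda>e. \<Sum>c\<in>Basis. (e \<bullet> c) * A c (\<Psi> p))) (at (\<Psi> p) within \<Psi> ` S)"
      using A(1) T p by (blast intro: has_derivative_subset)
    from diff_chain_within[OF 1 this]
    have "((\<lambda>p. \<phi> (\<Psi> p)) has_derivative (\<lambda>d. \<Sum>c\<in>Basis. (\<Sum>b\<in>Basis. (d \<bullet> b) * B c b p) * A c (\<Psi> p))) (at p within S)"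
      by (simp add: o_def inner_sum_left inner_Basis if_distrib cong: if_cong)
    moreover have "(\<Sum>c\<in>Basis. (\<Sum>b\<in>Basis. (d \<bullet> b) * B c b p) * A c (\<Psi> p)) = (\<Sum>b\<in>Basis. (d \<bullet> b) * (\<Sum>c\<in>Basis. B c b p * A c (\<Psi> p)))" for d
      unfolding sum_distrib_left sum_distrib_right
      by (subst sum.swap) (simp add: algebra_simps)
    ultimately show ?thesis by simp
  qed
  moreover have "C_k_class k W (\<lambda>p. \<Sum>c\<in>Basis. B c b p * A c (\<Psi> p)) S" if "b \<in> Basis" for b
    using that B A Suc.IH lower by (intro C_k_class_sum[OF add] C_k_class_mult[OF add mult]) auto
  moreover have "(\<lambda>p. \<phi> (\<Psi> p)) \<in> W"
    by (rule bd[OF C_k_class_continuous[OF Suc.prems(1)]])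
  ultimately show ?case
    by (auto intro!: exI[where x="\<lambda>b p. \<Sum>c\<in>Basis. B c b p * A c (\<Psi> p)"])
qed

text \<open>The derivative of 1/u contains only 1/u and derivatives of u, so the induction closes
  once 1/u itself lies in \<open>W\<close>. This is assumed separately, since membership of u does
  not control how u approaches 0.\<close>

lemma C_k_class_inverse:
  assumes add: "\<And>F G. F \<in> W \<Longrightarrow> G \<in> W \<Longrightarrow> (\<lambda>p. F p + G p) \<in> W"
    and mult: "\<And>F G. F \<in> W \<Longrightarrow> G \<in> W \<Longrightarrow> (\<lambda>p. F p * G p) \<in> W"
    and const: "\<And>c. (\<lambda>_. c) \<in> W"
    and u: "\<And>p. p \<in> S \<Longrightarrow> u p \<noteq> 0" "(\<lambda>p. inverse (u p)) \<in> W"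
  shows "C_k_class k W u S \<Longrightarrow> C_k_class k W (\<lambda>p. inverse (u p)) S"
proof (induction k)
  case 0
  then show ?case using u by (auto intro: continuous_intros)
next
  case (Suc k)
  obtain A where A: "\<forall>p\<in>S. has_partials u A p S"
    "\<forall>b\<in>Basis. C_k_class k W (A b) S" using Suc.prems by auto
  have "((\<lambda>p. inverse (u p)) has_derivative (\<lambda>d. \<Sum>b\<in>Basis. (d \<bullet> b) * (- 1 * A b p * (inverse (u p) * inverse (u p))))) (at p within S)" if "p \<in> S" for p
  proof -
    have "((\<lambda>p. inverse (u p)) has_derivative (\<lambda>d. - (inverse (u p) * (\<Sum>b\<in>Basis. (d \<bullet> b) * A b p) * inverse (u p)))) (at p within S)"
      by (rule Deriv.has_derivative_inverse[OF u(1)[OF that] A(1)[rule_format, OF that]])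
    then show ?thesis by (simp add: sum_distrib_left sum_distrib_right sum_negf algebra_simps)
  qed
  moreover have inv: "C_k_class k W (\<lambda>p. inverse (u p)) S"
    by (rule Suc.IH[OF C_k_class_Suc_imp[OF Suc.prems]])
  moreover have "C_k_class k W (\<lambda>p. - 1 * A b p * (inverse (u p) * inverse (u p))) S" if "b \<in> Basis" for b
    by (rule C_k_class_mult[OF add mult C_k_class_mult[OF add mult C_k_class_const[OF const] A(2)[rule_format, OF that]]
          C_k_class_mult[OF add mult inv inv]])
  ultimately show ?case using u
    by (auto intro!: exI[where x="\<lambda>b p. - 1 * A b p * (inverse (u p) * inverse (u p))"])
qed

text \<open>Each differentiation multiplies exp u by a derivative of u. Hence exp u may lie in a
  better class \<open>V\<close> than u, and membership of exp u alone propagates to all orders; this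
  is how flatness of \<open>exp (\<theta> y)\<close> reaches its derivatives.\<close>

lemma C_k_class_exp:
  assumes add: "\<And>F G. F \<in> V \<Longrightarrow> G \<in> V \<Longrightarrow> (\<lambda>p. F p + G p) \<in> V"
    and mult: "\<And>F G. F \<in> V \<Longrightarrow> G \<in> W \<Longrightarrow> (\<lambda>p. F p * G p) \<in> V"
    and u: "(\<lambda>p. exp (u p)) \<in> V"
  shows "C_k_class k W u S \<Longrightarrow> C_k_class k V (\<lambda>p. exp (u p)) S"
proof (induction k)
  case 0
  then show ?case using u by (auto intro: continuous_intros)
next
  case (Suc k)
  obtain A where A: "\<forall>p\<in>S. has_partials u A p S"
    "\<forall>b\<in>Basis. C_k_class k W (A b) S" using Suc.prems by auto
  have "((\<lambda>p. exp (u p)) has_derivative (\<lambda>d. \<Sum>b\<in>Basis. (d \<bullet> b) * (exp (u p) * A b p))) (at p within S)" if "p \<in> S" for p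
  proof -
    have "((\<lambda>p. exp (u p)) has_derivative (\<lambda>d. exp (u p) * (\<Sum>b\<in>Basis. (d \<bullet> b) * A b p))) (at p within S)"
      by (rule has_derivative_compose[OF A(1)[rule_format, OF that] DERIV_exp[unfolded has_field_derivative_def]])
    then show ?thesis by (simp add: sum_distrib_left algebra_simps)
  qed
  moreover have "C_k_class k V (\<lambda>p. exp (u p) * A b p) S" if "b \<in> Basis" for b
    by (rule C_k_class_mult[OF add mult Suc.IH[OF C_k_class_Suc_imp[OF Suc.prems]] A(2)[rule_format, OF that]])
  ultimately show ?case using u
    by (auto intro!: exI[where x="\<lambda>b p. exp (u p) * A b p"])
qed

text \<open>A derivative within a set is linear even where it is not unique, so its values on the
  basis recover it and the partial derivatives can be handled as scalar functions.\<close>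

lemma C_k_on_iff_class: "C_k_on k F S \<longleftrightarrow> C_k_class k UNIV F S"
proof (induction k arbitrary: F)
  case 0 then show ?case by simp
next
  case (Suc k)
  show ?case
  proof
    assume "C_k_on (Suc k) F S"
    then obtain F' where F': "\<forall>p\<in>S. (F has_derivative F' p) (at p within S)"
      "\<forall>b\<in>Basis. C_k_class k UNIV (\<lambda>p. F' p b) S" using Suc by auto
    have "(F has_derivative (\<lambda>d. \<Sum>b\<in>Basis. (d \<bullet> b) * F' p b)) (at p within S)" if "p \<in> S" for p
    proof -
      have "F' p = (\<lambda>d. \<Sum>b\<in>Basis. (d \<bullet> b) * F' p b)"
        using linear_basis_expansion[OF has_derivative_linear[OF F'(1)[rule_format, OF that]]] by (rule ext)
      then show ?thesis using F' that by metis
    qed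
    then show "C_k_class (Suc k) UNIV F S" using F'(2) by (auto intro!: exI[where x="\<lambda>b p. F' p b"])
  next
    assume "C_k_class (Suc k) UNIV F S"
    then obtain A where A: "\<forall>p\<in>S. has_partials F A p S"
      "\<forall>b\<in>Basis. C_k_on k (A b) S" using Suc by auto
    have "(\<lambda>p. \<Sum>c\<in>Basis. (b \<bullet> c) * A c p) = A b" if "b \<in> Basis" for b
      using that by (auto simp: fun_eq_iff inner_Basis if_distrib[of "\<lambda>x. x * _"] cong: if_cong)
    then show "C_k_on (Suc k) F S"
      using A by (auto intro!: exI[where x="\<lambda>p d. \<Sum>b\<in>Basis. (d \<bullet> b) * A b p"])
  qed
qed

section \<open>Closure rules for functions of class C^k\<close>

lemma C_k_on_SucE:
  assumes "C_k_on (Suc k) F S"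
  obtains A where "\<And>p. p \<in> S \<Longrightarrow> has_partials F A p S"
    "\<And>b. b \<in> Basis \<Longrightarrow> C_k_on k (A b) S"
  using assms that unfolding C_k_on_iff_class by auto

lemma C_k_on_SucI:
  assumes "\<And>p. p \<in> S \<Longrightarrow> has_partials F A p S"
    "\<And>b. b \<in> Basis \<Longrightarrow> C_k_on k (A b) S"
  shows "C_k_on (Suc k) F S"
  using assms unfolding C_k_on_iff_class by auto

lemma C_k_on_continuous: "C_k_on k F S \<Longrightarrow> continuous_on S F"
  using C_k_class_continuous C_k_on_iff_class by blast

lemma C_k_on_Suc_imp: "C_k_on (Suc k) F S \<Longrightarrow> C_k_on k F S"
  using C_k_class_Suc_imp C_k_on_iff_class by blast

lemma C_k_on_le: "C_k_on k F S \<Longrightarrow> j \<le> k \<Longrightarrow> C_k_on j F S"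
  by (induction k rule: nat_induct) (auto simp: le_Suc_eq simp del: C_k_on.simps intro: C_k_on_Suc_imp)

lemma C_k_on_subset: "C_k_on k F S \<Longrightarrow> T \<subseteq> S \<Longrightarrow> C_k_on k F T"
  using C_k_class_mono[of k UNIV F S T UNIV] C_k_on_iff_class by blast

lemma C_k_on_cong:
  assumes "C_k_on k F S" and eq: "\<And>p. p \<in> S \<Longrightarrow> F p = G p"
  shows "C_k_on k G S"
proof (cases k)
  case 0 then show ?thesis using assms by (simp cong: continuous_on_cong)
next
  case (Suc n)
  have *: "C_k_on (Suc n) F S" using assms Suc by simp
  obtain A where A: "\<And>p. p \<in> S \<Longrightarrow> has_partials F A p S"
    "\<And>b. b \<in> Basis \<Longrightarrow> C_k_on n (A b) S" by (rule C_k_on_SucE[OF *], rule that)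
  show ?thesis unfolding Suc
  proof (rule C_k_on_SucI[OF _ A(2)])
    fix p assume p: "p \<in> S"
    show "has_partials G A p S"
      by (rule has_derivative_transform[OF p eq[symmetric] A(1)[OF p]])
  qed auto
qed

lemma C_k_on_const: "C_k_on k (\<lambda>_. c) S"
  unfolding C_k_on_iff_class by (rule C_k_class_const) auto

lemma C_k_on_linear: "bounded_linear F \<Longrightarrow> C_k_on k F S"
  unfolding C_k_on_iff_class by (rule C_k_class_linear) auto

lemma C_k_on_add: "C_k_on k F S \<Longrightarrow> C_k_on k G S \<Longrightarrow> C_k_on k (\<lambda>p. F p + G p) S"
  unfolding C_k_on_iff_class by (rule C_k_class_add) auto

lemma C_k_on_mult: "C_k_on k F S \<Longrightarrow> C_k_on k G S \<Longrightarrow> C_k_on k (\<lambda>p. F p * G p) S"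
  unfolding C_k_on_iff_class by (rule C_k_class_mult) auto

lemma C_k_on_minus: "C_k_on k F S \<Longrightarrow> C_k_on k (\<lambda>p. - F p) S"
  using C_k_on_mult[OF C_k_on_const[of k "-1"]] by fastforce

lemma C_k_on_diff: "C_k_on k F S \<Longrightarrow> C_k_on k G S \<Longrightarrow> C_k_on k (\<lambda>p. F p - G p) S"
  using C_k_on_add[OF _ C_k_on_minus[of k G S], of F] by simp

lemma C_k_on_inverse: "C_k_on k F S \<Longrightarrow> (\<And>p. p \<in> S \<Longrightarrow> F p \<noteq> 0) \<Longrightarrow> C_k_on k (\<lambda>p. inverse (F p)) S"
  unfolding C_k_on_iff_class by (rule C_k_class_inverse) auto

lemma C_k_on_divide: "C_k_on k F S \<Longrightarrow> C_k_on k G S \<Longrightarrow> (\<And>p. p \<in> S \<Longrightarrow> G p \<noteq> 0) \<Longrightarrow> C_k_on k (\<lambda>p. F p / G p) S"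
  unfolding divide_inverse by (intro C_k_on_mult C_k_on_inverse)

lemma C_k_on_exp: "C_k_on k F S \<Longrightarrow> C_k_on k (\<lambda>p. exp (F p)) S"
  unfolding C_k_on_iff_class by (rule C_k_class_exp) auto

text \<open>Regularity of vector-valued maps is stated componentwise because
  \<open>C_k_class\<close> is scalar; the maps substituted later are nested pairs, assembled with
  \<open>comp_C_k_Pair\<close>.\<close>

definition comp_C_k :: "nat \<Rightarrow> ('a::euclidean_space \<Rightarrow> real) set \<Rightarrow> ('a \<Rightarrow> 'b::euclidean_space) \<Rightarrow> 'a set \<Rightarrow> bool" where
  "comp_C_k k W \<Psi> S \<longleftrightarrow> (\<forall>b\<in>Basis. C_k_class k W (\<lambda>p. \<Psi> p \<bullet> b) S)"

lemma comp_C_k_real: "comp_C_k k W \<psi> S \<longleftrightarrow> C_k_class k W (\<psi> :: _ \<Rightarrow> real) S"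
  by (simp add: comp_C_k_def)

lemma comp_C_k_Pair: "comp_C_k k W \<Phi> S \<Longrightarrow> comp_C_k k W \<Psi> S \<Longrightarrow> comp_C_k k W (\<lambda>p. (\<Phi> p, \<Psi> p)) S"
  by (auto simp: comp_C_k_def Basis_prod_def)

lemma comp_C_k_linear: "bounded_linear \<Psi> \<Longrightarrow> comp_C_k k UNIV \<Psi> S"
  unfolding comp_C_k_def
  by (auto intro!: C_k_class_linear bounded_linear_inner_left_comp)

lemma C_k_on_compose:
  assumes "C_k_on k \<phi> T" "comp_C_k k UNIV \<Psi> S" "\<And>p. p \<in> S \<Longrightarrow> \<Psi> p \<in> T"
  shows "C_k_on k (\<lambda>p. \<phi> (\<Psi> p)) S"
proof -
  have \<phi>: "C_k_class k UNIV \<phi> T" using assms(1) by (simp only: C_k_on_iff_class)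
  have \<Psi>: "\<And>b. b \<in> Basis \<Longrightarrow> C_k_class k UNIV (\<lambda>p. \<Psi> p \<bullet> b) S"
    using assms(2) by (simp add: comp_C_k_def)
  have T: "\<Psi> ` S \<subseteq> T" using assms(3) by auto
  show ?thesis unfolding C_k_on_iff_class
    by (rule C_k_class_compose[OF _ _ _ T \<phi> \<Psi>]) simp_all
qed

lemma C_k_on_fst: "C_k_on k (\<lambda>p. fst p :: real) S"
  by (intro C_k_on_linear bounded_linear_fst)

lemma comp_C_k_UNIV_real: "comp_C_k k UNIV \<psi> S \<longleftrightarrow> C_k_on k (\<psi> :: _ \<Rightarrow> real) S"
  by (simp add: comp_C_k_real C_k_on_iff_class)

lemma sum_Basis_prod:
  fixes f :: "'a::euclidean_space \<times> 'b::euclidean_space \<Rightarrow> real"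
  shows "(\<Sum>b\<in>Basis. f b) = (\<Sum>b\<in>Basis. f (b, 0)) + (\<Sum>b\<in>Basis. f (0, b))"
proof -
  have inj: "inj_on (\<lambda>u. (u::'a, 0::'b)) Basis" "inj_on (\<lambda>u. (0::'a, u::'b)) Basis"
    by (auto intro!: inj_onI)
  show ?thesis unfolding Basis_prod_def
    by (subst sum.union_disjoint) (auto simp: sum.reindex[OF inj(1)] sum.reindex[OF inj(2)])
qed

section \<open>Hadamard's lemma and integrals depending on a parameter\<close>

lemma continuous_on_slice1: "continuous_on (A \<times> B) f \<Longrightarrow> b \<in> B \<Longrightarrow> continuous_on A (\<lambda>a. f (a, b))"
  by (rule continuous_on_compose2[where t = "A \<times> B" and g = f]) (auto intro!: continuous_intros)

lemma continuous_on_slice2: "continuous_on (A \<times> B) f \<Longrightarrow> a \<in> A \<Longrightarrow> continuous_on B (\<lambda>b. f (a, b))"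
  by (rule continuous_on_compose2[where t = "A \<times> B" and g = f]) (auto intro!: continuous_intros)

text \<open>The coefficient of Hadamard's lemma. For continuous \<phi> it is, unlike a difference
  quotient, jointly continuous in both end points, also on the diagonal, where it equals
  \<open>\<phi> p\<close>.\<close>

definition segment_mean :: "('a::euclidean_space \<Rightarrow> real) \<Rightarrow> 'a \<Rightarrow> 'a \<Rightarrow> real" where
  "segment_mean \<phi> p q = integral {0..1} (\<lambda>\<tau>. \<phi> (p + \<tau> *\<^sub>R (q - p)))"

lemma segment_mean_diag [simp]: "segment_mean \<phi> p p = \<phi> p"
  by (simp add: segment_mean_def)

lemma convex_segment_mem:
  assumes "convex S" "p \<in> S" "q \<in> S" "\<tau> \<in> {0..1::real}"
  shows "p + \<tau> *\<^sub>R (q - p) \<in> S"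
proof -
  have "(1 - \<tau>) *\<^sub>R p + \<tau> *\<^sub>R q \<in> S" using assms by (auto intro: convexD_alt)
  then show ?thesis by (simp add: algebra_simps)
qed

lemma continuous_on_integral_param:
  fixes \<phi> :: "real \<times> 'a::euclidean_space \<Rightarrow> real"
  assumes "continuous_on ({0..1} \<times> S) \<phi>"
  shows "continuous_on S (\<lambda>p. integral {0..1} (\<lambda>\<tau>. \<phi> (\<tau>, p)))"
proof -
  have "continuous_on (S \<times> cbox 0 1) (\<lambda>(p, \<tau>). \<phi> (\<tau>, p))"
    unfolding case_prod_beta by (rule continuous_on_compose2[OF assms]) (auto intro!: continuous_intros)
  from integral_continuous_on_param[OF this] show ?thesis by simp
qed

lemma continuous_on_segment_mean:
  assumes "continuous_on S \<phi>" "convex S"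
  shows "continuous_on (S \<times> S) (\<lambda>(p, q). segment_mean \<phi> p q)"
proof -
  have "continuous_on ({0..1} \<times> (S \<times> S)) (\<lambda>(\<tau>, p, q). \<phi> (p + \<tau> *\<^sub>R (q - p)))"
    unfolding case_prod_beta
    by (rule continuous_on_compose2[OF assms(1)])
       (auto intro!: continuous_intros convex_segment_mem[OF assms(2), simplified])
  from continuous_on_integral_param[OF this] show ?thesis
    by (simp add: segment_mean_def case_prod_beta)
qed

text \<open>
  Hadamard's lemma and its converse: being differentiable amounts to writing differences as combinations
  of the coordinate increments with continuous coefficients. All later differentiability and uniqueness
  proofs exhibit such coefficients instead of estimating remainders.
\<close>

lemma difference_eq_segment_mean:
  assumes S: "convex S" "p \<in> S" "q \<in> S"
    and F: "\<And>p. p \<in> S \<Longrightarrow> has_partials F A p S"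
    and A: "\<And>b. b \<in> Basis \<Longrightarrow> continuous_on S (A b)"
  shows "F q - F p = (\<Sum>b\<in>Basis. ((q - p) \<bullet> b) * segment_mean (A b) p q)"
proof -
  let ?c = "\<lambda>\<tau>. p + \<tau> *\<^sub>R (q - p)"
  have mem: "?c ` {0..1} \<subseteq> S" using convex_segment_mem[OF S] by auto
  have "((\<lambda>\<tau>. F (?c \<tau>)) has_vector_derivative (\<Sum>b\<in>Basis. ((q - p) \<bullet> b) * A b (?c \<tau>))) (at \<tau> within {0..1})"
    if "\<tau> \<in> {0..1}" for \<tau>
  proof -
    have 1: "(?c has_derivative (\<lambda>h. h *\<^sub>R (q - p))) (at \<tau> within {0..1})"
      by (auto intro!: derivative_eq_intros)
    have "(F has_derivative (\<lambda>d. \<Sum>b\<in>Basis. (d \<bullet> b) * A b (?c \<tau>))) (at (?c \<tau>) within ?c ` {0..1})"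
      using F mem that by (blast intro: has_derivative_subset)
    from diff_chain_within[OF 1 this] show ?thesis
      by (simp add: has_vector_derivative_def o_def sum_distrib_left mult.assoc)
  qed
  from fundamental_theorem_of_calculus[OF _ this]
  have "((\<lambda>\<tau>. \<Sum>b\<in>Basis. ((q - p) \<bullet> b) * A b (?c \<tau>)) has_integral (F q - F p)) {0..1}"
    by simp
  then have "F q - F p = integral {0..1} (\<lambda>\<tau>. \<Sum>b\<in>Basis. ((q - p) \<bullet> b) * A b (?c \<tau>))"
    by (simp add: integral_unique)
  also have "\<dots> = (\<Sum>b\<in>Basis. integral {0..1} (\<lambda>\<tau>. ((q - p) \<bullet> b) * A b (?c \<tau>)))"
  proof (rule integral_sum)
    fix b :: 'a assume "b \<in> Basis"
    then have "continuous_on {0..1} (\<lambda>\<tau>. A b (?c \<tau>))"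
      using mem by (intro continuous_on_compose2[OF A[of b], of "{0..1}" ?c]) (auto intro!: continuous_intros)
    then show "(\<lambda>\<tau>. (q - p) \<bullet> b * A b (?c \<tau>)) integrable_on {0..1}"
      by (intro integrable_continuous_real continuous_intros)
  qed simp
  finally show ?thesis by (simp add: segment_mean_def)
qed

lemma has_derivative_difference_form:
  fixes F :: "'a::euclidean_space \<Rightarrow> real"
  assumes eq: "\<And>q. q \<in> S \<Longrightarrow> F q - F p = (\<Sum>b\<in>Basis. ((q - p) \<bullet> b) * B b q)"
    and B: "\<And>b. b \<in> Basis \<Longrightarrow> continuous (at p within S) (B b)" and p: "p \<in> S"
  shows "has_partials F B p S"
proof -
  have "((\<lambda>q. \<Sum>b\<in>Basis. \<bar>B b q - B b p\<bar>) \<longlongrightarrow> (\<Sum>b\<in>(Basis::'a set). \<bar>B b p - B b p\<bar>)) (at p within S)"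
    using B by (intro tendsto_intros) (auto simp: continuous_within)
  then have lim: "((\<lambda>q. \<Sum>b\<in>Basis. \<bar>B b q - B b p\<bar>) \<longlongrightarrow> 0) (at p within S)" by simp
  have "norm ((F q - F p - (\<Sum>b\<in>Basis. ((q - p) \<bullet> b) * B b p)) /\<^sub>R norm (q - p)) \<le> (\<Sum>b\<in>Basis. \<bar>B b q - B b p\<bar>)"
    if "q \<in> S" "q \<noteq> p" for q
  proof -
    have "F q - F p - (\<Sum>b\<in>Basis. ((q - p) \<bullet> b) * B b p) = (\<Sum>b\<in>Basis. ((q - p) \<bullet> b) * (B b q - B b p))"
      unfolding eq[OF that(1)] by (simp add: sum_subtractf right_diff_distrib)
    also have "\<bar>\<dots>\<bar> \<le> (\<Sum>b\<in>Basis. norm (q - p) * \<bar>B b q - B b p\<bar>)"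
      by (rule order_trans[OF sum_abs]) (auto intro!: sum_mono mult_right_mono simp: abs_mult Basis_le_norm)
    finally show ?thesis using that
      by (simp add: field_simps sum_distrib_left abs_mult)
  qed
  then have "\<forall>\<^sub>F q in at p within S. norm ((F q - F p - (\<Sum>b\<in>Basis. ((q - p) \<bullet> b) * B b p)) /\<^sub>R norm (q - p)) \<le> (\<Sum>b\<in>Basis. \<bar>B b q - B b p\<bar>)"
    by (auto simp: eventually_at intro: exI[where x=1])
  from tendsto_0_le[OF lim, where K=1] this
  have "((\<lambda>q. (F q - F p - (\<Sum>b\<in>Basis. ((q - p) \<bullet> b) * B b p)) /\<^sub>R norm (q - p)) \<longlongrightarrow> 0) (at p within S)"
    by (intro Lim_null_comparison[OF _ lim]) auto
  moreover have "bounded_linear (\<lambda>d. \<Sum>b\<in>Basis. (d \<bullet> b) * B b p)"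
    by (intro bounded_linear_sum bounded_linear_mult_left[THEN bounded_linear_compose] bounded_linear_inner_left)
  ultimately show ?thesis by (simp add: has_derivative_at_within)
qed

text \<open>Differentiation under the integral: the Hadamard identity for \<phi> is integrated in
  \<tau>, and the integrated coefficients are again continuous. For fixed \<tau> the increment has
  no \<tau> component, hence only the directions \<open>(0, b)\<close> occur.\<close>

lemma C_k_on_integral_param:
  fixes \<phi> :: "real \<times> 'a::euclidean_space \<Rightarrow> real"
  assumes S: "convex S"
  shows "C_k_on k \<phi> ({0..1} \<times> S) \<Longrightarrow> C_k_on k (\<lambda>p. integral {0..1} (\<lambda>\<tau>. \<phi> (\<tau>, p))) S"
proof (induction k arbitrary: \<phi>)
  case 0
  then show ?case using continuous_on_integral_param by auto
next
  case (Suc k)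
  let ?D = "{0..1::real} \<times> S"
  have D: "convex ?D" using S by (intro convex_Times) auto
  obtain A where A: "\<And>p. p \<in> ?D \<Longrightarrow> has_partials \<phi> A p ?D"
    "\<And>b. b \<in> Basis \<Longrightarrow> C_k_on k (A b) ?D" by (rule C_k_on_SucE[OF Suc.prems], rule that)
  have contA: "\<And>b. b \<in> Basis \<Longrightarrow> continuous_on ?D (A b)" using A(2) C_k_on_continuous by blast
  have cont\<phi>: "continuous_on {0..1} (\<lambda>\<tau>. \<phi> (\<tau>, p))" if "p \<in> S" for p
    using that by (intro continuous_on_compose2[OF C_k_on_continuous[OF Suc.prems]]) (auto intro!: continuous_intros)
  let ?F = "\<lambda>p. integral {0..1} (\<lambda>\<tau>. \<phi> (\<tau>, p))"
  \<comment> \<open>On the diagonal \<open>q = p\<close> this is the parameter integral of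
    \<open>A (0, b)\<close>, to which the induction hypothesis applies.\<close>
  define B where "B b p q = integral {0..1} (\<lambda>\<tau>. segment_mean (A (0, b)) (\<tau>, p) (\<tau>, q))" for b p q
  have contB: "continuous_on (S \<times> S) (\<lambda>(p, q). B b p q)"
   and contm: "continuous_on ({0..1} \<times> (S \<times> S)) (\<lambda>(\<tau>, p, q). segment_mean (A (0, b)) (\<tau>, p) (\<tau>, q))"
    if b: "b \<in> Basis" for b
  proof -
    show "continuous_on ({0..1} \<times> (S \<times> S)) (\<lambda>(\<tau>, p, q). segment_mean (A (0, b)) (\<tau>, p) (\<tau>, q))"
    proof -
      have "(0, b) \<in> Basis" using b by (simp add: Basis_prod_def)
      then have 1: "continuous_on (?D \<times> ?D) (\<lambda>(p, q). segment_mean (A (0, b)) p q)"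
        by (rule continuous_on_segment_mean[OF contA D])
      have 2: "continuous_on ({0..1} \<times> (S \<times> S)) (\<lambda>x. ((fst x, fst (snd x)), (fst x, snd (snd x))))"
        by (intro continuous_intros)
      have 3: "(\<lambda>x. ((fst x, fst (snd x)), (fst x, snd (snd x)))) ` ({0..1} \<times> (S \<times> S)) \<subseteq> ?D \<times> ?D"
        by auto
      show ?thesis using continuous_on_compose2[OF 1 2 3] by (simp add: case_prod_beta)
    qed
    from continuous_on_integral_param[OF this]
    show "continuous_on (S \<times> S) (\<lambda>(p, q). B b p q)" by (simp add: B_def case_prod_beta)
  qed
  have "(?F has_derivative (\<lambda>d. \<Sum>b\<in>Basis. (d \<bullet> b) * B b p p)) (at p within S)" if p: "p \<in> S" for p
  proof (rule has_derivative_difference_form[where B="\<lambda>b. B b p", OF _ _ p])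
    fix q assume q: "q \<in> S"
    have "?F q - ?F p = integral {0..1} (\<lambda>\<tau>. \<phi> (\<tau>, q) - \<phi> (\<tau>, p))"
      using cont\<phi> p q by (intro integral_diff[symmetric] integrable_continuous_real) auto
    also have "\<dots> = integral {0..1} (\<lambda>\<tau>. \<Sum>b\<in>Basis. ((q - p) \<bullet> b) * segment_mean (A (0, b)) (\<tau>, p) (\<tau>, q))"
    proof (rule integral_cong)
      fix \<tau> :: real assume "\<tau> \<in> {0..1}"
      then have "\<phi> (\<tau>, q) - \<phi> (\<tau>, p) = (\<Sum>b\<in>Basis. (((\<tau>, q) - (\<tau>, p)) \<bullet> b) * segment_mean (A b) (\<tau>, p) (\<tau>, q))"
        using p q by (intro difference_eq_segment_mean[OF D _ _ A(1) contA]) auto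
      then show "\<phi> (\<tau>, q) - \<phi> (\<tau>, p) = (\<Sum>b\<in>Basis. ((q - p) \<bullet> b) * segment_mean (A (0, b)) (\<tau>, p) (\<tau>, q))"
        by (simp add: sum_Basis_prod)
    qed
    also have "\<dots> = (\<Sum>b\<in>Basis. integral {0..1} (\<lambda>\<tau>. ((q - p) \<bullet> b) * segment_mean (A (0, b)) (\<tau>, p) (\<tau>, q)))"
    proof (rule integral_sum)
      fix b :: 'a assume "b \<in> Basis"
      then have "continuous_on {0..1} (\<lambda>\<tau>. segment_mean (A (0, b)) (\<tau>, p) (\<tau>, q))"
        using continuous_on_slice1[OF contm, of b "(p, q)"] p q by simp
      then show "(\<lambda>\<tau>. (q - p) \<bullet> b * segment_mean (A (0, b)) (\<tau>, p) (\<tau>, q)) integrable_on {0..1}"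
        by (intro integrable_continuous_real continuous_intros)
    qed simp
    finally show "?F q - ?F p = (\<Sum>b\<in>Basis. ((q - p) \<bullet> b) * B b p q)" by (simp add: B_def)
  next
    fix b :: 'a assume "b \<in> Basis"
    then have "continuous_on S (\<lambda>q. B b p q)"
      using continuous_on_slice2[OF contB, of b p] p by simp
    then show "continuous (at p within S) (B b p)" using p by (simp add: continuous_on_eq_continuous_within)
  qed
  note der = this
  show ?case
  proof (rule C_k_on_SucI[where A="\<lambda>b p. B b p p", OF der])
    fix b :: 'a assume "b \<in> Basis"
    then show "C_k_on k (\<lambda>p. B b p p) S" unfolding B_def using A(2)[of "(0, b)"]
      by (auto simp: Basis_prod_def intro: Suc.IH)
  qed
qed

text \<open>The antiderivative is differentiated along \<tau> instead of substituting in the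
  integral, so that \<sigma> = 0 is included.\<close>

lemma integral_scale_upto:
  fixes g :: "real \<Rightarrow> real"
  assumes g: "continuous_on {0..\<sigma>} g" and \<sigma>: "0 \<le> \<sigma>"
  shows "integral {0..\<sigma>} g = \<sigma> * integral {0..1} (\<lambda>\<tau>. g (\<sigma> * \<tau>))"
proof -
  let ?G = "\<lambda>x. integral {0..x} g"
  have im: "(\<lambda>\<tau>. \<sigma> * \<tau>) ` {0..1} \<subseteq> {0..\<sigma>}"
    using \<sigma> by (auto intro: mult_left_le)
  have "((\<lambda>\<tau>. ?G (\<sigma> * \<tau>)) has_vector_derivative \<sigma> * g (\<sigma> * \<tau>)) (at \<tau> within {0..1})" if "\<tau> \<in> {0..1}" for \<tau>
  proof -
    have "(?G has_vector_derivative g (\<sigma> * \<tau>)) (at (\<sigma> * \<tau>) within {0..\<sigma>})"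
      by (rule integral_has_vector_derivative[OF g]) (use im that in blast)
    then have 1: "(?G has_derivative (\<lambda>h. h * g (\<sigma> * \<tau>))) (at (\<sigma> * \<tau>) within (\<lambda>\<tau>. \<sigma> * \<tau>) ` {0..1})"
      using im by (auto simp: has_vector_derivative_def intro: has_derivative_subset)
    have "((\<lambda>\<tau>. \<sigma> * \<tau>) has_derivative (\<lambda>h. \<sigma> * h)) (at \<tau> within {0..1})"
      by (auto intro!: derivative_eq_intros)
    from diff_chain_within[OF this 1] show ?thesis
      by (simp add: has_vector_derivative_def o_def algebra_simps)
  qed
  from fundamental_theorem_of_calculus[OF _ this]
  have "((\<lambda>\<tau>. \<sigma> * g (\<sigma> * \<tau>)) has_integral (integral {0..\<sigma>} g)) {0..1}" by simp
  from integral_unique[OF this] show ?thesis by simp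
qed

text \<open>Rescaling \<open>{0..\<sigma>}\<close> to \<open>{0..1}\<close> turns the variable upper
  limit into an ordinary parameter of the integrand.\<close>

lemma C_k_on_integral_upto:
  fixes \<phi> :: "real \<times> 'a::euclidean_space \<Rightarrow> real"
  assumes S: "convex S" and \<phi>: "C_k_on k \<phi> ({0..1} \<times> S)"
  shows "C_k_on k (\<lambda>y. integral {0..fst y} (\<lambda>s. \<phi> (s, snd y))) ({0..1} \<times> S)"
proof -
  have "C_k_on k (\<lambda>x. \<phi> (fst (snd x) * fst x, snd (snd x))) ({0..1} \<times> ({0..1} \<times> S))"
    by (rule C_k_on_compose[OF \<phi> comp_C_k_Pair[OF comp_C_k_UNIV_real[THEN iffD2, OF C_k_on_mult] comp_C_k_linear]])
       (auto intro!: C_k_on_linear bounded_linear_fst bounded_linear_fst_comp bounded_linear_snd_comp bounded_linear_snd mult_le_one)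
  from C_k_on_integral_param[OF _ this] S
  have "C_k_on k (\<lambda>x. fst x * integral {0..1} (\<lambda>\<tau>. \<phi> (fst x * \<tau>, snd x))) ({0..1} \<times> S)"
    by (intro C_k_on_mult C_k_on_fst) (auto intro: convex_Times)
  then show ?thesis
  proof (rule C_k_on_cong)
    fix x :: "real \<times> 'a" assume x: "x \<in> {0..1} \<times> S"
    have "continuous_on {0..fst x} (\<lambda>s. \<phi> (s, snd x))"
      using x by (intro continuous_on_compose2[OF C_k_on_continuous[OF \<phi>]]) (auto intro!: continuous_intros)
    from integral_scale_upto[OF this] x
    show "fst x * integral {0..1} (\<lambda>\<tau>. \<phi> (fst x * \<tau>, snd x)) = integral {0..fst x} (\<lambda>s. \<phi> (s, snd x))"
      by (auto simp: case_prod_beta)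
  qed
qed

section \<open>Dependence of scalar initial value problems on parameters\<close>

text \<open>Integrating factor. The formula serves twice: with \<beta> linear in a parameter
  increment it gives the derivative of a solution, and with \<beta> = 0 it gives uniqueness.\<close>

lemma linear_ode_solution:
  fixes \<Delta> \<alpha> \<beta> :: "real \<Rightarrow> real"
  assumes \<alpha>: "continuous_on {0..T} \<alpha>" and \<beta>: "continuous_on {0..T} \<beta>"
    and 0: "\<Delta> 0 = 0" and \<sigma>: "\<sigma> \<in> {0..T}"
    and der: "\<And>s. s \<in> {0..T} \<Longrightarrow> (\<Delta> has_real_derivative \<alpha> s * \<Delta> s + \<beta> s) (at s within {0..T})"
  shows "\<Delta> \<sigma> = exp (integral {0..\<sigma>} \<alpha>) * integral {0..\<sigma>} (\<lambda>s. exp (- integral {0..s} \<alpha>) * \<beta> s)"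
proof -
  let ?I = "\<lambda>s. integral {0..s} \<alpha>"
  have "((\<lambda>s. exp (- ?I s) * \<Delta> s) has_vector_derivative exp (- ?I s) * \<beta> s) (at s within {0..\<sigma>})" if s: "s \<in> {0..\<sigma>}" for s
  proof -
    have s': "s \<in> {0..T}" using s \<sigma> by auto
    have "(?I has_real_derivative \<alpha> s) (at s within {0..T})"
      using integral_has_vector_derivative[OF \<alpha> s'] by (simp add: has_real_derivative_iff_has_vector_derivative)
    then have "((\<lambda>s. exp (- ?I s) * \<Delta> s) has_real_derivative exp (- ?I s) * \<beta> s) (at s within {0..T})"
      using der[OF s'] by (auto intro!: derivative_eq_intros simp: algebra_simps)
    then have "((\<lambda>s. exp (- ?I s) * \<Delta> s) has_real_derivative exp (- ?I s) * \<beta> s) (at s within {0..\<sigma>})"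
      by (rule DERIV_subset) (use \<sigma> in auto)
    then show ?thesis by (simp add: has_real_derivative_iff_has_vector_derivative)
  qed
  from fundamental_theorem_of_calculus[OF _ this]
  have "integral {0..\<sigma>} (\<lambda>s. exp (- ?I s) * \<beta> s) = exp (- ?I \<sigma>) * \<Delta> \<sigma>"
    using \<sigma> 0 by (auto simp: integral_unique)
  then show ?thesis by (simp add: exp_minus)
qed

text \<open>
  The difference of two solutions solves a scalar linear equation whose coefficients are segment means
  of the partial derivatives of \<open>F\<close>; its explicit solution is linear in the increment of the
  parameter. Being scalar, the formula for the partial derivatives of \<open>u\<close> only involves integrals and
  exponentials of functions of \<open>u\<close>, so that the induction on \<open>k\<close> stays within scalar equations.
\<close>

theorem C_k_on_ode_solution:
  fixes F :: "real \<times> real \<times> 'a::euclidean_space \<Rightarrow> real" and u :: "real \<times> 'a \<Rightarrow> real"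
  assumes P: "convex P" and J: "convex J"
    and u_cont: "continuous_on ({0..1} \<times> P) u"
    and u_mem: "\<And>s p. s \<in> {0..1} \<Longrightarrow> p \<in> P \<Longrightarrow> u (s, p) \<in> J"
    and u_eq: "\<And>\<sigma> p. \<sigma> \<in> {0..1} \<Longrightarrow> p \<in> P \<Longrightarrow> u (\<sigma>, p) = integral {0..\<sigma>} (\<lambda>s. F (s, u (s, p), p))"
  shows "C_k_on k F ({0..1} \<times> J \<times> P) \<Longrightarrow> C_k_on k u ({0..1} \<times> P)"
proof (induction k)
  case 0
  show ?case using u_cont by simp
next
  case (Suc k)
  define I where "I = {0..1::real}"
  define D where "D = I \<times> J \<times> P"
  have D: "convex D" unfolding D_def I_def using P J by (intro convex_Times) auto
  have IP: "convex (I \<times> P)" and PP: "convex (P \<times> P)" unfolding I_def using P by (auto intro: convex_Times)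
  have u: "C_k_on k u (I \<times> P)" unfolding I_def by (rule Suc.IH[OF C_k_on_Suc_imp[OF Suc.prems]])
  have FD: "C_k_on (Suc k) F D" using Suc.prems by (simp only: D_def I_def)
  obtain A where A: "\<And>p. p \<in> D \<Longrightarrow> has_partials F A p D"
    "\<And>b. b \<in> Basis \<Longrightarrow> C_k_on k (A b) D" by (rule C_k_on_SucE[OF FD], rule that)
  have contA: "\<And>b. b \<in> Basis \<Longrightarrow> continuous_on D (A b)" by (rule C_k_on_continuous[OF A(2)])
  define w where "w y = (fst y, u y, snd y)" for y
  have w_mem: "w y \<in> D" if "y \<in> I \<times> P" for y using that u_mem by (auto simp: w_def D_def I_def)
  have w: "comp_C_k k UNIV w (I \<times> P)" unfolding w_def
    by (intro comp_C_k_Pair comp_C_k_UNIV_real[THEN iffD2, OF u] comp_C_k_linear bounded_linear_fst bounded_linear_snd)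
  have w_cont: "continuous_on (I \<times> P) w" unfolding w_def using u_cont by (auto intro!: continuous_intros simp: I_def)
  define \<phi> where "\<phi> y = F (w y)" for y
  have \<phi>: "C_k_on k \<phi> (I \<times> P)" unfolding \<phi>_def
    by (rule C_k_on_compose[OF C_k_on_Suc_imp[OF FD] w w_mem])
  have \<phi>_cont: "continuous_on (I \<times> P) \<phi>" by (rule C_k_on_continuous[OF \<phi>])
  have u_der: "((\<lambda>s. u (s, p)) has_real_derivative \<phi> (s, p)) (at s within I)" if "s \<in> I" "p \<in> P" for s p
  proof -
    have "continuous_on {0..1} (\<lambda>s. \<phi> (s, p))"
      using continuous_on_slice1[OF \<phi>_cont that(2)] by (simp add: I_def)
    from integral_has_vector_derivative[OF this] that(1)
    have "((\<lambda>s. integral {0..s} (\<lambda>s. \<phi> (s, p))) has_real_derivative \<phi> (s, p)) (at s within I)"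
      by (simp add: has_real_derivative_iff_has_vector_derivative I_def)
    then show ?thesis unfolding has_field_derivative_def
    proof (rule has_derivative_transform[rotated 2])
      show "s \<in> I" by fact
      show "u (x, p) = integral {0..x} (\<lambda>s. \<phi> (s, p))" if "x \<in> I" for x
        using u_eq[of x p] that \<open>p \<in> P\<close> by (simp add: \<phi>_def w_def I_def)
    qed
  qed
  \<comment> \<open>Two-point coefficients: means of the partial derivatives of \<open>F\<close>
    over the segment joining the solutions for two parameters at the same time.\<close>
  define m where "m b y = segment_mean (A b) (w (fst y, fst (snd y))) (w (fst y, snd (snd y)))" for b and y :: "real \<times> 'a \<times> 'a"
  have m_cont: "continuous_on (I \<times> (P \<times> P)) (m b)" if "b \<in> Basis" for b
  proof -
    have 1: "continuous_on (D \<times> D) (\<lambda>(p, q). segment_mean (A b) p q)"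
      by (rule continuous_on_segment_mean[OF contA[OF that] D])
    have 2: "continuous_on (I \<times> (P \<times> P)) (\<lambda>y. (w (fst y, fst (snd y)), w (fst y, snd (snd y))))"
      by (intro continuous_intros continuous_on_compose2[OF w_cont]) auto
    have 3: "(\<lambda>y. (w (fst y, fst (snd y)), w (fst y, snd (snd y)))) ` (I \<times> (P \<times> P)) \<subseteq> D \<times> D"
      using w_mem by auto
    show ?thesis using continuous_on_compose2[OF 1 2 3] by (simp add: m_def[abs_def] case_prod_beta)
  qed
  have upto: "continuous_on (I \<times> S) (\<lambda>y. integral {0..fst y} (\<lambda>s. \<psi> (s, snd y)))"
    if "continuous_on (I \<times> S) \<psi>" "convex S" for \<psi> :: "real \<times> 'a \<times> 'a \<Rightarrow> real" and S
    using C_k_on_integral_upto[of S 0 \<psi>] that by (simp add: I_def)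
  define \<alpha> where "\<alpha> = m (0, 1, 0)"
  define i where "i y = integral {0..fst y} (\<lambda>s. \<alpha> (s, snd y))" for y
  \<comment> \<open>Solution of the linearised equation driven by the direction c, in two-point
    form; for equal parameters it becomes a partial derivative of u.\<close>
  define V where "V c y = exp (i y) * integral {0..fst y} (\<lambda>s. exp (- i (s, snd y)) * m (0, 0, c) (s, snd y))" for c y
  have basis: "(0, 1, 0) \<in> (Basis :: (real \<times> real \<times> 'a) set)" "\<And>c. c \<in> Basis \<Longrightarrow> (0, 0, c) \<in> (Basis :: (real \<times> real \<times> 'a) set)"
    by (auto simp: Basis_prod_def)
  have i_cont: "continuous_on (I \<times> (P \<times> P)) i"
    unfolding i_def[abs_def] \<alpha>_def by (rule upto[OF m_cont[OF basis(1)] PP])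
  have g_cont: "continuous_on (I \<times> (P \<times> P)) (\<lambda>y. exp (- i y) * m (0, 0, c) y)" if "c \<in> Basis" for c
    by (intro continuous_intros i_cont m_cont basis that)
  have V_cont: "continuous_on (I \<times> (P \<times> P)) (V c)" if "c \<in> Basis" for c
    unfolding V_def[abs_def]
    by (intro continuous_intros i_cont upto[OF g_cont[OF that] PP, simplified])
  have u_diff: "u (\<sigma>, q) - u (\<sigma>, p) = (\<Sum>c\<in>Basis. ((q - p) \<bullet> c) * V c (\<sigma>, p, q))"
    if \<sigma>: "\<sigma> \<in> I" and pq: "p \<in> P" "q \<in> P" for \<sigma> p q
  proof -
    define \<beta> where "\<beta> s = (\<Sum>c\<in>Basis. ((q - p) \<bullet> c) * m (0, 0, c) (s, p, q))" for s
    have mI: "continuous_on I (\<lambda>s. m b (s, p, q))" if "b \<in> Basis" for b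
      using continuous_on_slice1[OF m_cont[OF that]] pq by simp
    have "u (\<sigma>, q) - u (\<sigma>, p) = exp (integral {0..\<sigma>} (\<lambda>s. \<alpha> (s, p, q))) *
        integral {0..\<sigma>} (\<lambda>s. exp (- integral {0..s} (\<lambda>s. \<alpha> (s, p, q))) * \<beta> s)"
    proof (rule linear_ode_solution[where T=1])
      show "continuous_on {0..1} (\<lambda>s. \<alpha> (s, p, q))" using mI[OF basis(1)] by (simp add: \<alpha>_def I_def)
      show "continuous_on {0..1} \<beta>" unfolding \<beta>_def
        using mI[OF basis(2)] by (intro continuous_intros) (simp add: I_def)
      show "u (0, q) - u (0, p) = 0" using u_eq[of 0] pq by simp
      show "\<sigma> \<in> {0..1}" using \<sigma> by (simp add: I_def)
      fix s :: real assume s: "s \<in> {0..1}"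
      have "((\<lambda>s. u (s, q) - u (s, p)) has_real_derivative \<phi> (s, q) - \<phi> (s, p)) (at s within {0..1})"
        using u_der[of s q] u_der[of s p] s pq by (auto intro!: derivative_eq_intros simp: I_def)
      moreover have "\<phi> (s, q) - \<phi> (s, p) = (\<Sum>b\<in>Basis. ((w (s, q) - w (s, p)) \<bullet> b) * segment_mean (A b) (w (s, p)) (w (s, q)))"
        unfolding \<phi>_def using w_mem s pq by (intro difference_eq_segment_mean[OF D _ _ A(1) contA]) (auto simp: I_def)
      moreover have "\<dots> = \<alpha> (s, p, q) * (u (s, q) - u (s, p)) + \<beta> s"
        unfolding sum_Basis_prod by (simp add: w_def \<alpha>_def m_def \<beta>_def zero_prod_def[symmetric])
      ultimately show "((\<lambda>s. u (s, q) - u (s, p)) has_real_derivative \<alpha> (s, p, q) * (u (s, q) - u (s, p)) + \<beta> s) (at s within {0..1})"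
        by simp
    qed
    also have "integral {0..\<sigma>} (\<lambda>s. exp (- integral {0..s} (\<lambda>s. \<alpha> (s, p, q))) * \<beta> s)
       = integral {0..\<sigma>} (\<lambda>s. \<Sum>c\<in>Basis. ((q - p) \<bullet> c) * (exp (- i (s, p, q)) * m (0, 0, c) (s, p, q)))"
      unfolding \<beta>_def i_def sum_distrib_left by (simp add: mult.left_commute)
    also have "\<dots> = (\<Sum>c\<in>Basis. integral {0..\<sigma>} (\<lambda>s. ((q - p) \<bullet> c) * (exp (- i (s, p, q)) * m (0, 0, c) (s, p, q))))"
    proof (rule integral_sum)
      fix c :: 'a assume "c \<in> Basis"
      then have "continuous_on I (\<lambda>s. exp (- i (s, p, q)) * m (0, 0, c) (s, p, q))"
        using continuous_on_slice1[OF g_cont, of c "(p, q)"] pq by simp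
      then have "continuous_on {0..\<sigma>} (\<lambda>s. exp (- i (s, p, q)) * m (0, 0, c) (s, p, q))"
        using \<sigma> by (auto simp: I_def intro: continuous_on_subset)
      then show "(\<lambda>s. ((q - p) \<bullet> c) * (exp (- i (s, p, q)) * m (0, 0, c) (s, p, q))) integrable_on {0..\<sigma>}"
        by (intro integrable_continuous_real continuous_on_mult_left)
    qed simp
    finally show ?thesis by (simp add: V_def i_def sum_distrib_left mult.left_commute)
  qed
  define B where "B b y = fst b * \<phi> y + (\<Sum>c\<in>Basis. (snd b \<bullet> c) * V c (fst y, snd y, snd y))" for b y
  have der: "has_partials u B y (I \<times> P)" if y: "y \<in> I \<times> P" for y
  proof -
    obtain \<sigma> p where y_eq: "y = (\<sigma>, p)" by (cases y)
    then have \<sigma>: "\<sigma> \<in> I" and p: "p \<in> P" using y by auto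
    \<comment> \<open>The increment from \<open>(\<sigma>, p)\<close> to \<open>(s, q)\<close> is
      split at \<open>(\<sigma>, q)\<close>: \<open>M\<close> carries the change of time at the new
      parameter q, and \<open>V\<close> the change of parameter at the old time \<sigma>.\<close>
    define M where "M z = segment_mean (\<lambda>s. \<phi> (s, snd z)) \<sigma> (fst z)" for z
    define C where "C b z = fst b * M z + (\<Sum>c\<in>Basis. (snd b \<bullet> c) * V c (\<sigma>, p, snd z))" for b z
    have M_cont: "continuous_on (I \<times> P) M"
    proof -
      have "continuous_on ({0..1} \<times> (I \<times> P)) (\<lambda>x. \<phi> (\<sigma> + fst x *\<^sub>R (fst (snd x) - \<sigma>), snd (snd x)))"
      proof (rule continuous_on_compose2[OF \<phi>_cont])
        show "(\<lambda>x. (\<sigma> + fst x *\<^sub>R (fst (snd x) - \<sigma>), snd (snd x))) ` ({0..1} \<times> (I \<times> P)) \<subseteq> I \<times> P"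
        proof safe
          fix \<tau> s q assume "\<tau> \<in> {0..1::real}" "s \<in> I" 
          then have "\<sigma> + \<tau> *\<^sub>R (s - \<sigma>) \<in> I" using convex_segment_mem[of I \<sigma> s \<tau>] \<sigma> by (simp add: I_def)
          then show "\<sigma> + fst (\<tau>, s, q) *\<^sub>R (fst (snd (\<tau>, s, q)) - \<sigma>) \<in> I" by simp
        qed auto
      qed (intro continuous_intros)
      from continuous_on_integral_param[OF this] show ?thesis
        unfolding M_def[abs_def] segment_mean_def by simp
    qed
    have "has_partials u C y (I \<times> P)"
    proof (rule has_derivative_difference_form[where B=C, OF _ _ y])
      fix z assume "z \<in> I \<times> P"
      then obtain s q where z: "z = (s, q)" "s \<in> I" "q \<in> P" by auto
      have "u (s, q) - u (\<sigma>, q) = (\<Sum>b\<in>Basis. ((s - \<sigma>) \<bullet> b) * segment_mean (\<lambda>s. \<phi> (s, q)) \<sigma> s)"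
      proof (rule difference_eq_segment_mean[where F="\<lambda>s. u (s, q)" and A="\<lambda>_ s. \<phi> (s, q)" and S=I])
        show "((\<lambda>s. u (s, q)) has_derivative (\<lambda>d. \<Sum>b\<in>Basis. d \<bullet> b * \<phi> (x, q))) (at x within I)" if "x \<in> I" for x
          by (rule has_derivative_eq_rhs[OF u_der[OF that z(3), unfolded has_field_derivative_def]]) (simp add: fun_eq_iff)
        show "continuous_on I (\<lambda>s. \<phi> (s, q))" by (rule continuous_on_slice1[OF \<phi>_cont z(3)])
      qed (use \<sigma> z in \<open>auto simp: I_def\<close>)
      then show "u z - u y = (\<Sum>b\<in>Basis. ((z - y) \<bullet> b) * C b z)"
        using u_diff[OF \<sigma> p z(3)] unfolding sum_Basis_prod
        by (simp add: z(1) y_eq C_def M_def inner_Basis if_distrib if_distribR sum.delta cong: if_cong)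
    next
      fix b :: "real \<times> 'a"
      have "continuous_on (I \<times> P) (C b)" unfolding C_def
        by (intro continuous_intros M_cont continuous_on_compose2[OF V_cont]) (use \<sigma> p in auto)
      then show "continuous (at y within I \<times> P) (C b)" using y unfolding continuous_on_eq_continuous_within by blast
    qed
    moreover have "C b y = B b y" for b by (simp add: C_def B_def M_def y_eq)
    ultimately show ?thesis by simp
  qed
  show ?case unfolding I_def[symmetric]
  proof (rule C_k_on_SucI[where A=B, OF der])
    fix b :: "real \<times> 'a"
    have m: "C_k_on k (\<lambda>y. A b (w y)) (I \<times> P)" if "b \<in> Basis" for b
      by (rule C_k_on_compose[OF A(2)[OF that] w w_mem])
    have upto: "C_k_on k (\<lambda>y. integral {0..fst y} (\<lambda>s. \<psi> (s, snd y))) (I \<times> P)"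
      if "C_k_on k \<psi> (I \<times> P)" for \<psi>
      using C_k_on_integral_upto[of P k \<psi>] P that by (simp add: I_def del: C_k_on.simps)
    have m_diag: "m b (s, p, p) = A b (w (s, p))" for b s p by (simp add: m_def)
    have i: "C_k_on k (\<lambda>y. i (fst y, snd y, snd y)) (I \<times> P)"
      using upto[OF m[OF basis(1)]] by (simp add: i_def \<alpha>_def m_diag)
    have V: "C_k_on k (\<lambda>y. V c (fst y, snd y, snd y)) (I \<times> P)" if "c \<in> Basis" for c
    proof -
      have "C_k_on k (\<lambda>y. exp (- i (fst y, snd y, snd y)) * A (0, 0, c) (w y)) (I \<times> P)"
        by (rule C_k_on_mult[OF C_k_on_exp[OF C_k_on_minus[OF i]] m[OF basis(2)[OF that]]])
      from C_k_on_mult[OF C_k_on_exp[OF i] upto[OF this]]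
      show ?thesis by (simp add: V_def m_diag)
    qed
    have sum: "C_k_on k (\<lambda>y. \<Sum>c\<in>C. (snd b \<bullet> c) * V c (fst y, snd y, snd y)) (I \<times> P)" if "finite C" "C \<subseteq> Basis" for C
      using that
    proof (induction C rule: finite_induct)
      case empty show ?case by (simp add: C_k_on_const del: C_k_on.simps)
    next
      case (insert x F)
      then show ?case
        using C_k_on_add[OF C_k_on_mult[OF C_k_on_const[of k "snd b \<bullet> x"] V[of x]], of "\<lambda>y. \<Sum>c\<in>F. (snd b \<bullet> c) * V c (fst y, snd y, snd y)"]
        by (simp del: C_k_on.simps)
    qed
    show "C_k_on k (B b) (I \<times> P)" unfolding B_def
      by (rule C_k_on_add[OF C_k_on_mult[OF C_k_on_const \<phi>] sum]) auto
  qed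
qed

section \<open>Flat functions and Picard iteration\<close>

text \<open>The weight q is to vanish on the singular set. Only points with q > 0 are tested,
  because the formulas of interest divide by q.\<close>

definition poly_growth :: "('a \<Rightarrow> real) \<Rightarrow> 'a set \<Rightarrow> ('a \<Rightarrow> real) set" where
  "poly_growth q D = {\<phi>. \<exists>n C. \<forall>p\<in>D. q p > 0 \<longrightarrow> \<bar>\<phi> p\<bar> \<le> C * inverse (q p) ^ n}"

definition flat_at_zero :: "('a \<Rightarrow> real) \<Rightarrow> 'a set \<Rightarrow> ('a \<Rightarrow> real) set" where
  "flat_at_zero q D = {\<phi>. \<forall>n. \<exists>C. \<forall>p\<in>D. q p > 0 \<longrightarrow> \<bar>\<phi> p\<bar> \<le> C * q p ^ n}"

lemma poly_growth_bounded: "(\<And>p. p \<in> D \<Longrightarrow> q p > 0 \<Longrightarrow> \<bar>\<phi> p\<bar> \<le> C) \<Longrightarrow> \<phi> \<in> poly_growth q D"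
  unfolding poly_growth_def by (auto intro!: exI[where x=0] exI[where x=C])

lemma poly_growth_mult:
  assumes "\<phi> \<in> poly_growth q D" "\<psi> \<in> poly_growth q D"
  shows "(\<lambda>p. \<phi> p * \<psi> p) \<in> poly_growth q D"
proof -
  obtain n C where C: "\<forall>p\<in>D. q p > 0 \<longrightarrow> \<bar>\<phi> p\<bar> \<le> C * inverse (q p) ^ n" using assms unfolding poly_growth_def by auto
  obtain m E where E: "\<forall>p\<in>D. q p > 0 \<longrightarrow> \<bar>\<psi> p\<bar> \<le> E * inverse (q p) ^ m" using assms unfolding poly_growth_def by auto
  have "\<bar>\<phi> p * \<psi> p\<bar> \<le> (C * E) * inverse (q p) ^ (n + m)" if "p \<in> D" "q p > 0" for p
  proof -
    have "\<bar>\<phi> p\<bar> * \<bar>\<psi> p\<bar> \<le> (C * inverse (q p) ^ n) * (E * inverse (q p) ^ m)"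
      using C E that order_trans[OF abs_ge_zero] by (intro mult_mono) blast+
    then show ?thesis by (simp add: abs_mult power_add algebra_simps)
  qed
  then show ?thesis unfolding poly_growth_def by blast
qed

text \<open>\<open>q p \<le> 1\<close> makes larger powers of 1/q dominate smaller ones, so that two
  bounds of different order can be added.\<close>

lemma poly_growth_add:
  assumes q: "\<And>p. p \<in> D \<Longrightarrow> q p \<le> 1" and "\<phi> \<in> poly_growth q D" "\<psi> \<in> poly_growth q D"
  shows "(\<lambda>p. \<phi> p + \<psi> p) \<in> poly_growth q D"
proof -
  obtain n C where C: "\<forall>p\<in>D. q p > 0 \<longrightarrow> \<bar>\<phi> p\<bar> \<le> C * inverse (q p) ^ n" using assms unfolding poly_growth_def by auto
  obtain m E where E: "\<forall>p\<in>D. q p > 0 \<longrightarrow> \<bar>\<psi> p\<bar> \<le> E * inverse (q p) ^ m" using assms unfolding poly_growth_def by auto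
  have "\<bar>\<phi> p + \<psi> p\<bar> \<le> (\<bar>C\<bar> + \<bar>E\<bar>) * inverse (q p) ^ (n + m)" if p: "p \<in> D" "q p > 0" for p
  proof -
    have 1: "1 \<le> inverse (q p)" using q p by (simp add: one_le_inverse)
    have "\<bar>\<phi> p\<bar> \<le> C * inverse (q p) ^ n" using C p by blast
    also have "\<dots> \<le> \<bar>C\<bar> * inverse (q p) ^ (n + m)"
      using 1 p by (intro mult_mono power_increasing) auto
    finally have a: "\<bar>\<phi> p\<bar> \<le> \<bar>C\<bar> * inverse (q p) ^ (n + m)" .
    have "\<bar>\<psi> p\<bar> \<le> E * inverse (q p) ^ m" using E p by blast
    also have "\<dots> \<le> \<bar>E\<bar> * inverse (q p) ^ (n + m)"
      using 1 p by (intro mult_mono power_increasing) auto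
    finally show ?thesis using a by (simp add: distrib_right)
  qed
  then show ?thesis unfolding poly_growth_def by blast
qed

lemma flat_at_zero_add:
  assumes "\<phi> \<in> flat_at_zero q D" "\<psi> \<in> flat_at_zero q D"
  shows "(\<lambda>p. \<phi> p + \<psi> p) \<in> flat_at_zero q D"
  unfolding flat_at_zero_def
proof safe
  fix n
  obtain C where C: "\<forall>p\<in>D. q p > 0 \<longrightarrow> \<bar>\<phi> p\<bar> \<le> C * q p ^ n" using assms unfolding flat_at_zero_def by blast
  obtain E where E: "\<forall>p\<in>D. q p > 0 \<longrightarrow> \<bar>\<psi> p\<bar> \<le> E * q p ^ n" using assms unfolding flat_at_zero_def by blast
  have "\<bar>\<phi> p + \<psi> p\<bar> \<le> (C + E) * q p ^ n" if "p \<in> D" "q p > 0" for p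
  proof -
    have "\<bar>\<phi> p\<bar> \<le> C * q p ^ n" "\<bar>\<psi> p\<bar> \<le> E * q p ^ n" using C E that by auto
    then show ?thesis by (simp add: distrib_right)
  qed
  then show "\<exists>C. \<forall>p\<in>D. 0 < q p \<longrightarrow> \<bar>\<phi> p + \<psi> p\<bar> \<le> C * q p ^ n" by blast
qed

text \<open>The powers of 1/q lost to \<psi> are regained, because a flat function is bounded by a
  multiple of every power of q.\<close>

lemma flat_at_zero_mult:
  assumes "\<phi> \<in> flat_at_zero q D" "\<psi> \<in> poly_growth q D"
  shows "(\<lambda>p. \<phi> p * \<psi> p) \<in> flat_at_zero q D"
  unfolding flat_at_zero_def
proof safe
  fix n
  obtain m E where E: "\<forall>p\<in>D. q p > 0 \<longrightarrow> \<bar>\<psi> p\<bar> \<le> E * inverse (q p) ^ m" using assms unfolding poly_growth_def by auto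
  obtain C where C: "\<forall>p\<in>D. q p > 0 \<longrightarrow> \<bar>\<phi> p\<bar> \<le> C * q p ^ (n + m)" using assms unfolding flat_at_zero_def by blast
  have "\<bar>\<phi> p * \<psi> p\<bar> \<le> (C * E) * q p ^ n" if "p \<in> D" "q p > 0" for p
  proof -
    have "\<bar>\<phi> p\<bar> * \<bar>\<psi> p\<bar> \<le> (C * q p ^ (n + m)) * (E * inverse (q p) ^ m)"
      using C E that order_trans[OF abs_ge_zero] by (intro mult_mono) blast+
    also have "\<dots> = (C * E) * q p ^ n" using that by (simp add: power_add field_simps)
    finally show ?thesis by (simp add: abs_mult)
  qed
  then show "\<exists>C. \<forall>p\<in>D. 0 < q p \<longrightarrow> \<bar>\<phi> p * \<psi> p\<bar> \<le> C * q p ^ n" by blast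
qed

lemma flat_subset_poly_growth: "flat_at_zero q D \<subseteq> poly_growth q D"
proof
  fix \<phi> assume "\<phi> \<in> flat_at_zero q D"
  then obtain C where "\<forall>p\<in>D. q p > 0 \<longrightarrow> \<bar>\<phi> p\<bar> \<le> C * q p ^ 0" unfolding flat_at_zero_def by blast
  then show "\<phi> \<in> poly_growth q D" by (intro poly_growth_bounded[of _ _ _ C]) auto
qed

text \<open>By \<open>L\<close> the weight grows at most linearly away from its zeros. A bound by q
  then gives continuity of the extension by 0, and a bound by q^2 gives derivative 0 at the zeros;
  the partial derivatives are flat themselves, so the argument repeats at every order.\<close>

lemma C_k_on_flat_extension:
  fixes q :: "'a::euclidean_space \<Rightarrow> real"
  assumes q: "continuous_on D q" "\<And>p. p \<in> D \<Longrightarrow> q p \<ge> 0"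
    and L: "\<And>p p'. p \<in> D \<Longrightarrow> p' \<in> D \<Longrightarrow> q p' = 0 \<Longrightarrow> q p \<le> L * norm (p - p')"
  shows "C_k_class k (flat_at_zero q D) \<phi> {p\<in>D. q p > 0} \<Longrightarrow> C_k_on k (\<lambda>p. if q p > 0 then \<phi> p else 0) D"
proof (induction k arbitrary: \<phi>)
  let ?D = "{p\<in>D. q p > 0}"
  \<comment> \<open>The set q > 0 is relatively open in \<open>D\<close>, so at its points
    derivatives within it and within \<open>D\<close> coincide.\<close>
  have at_eq: "at p within ?D = at p within D" if p: "p \<in> ?D" for p
  proof -
    obtain U where U: "open U" "U \<inter> D = q -` {0<..} \<inter> D"
      using q(1) unfolding continuous_on_open_invariant by (metis open_greaterThan)
    have "U \<inter> D = ?D" using U(2) by auto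
    then show ?thesis using U(1) p by (intro at_within_nhd[of p U]) auto
  qed
  have bound: "\<exists>C\<ge>0. \<forall>p\<in>D. \<bar>if q p > 0 then \<phi> p else 0\<bar> \<le> C * q p ^ n" if \<phi>: "\<phi> \<in> flat_at_zero q D" for \<phi> n
  proof -
    obtain C where C: "\<And>p. p \<in> D \<Longrightarrow> q p > 0 \<Longrightarrow> \<bar>\<phi> p\<bar> \<le> C * q p ^ n" using \<phi> unfolding flat_at_zero_def by blast
    have "\<bar>if q p > 0 then \<phi> p else 0\<bar> \<le> \<bar>C\<bar> * q p ^ n" if "p \<in> D" for p
    proof (cases "q p > 0")
      case True
      have "\<bar>\<phi> p\<bar> \<le> C * q p ^ n" using C that True by blast
      also have "\<dots> \<le> \<bar>C\<bar> * q p ^ n" using True by (intro mult_right_mono) auto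
      finally show ?thesis using True by simp
    next
      case False then show ?thesis using q(2)[OF that] by simp
    qed
    then show ?thesis by (intro exI[where x="\<bar>C\<bar>"]) auto
  qed
  {
    case (0 \<phi>)
    have \<phi>: "\<phi> \<in> flat_at_zero q D" "continuous_on ?D \<phi>" using 0 by auto
    have "continuous (at p within D) (\<lambda>p. if q p > 0 then \<phi> p else 0)" if p: "p \<in> D" for p
    proof (cases "q p > 0")
      case True
      then have p': "p \<in> ?D" using p by simp
      have "continuous_on ?D (\<lambda>p. if q p > 0 then \<phi> p else 0)" by (rule continuous_on_eq[OF \<phi>(2)]) simp
      then have "continuous (at p within ?D) (\<lambda>p. if q p > 0 then \<phi> p else 0)"
        using p' unfolding continuous_on_eq_continuous_within by blast
      then show ?thesis unfolding at_eq[OF p'] .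
    next
      case False
      then have q0: "q p = 0" using q(2)[OF p] by simp
      obtain C where C: "C \<ge> 0" "\<And>x. x \<in> D \<Longrightarrow> \<bar>if q x > 0 then \<phi> x else 0\<bar> \<le> C * q x ^ 1" using bound[OF \<phi>(1), of 1] by blast
      have "((\<lambda>x. C * q x) \<longlongrightarrow> C * q p) (at p within D)"
        using q(1) p by (intro tendsto_intros) (simp add: continuous_on_def)
      then have "((\<lambda>x. C * q x) \<longlongrightarrow> 0) (at p within D)" using q0 by simp
      moreover have "\<forall>\<^sub>F x in at p within D. norm (if q x > 0 then \<phi> x else 0) \<le> C * q x"
        using C(2) by (auto simp: eventually_at intro!: exI[where x=1])
      ultimately have "((\<lambda>x. if q x > 0 then \<phi> x else 0) \<longlongrightarrow> 0) (at p within D)"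
        by (rule Lim_null_comparison[rotated])
      then show ?thesis using q0 by (simp add: continuous_within)
    qed
    then show ?case by (auto simp: continuous_on_eq_continuous_within)
  next
    case (Suc k \<phi>)
    obtain A where A: "\<And>p. p \<in> ?D \<Longrightarrow> has_partials \<phi> A p ?D"
      "\<And>b. b \<in> Basis \<Longrightarrow> C_k_class k (flat_at_zero q D) (A b) ?D" and \<phi>: "\<phi> \<in> flat_at_zero q D"
      using Suc.prems by auto
    let ?f = "\<lambda>p. if q p > 0 then \<phi> p else 0"
    let ?A = "\<lambda>b p. if q p > 0 then A b p else 0"
    have "(?f has_derivative (\<lambda>d. \<Sum>b\<in>Basis. (d \<bullet> b) * ?A b p)) (at p within D)" if p: "p \<in> D" for p
    proof (cases "q p > 0")
      case True
      then have p': "p \<in> ?D" using p by simp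
      have "(?f has_derivative (\<lambda>d. \<Sum>b\<in>Basis. (d \<bullet> b) * A b p)) (at p within ?D)"
        by (rule has_derivative_transform[OF p' _ A(1)[OF p']]) simp
      then show ?thesis unfolding at_eq[OF p'] using True by simp
    next
      case False
      then have q0: "q p = 0" using q(2)[OF p] by simp
      obtain C where C: "C \<ge> 0" "\<And>x. x \<in> D \<Longrightarrow> \<bar>?f x\<bar> \<le> C * q x ^ 2" using bound[OF \<phi>, of 2] by blast
      have "((\<lambda>x. C * L\<^sup>2 * norm (x - p)) \<longlongrightarrow> C * L\<^sup>2 * norm (p - p)) (at p within D)"
        by (intro tendsto_intros)
      then have lim: "((\<lambda>x. C * L\<^sup>2 * norm (x - p)) \<longlongrightarrow> 0) (at p within D)" by simp
      have "norm ((?f x - ?f p - 0) /\<^sub>R norm (x - p)) \<le> C * L\<^sup>2 * norm (x - p)" if x: "x \<in> D" "x \<noteq> p" for x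
      proof -
        have "\<bar>?f x\<bar> \<le> C * q x ^ 2" using C x by blast
        also have "\<dots> \<le> C * (L * norm (x - p)) ^ 2"
          using C(1) L[OF x(1) p q0] q(2)[OF x(1)] by (intro mult_left_mono power_mono) auto
        finally have "\<bar>?f x\<bar> / norm (x - p) \<le> C * (L * norm (x - p)) ^ 2 / norm (x - p)"
          by (rule divide_right_mono) simp
        also have "\<dots> = C * L\<^sup>2 * norm (x - p)" using x by (simp add: power2_eq_square)
        finally show ?thesis using q0 by (simp add: abs_mult divide_inverse_commute)
      qed
      then have "((\<lambda>x. (?f x - ?f p - 0) /\<^sub>R norm (x - p)) \<longlongrightarrow> 0) (at p within D)"
        by (intro Lim_null_comparison[OF _ lim]) (auto simp: eventually_at intro!: exI[where x=1])
      then have "(?f has_derivative (\<lambda>d. 0)) (at p within D)"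
        by (simp add: has_derivative_at_within)
      then show ?thesis using q0 by simp
    qed
    then show ?case using Suc.IH[OF A(2)]
      by (rule C_k_on_SucI[where A="?A"])
  }
qed

text \<open>On a time interval of length 1 the bound 1 keeps the iterates in \<open>{-1..1}\<close>,
  and the Lipschitz constant 1/2 makes the integral operator a contraction. The parameter is carried
  through the iteration, so joint continuity comes from uniform convergence.\<close>

lemma picard_solution:
  fixes F :: "real \<times> real \<times> 'a::euclidean_space \<Rightarrow> real"
  assumes F: "continuous_on ({0..1} \<times> {-1..1} \<times> P) F"
    and bd: "\<And>s u p. s \<in> {0..1} \<Longrightarrow> u \<in> {-1..1} \<Longrightarrow> p \<in> P \<Longrightarrow> \<bar>F (s, u, p)\<bar> \<le> 1"
    and lip: "\<And>s u u' p. s \<in> {0..1} \<Longrightarrow> u \<in> {-1..1} \<Longrightarrow> u' \<in> {-1..1} \<Longrightarrow> p \<in> P \<Longrightarrow> \<bar>F (s, u, p) - F (s, u', p)\<bar> \<le> 1/2 * \<bar>u - u'\<bar>"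
    and P: "convex P"
  obtains u where "continuous_on ({0..1} \<times> P) u" "\<And>s p. s \<in> {0..1} \<Longrightarrow> p \<in> P \<Longrightarrow> u (s, p) \<in> {-1..1}"
    "\<And>\<sigma> p. \<sigma> \<in> {0..1} \<Longrightarrow> p \<in> P \<Longrightarrow> u (\<sigma>, p) = integral {0..\<sigma>} (\<lambda>s. F (s, u (s, p), p))"
proof -
  let ?S = "{0..1::real} \<times> P"
  define T where "T u y = integral {0..fst y} (\<lambda>s. F (s, u (s, snd y), snd y))" for u :: "real \<times> 'a \<Rightarrow> real" and y
  define ok where "ok u \<longleftrightarrow> continuous_on ?S u \<and> (\<forall>y\<in>?S. u y \<in> {-1..1})" for u :: "real \<times> 'a \<Rightarrow> real"
  have contF: "continuous_on ?S (\<lambda>y. F (fst y, u y, snd y))" if "ok u" for u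
    using that unfolding ok_def by (intro continuous_on_compose2[OF F]) (auto intro!: continuous_intros)
  have contFs: "continuous_on {0..\<sigma>} (\<lambda>s. F (s, u (s, p), p))" if "ok u" "p \<in> P" "\<sigma> \<in> {0..1}" for u p \<sigma>
    using continuous_on_slice1[OF contF[OF that(1)] that(2)] that(3) by (auto intro: continuous_on_subset)
  have T_ok: "ok (T u)" if u: "ok u" for u
    unfolding ok_def
  proof (intro conjI ballI)
    show "continuous_on ?S (T u)" unfolding T_def[abs_def]
      using C_k_on_integral_upto[OF P, of 0 "\<lambda>y. F (fst y, u y, snd y)"] contF[OF u] by simp
    fix y assume y: "y \<in> ?S"
    have "norm (T u y) \<le> 1 * (fst y - 0)" unfolding T_def
      using y u by (intro integral_bound contFs) (auto simp: ok_def intro!: bd)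
    then show "T u y \<in> {-1..1}" using y by auto
  qed
  have T_lip: "\<bar>T u y - T u' y\<bar> \<le> 1/2 * e" if u: "ok u" "ok u'" and e: "\<And>y. y \<in> ?S \<Longrightarrow> \<bar>u y - u' y\<bar> \<le> e" and y: "y \<in> ?S" for u u' e y
  proof -
    have "T u y - T u' y = integral {0..fst y} (\<lambda>s. F (s, u (s, snd y), snd y) - F (s, u' (s, snd y), snd y))"
      unfolding T_def using y u by (intro integral_diff[symmetric] integrable_continuous_real contFs) auto
    moreover have "norm \<dots> \<le> (1/2 * e) * (fst y - 0)"
    proof (rule integral_bound)
      fix s assume s: "s \<in> {0..fst y}"
      then have s': "(s, snd y) \<in> ?S" "s \<in> {0..1}" "snd y \<in> P" using y by auto
      have "\<bar>F (s, u (s, snd y), snd y) - F (s, u' (s, snd y), snd y)\<bar> \<le> 1/2 * \<bar>u (s, snd y) - u' (s, snd y)\<bar>"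
        using u s' unfolding ok_def by (intro lip) blast+
      then show "norm (F (s, u (s, snd y), snd y) - F (s, u' (s, snd y), snd y)) \<le> 1/2 * e"
        using e[OF s'(1)] by simp
    qed (use y u in \<open>auto intro!: continuous_on_diff contFs\<close>)
    moreover have "0 \<le> e" using e[OF y] by simp
    then have "(1/2 * e) * (fst y - 0) \<le> 1/2 * e" using y by (auto intro: mult_left_le)
    ultimately show ?thesis by simp
  qed
  define U where "U n = (T ^^ n) (\<lambda>_. 0)" for n
  have U_Suc: "U (Suc n) = T (U n)" for n by (simp add: U_def)
  have U_ok: "ok (U n)" for n
  proof (induction n)
    case 0 show ?case by (simp add: U_def ok_def)
  next
    case (Suc n) then show ?case unfolding U_Suc by (rule T_ok)
  qed
  have U_diff: "\<bar>U (Suc n) y - U n y\<bar> \<le> (1/2) ^ n" if "y \<in> ?S" for n y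
    using that
  proof (induction n arbitrary: y)
    case 0
    have "ok (U 1)" by (rule U_ok)
    then show ?case using 0 by (auto simp: U_def ok_def abs_le_iff)
  next
    case (Suc n)
    show ?case unfolding U_Suc[of "Suc n"] using T_lip[OF U_ok U_ok Suc.IH Suc.prems] by (simp add: U_Suc)
  qed
  \<comment> \<open>The limit of the iterates as a telescoping series, dominated by the geometric
    series of \<open>U_diff\<close>.\<close>
  define u where "u y = (\<Sum>i. U (Suc i) y - U i y)" for y
  have "uniform_limit ?S (\<lambda>n y. \<Sum>i<n. U (Suc i) y - U i y) u sequentially"
    unfolding u_def using U_diff
    by (intro Weierstrass_m_test[where M="\<lambda>n. (1/2) ^ n"]) (auto intro!: summable_geometric)
  moreover have "(\<Sum>i<n. U (Suc i) y - U i y) = U n y" for n y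
    by (induction n) (simp_all add: U_def)
  ultimately have lim: "uniform_limit ?S U u sequentially" by simp
  have u_cont: "continuous_on ?S u"
    by (rule uniform_limit_theorem[OF _ lim]) (use U_ok in \<open>auto simp: ok_def\<close>)
  have u_lim: "(\<lambda>n. U n y) \<longlonglongrightarrow> u y" if "y \<in> ?S" for y
    using tendsto_uniform_limitI[OF lim that] .
  have u_mem: "u y \<in> {-1..1}" if "y \<in> ?S" for y
  proof -
    have "closed {-1..1::real}" by simp
    from Lim_in_closed_set[OF this _ _ u_lim[OF that]] show ?thesis using U_ok that by (auto simp: ok_def)
  qed
  have u_ok: "ok u" using u_cont u_mem by (auto simp: ok_def)
  have u_fix: "u y = T u y" if y: "y \<in> ?S" for y
  proof -
    have "(\<lambda>n. U (Suc n) y) \<longlonglongrightarrow> T u y"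
    proof (rule LIMSEQ_I)
      fix e :: real assume e: "0 < e"
      obtain N where N: "\<And>n x. n \<ge> N \<Longrightarrow> x \<in> ?S \<Longrightarrow> dist (U n x) (u x) < e"
        using uniform_limitD[OF lim e] unfolding eventually_sequentially by blast
      have "norm (U (Suc n) y - T u y) < e" if "n \<ge> N" for n
      proof -
        have "\<bar>T (U n) y - T u y\<bar> \<le> 1/2 * e"
          using N[OF that] by (intro T_lip[OF U_ok u_ok _ y]) (simp add: dist_real_def less_imp_le)
        then show ?thesis using e by (simp add: U_Suc)
      qed
      then show "\<exists>N. \<forall>n\<ge>N. norm (U (Suc n) y - T u y) < e" by blast
    qed
    moreover have "(\<lambda>n. U (Suc n) y) \<longlonglongrightarrow> u y" by (rule LIMSEQ_Suc[OF u_lim[OF y]])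
    ultimately show ?thesis by (rule LIMSEQ_unique[symmetric])
  qed
  show ?thesis
  proof (rule that[of u])
    fix \<sigma> :: real and p assume "\<sigma> \<in> {0..1}" "p \<in> P"
    then show "u (\<sigma>, p) = integral {0..\<sigma>} (\<lambda>s. F (s, u (s, p), p))"
      using u_fix[of "(\<sigma>, p)"] by (simp add: T_def)
  qed (use u_cont u_mem in auto)
qed

text \<open>Transfers a strict sign known at the unperturbed parameter m0 to nearby parameters,
  uniformly over a compact set. For nonempty \<open>K\<close> the constant is half the minimum at
  m0, and uniform continuity does the rest.\<close>

lemma compact_uniform_lower_bound:
  fixes \<phi> :: "'a::metric_space \<times> 'b::metric_space \<Rightarrow> real"
  assumes \<phi>: "continuous_on (K \<times> M) \<phi>" and K: "compact K" and M: "compact M" "m0 \<in> M"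
    and pos: "\<And>k. k \<in> K \<Longrightarrow> \<phi> (k, m0) > 0"
  obtains c \<delta> where "c > 0" "\<delta> > 0" "\<And>k m. k \<in> K \<Longrightarrow> m \<in> M \<Longrightarrow> dist m m0 < \<delta> \<Longrightarrow> c \<le> \<phi> (k, m)"
proof (cases "K = {}")
  case True then show ?thesis using that[of 1 1] by simp
next
  case False
  have "continuous_on K (\<lambda>k. \<phi> (k, m0))" by (rule continuous_on_slice1[OF \<phi> M(2)])
  from continuous_attains_inf[OF K False this] obtain k0 where k0: "k0 \<in> K" "\<And>k. k \<in> K \<Longrightarrow> \<phi> (k0, m0) \<le> \<phi> (k, m0)" by blast
  define c where "c = \<phi> (k0, m0) / 2"
  have c: "c > 0" using pos k0 by (simp add: c_def)
  have "uniformly_continuous_on (K \<times> M) \<phi>" by (rule compact_uniformly_continuous[OF \<phi> compact_Times[OF K M(1)]])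
  then obtain \<delta> where \<delta>: "\<delta> > 0" "\<And>x y. x \<in> K \<times> M \<Longrightarrow> y \<in> K \<times> M \<Longrightarrow> dist y x < \<delta> \<Longrightarrow> dist (\<phi> y) (\<phi> x) < c"
    unfolding uniformly_continuous_on_def using c by meson
  show ?thesis
  proof (rule that[OF c \<delta>(1)])
    fix k m assume "k \<in> K" "m \<in> M" "dist m m0 < \<delta>"
    then have "dist (\<phi> (k, m)) (\<phi> (k, m0)) < c" using M by (intro \<delta>(2)) (auto simp: dist_Pair_Pair)
    then have "\<phi> (k, m0) - \<phi> (k, m) < c" by (simp add: dist_real_def)
    then show "c \<le> \<phi> (k, m)" using k0(2)[OF \<open>k \<in> K\<close>] by (simp add: c_def)
  qed
qed

section \<open>The passage from the section to x = 0 in stretched time\<close>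

text \<open>As length times mean, an integral with moving end points becomes an integral over
  \<open>{0..1}\<close>, whose smoothness in both ends follows from the rule for parameter
  integrals.\<close>

lemma integral_eq_segment_mean:
  fixes g :: "real \<Rightarrow> real"
  assumes g: "continuous_on {c..d} g" and cd: "c \<le> d"
  shows "integral {c..d} g = (d - c) * segment_mean g c d"
proof -
  have "integral {c..d} g - integral {c..c} g = (\<Sum>b\<in>Basis. ((d - c) \<bullet> b) * segment_mean g c d)"
  proof (rule difference_eq_segment_mean[where F="\<lambda>x. integral {c..x} g" and A="\<lambda>_. g" and S="{c..d}"])
    fix x assume "x \<in> {c..d}"
    from integral_has_vector_derivative[OF g this]
    show "((\<lambda>x. integral {c..x} g) has_derivative (\<lambda>h. \<Sum>b\<in>Basis. h \<bullet> b * g x)) (at x within {c..d})"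
      by (simp add: has_vector_derivative_def)
  qed (use cd g in auto)
  then show ?thesis by simp
qed

text \<open>The inequality 1 + t \<le> exp t at t = y / (n + 1), raised to the power n. Dividing by
  n + 1 instead of n includes n = 0.\<close>

lemma exp_minus_le_inverse_power:
  fixes y :: real
  assumes y: "0 < y"
  shows "exp (- y) \<le> ((real n + 1) * inverse y) ^ n"
proof -
  define m where "m = real n + 1"
  have m: "m > 0" by (simp add: m_def)
  have "y / m \<le> exp (y / m)" using exp_ge_add_one_self[of "y / m"] by linarith
  then have "exp (- (y / m)) \<le> m * inverse y"
    using y m by (simp add: exp_minus field_simps)
  then have "exp (- (y / m)) ^ n \<le> (m * inverse y) ^ n" by (intro power_mono) auto
  moreover have "exp (- y) \<le> exp (- (y / m)) ^ n"
  proof -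
    have "real n * y / m \<le> y" using y m by (simp add: field_simps m_def)
    then show ?thesis by (simp add: exp_of_nat_mult[symmetric])
  qed
  ultimately show ?thesis by (simp add: m_def)
qed

lemma abs_exp_diff_le:
  fixes u v :: real
  assumes "u \<in> {-1..1}" "v \<in> {-1..1}"
  shows "\<bar>exp u - exp v\<bar> \<le> exp 1 * \<bar>u - v\<bar>"
proof -
  have *: "\<bar>exp u - exp v\<bar> \<le> exp 1 * \<bar>u - v\<bar>" if "v \<le> u" "u \<le> 1" for u v :: real
  proof -
    have "exp u - exp v = exp u * (1 - exp (v - u))" by (simp add: right_diff_distrib exp_diff)
    also have "\<dots> \<le> exp u * (u - v)" using exp_ge_add_one_self[of "v - u"] by (intro mult_left_mono) (linarith, simp)
    also have "\<dots> \<le> exp 1 * (u - v)" using that by (intro mult_right_mono) auto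
    finally show ?thesis using that by simp
  qed
  show ?thesis using *[of v u] *[of u v] assms by (cases "v \<le> u") (auto simp: abs_minus_commute)
qed

text \<open>The half \<open>x \<le> 0\<close> of the problem, with entry points in
  \<open>{a..b}\<close>. In the application h vanishes at the end \<open>x = 0\<close>, so
  \<open>mean_le\<close> asks for decay only of averages that begin at an entry point. The half
  \<open>x \<ge> 0\<close> becomes an instance after reflection of x.\<close>

locale half_system =
  fixes h h1 :: "real \<times> real \<times> real \<Rightarrow> real" and r :: nat and a b zb e B c :: real
  assumes h_C: "C_k_on r h ({a..0} \<times> {0..zb} \<times> {0..e})"
    and h1_C: "C_k_on r h1 ({a..0} \<times> {0..zb} \<times> {0..e})"
    and h1: "\<And>x z \<epsilon>. x \<in> {a..0} \<Longrightarrow> z \<in> {0..zb} \<Longrightarrow> \<epsilon> \<in> {0..e} \<Longrightarrow> h (x, z, \<epsilon>) - h (x, 0, \<epsilon>) = z * h1 (x, z, \<epsilon>)"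
    and h_lip: "\<And>x z z' \<epsilon>. x \<in> {a..0} \<Longrightarrow> z \<in> {0..zb} \<Longrightarrow> z' \<in> {0..zb} \<Longrightarrow> \<epsilon> \<in> {0..e} \<Longrightarrow>
       \<bar>h (x, z, \<epsilon>) - h (x, z', \<epsilon>)\<bar> \<le> B * \<bar>z - z'\<bar>"
    and mean_le: "\<And>x0 x \<epsilon>. x0 \<in> {a..b} \<Longrightarrow> x \<in> {a..0} \<Longrightarrow> \<epsilon> \<in> {0..e} \<Longrightarrow> segment_mean (\<lambda>s. h (s, 0, \<epsilon>)) x0 x \<le> - c"
    and ab: "a \<le> b" "b < 0" and zb: "0 < zb" and e: "0 < e" "e \<le> 1" and c: "0 < c" and B: "0 \<le> B"
begin

definition mean where "mean y = segment_mean (\<lambda>s. h (s, 0, snd (snd y))) (fst y) (fst (snd y))"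

abbreviation P where "P \<equiv> {a..b} \<times> {0..e}"
abbreviation D where "D \<equiv> {0..1::real} \<times> {-1..1::real} \<times> P"

text \<open>
  Points are \<open>y = (\<sigma>, u, x0, \<epsilon>)\<close>. With the stretched time \<open>v = \<sigma> / q = (x - x0) / (\<epsilon> * \<bar>x0\<bar>)\<close>, so that
  \<open>\<sigma> = v / (1 + v * (1 - \<epsilon>))\<close> and \<open>d\<sigma> = q\<^sup>2 dv\<close>, the abscissa is \<open>X y\<close>, \<open>\<epsilon> * \<theta> y\<close> is the integral of
  \<open>h (x, 0, \<epsilon>)\<close> from \<open>x0\<close> to \<open>X y\<close>, and \<open>u = ln (z / z0) - \<theta>\<close> satisfies \<open>du/d\<sigma> = F z0 y\<close>.
  The only singular points are those with \<open>q y = 0\<close>, that is \<open>\<sigma> = 1\<close> and \<open>\<epsilon> = 0\<close>, where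
  \<open>exp (\<theta> y)\<close> decays faster than any power of \<open>q y\<close>.
\<close>

definition q where "q y = 1 - fst y + snd (snd (snd y)) * fst y" for y :: "real \<times> real \<times> real \<times> real"
definition X where "X y = fst (snd (snd y)) * (1 - fst y) * inverse (q y)" for y :: "real \<times> real \<times> real \<times> real"
definition \<theta> where "\<theta> y = - 1 * fst (snd (snd y)) * (fst y * inverse (q y)) * mean (fst (snd (snd y)), X y, snd (snd (snd y)))"
  for y :: "real \<times> real \<times> real \<times> real"
definition zeta where "zeta z0 y = z0 * (exp (fst (snd y)) * exp (\<theta> y))" for y :: "real \<times> real \<times> real \<times> real"
definition \<Phi> where "\<Phi> z0 y = zeta z0 y * (h1 (X y, zeta z0 y, snd (snd (snd y))) * (- 1 * fst (snd (snd y)) * (inverse (q y) * inverse (q y))))"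
  for y :: "real \<times> real \<times> real \<times> real"
definition F where "F z0 y = (if q y > 0 then \<Phi> z0 y else 0)"

lemma mean_C: "C_k_on r mean ({a..0} \<times> {a..0} \<times> {0..e})"
proof -
  let ?T = "{a..0} \<times> {a..0} \<times> {0..e}"
  have "C_k_on r (\<lambda>y. h (fst (snd y) + fst y * (fst (snd (snd y)) - fst (snd y)), 0, snd (snd (snd y)))) ({0..1} \<times> ?T)"
  proof (rule C_k_on_compose[OF h_C])
    show "comp_C_k r UNIV (\<lambda>y. (fst (snd y) + fst y * (fst (snd (snd y)) - fst (snd y)), 0::real, snd (snd (snd y)))) ({0..1::real} \<times> ?T)"
      unfolding comp_C_k_UNIV_real
      by (intro comp_C_k_Pair; unfold comp_C_k_UNIV_real; (intro C_k_on_add C_k_on_mult C_k_on_diff C_k_on_const)?)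
         (intro C_k_on_linear bounded_linear_fst bounded_linear_fst_comp bounded_linear_snd_comp bounded_linear_snd)+
    fix y assume "y \<in> {0..1::real} \<times> ?T"
    then show "(fst (snd y) + fst y * (fst (snd (snd y)) - fst (snd y)), 0, snd (snd (snd y))) \<in> {a..0} \<times> {0..zb} \<times> {0..e}"
      using convex_segment_mem[of "{a..0}" "fst (snd y)" "fst (snd (snd y))" "fst y"] zb by auto
  qed
  from C_k_on_integral_param[OF _ this]
  show ?thesis unfolding mean_def[abs_def] segment_mean_def by (simp add: convex_Times del: C_k_on.simps)
qed

lemma q_bounds: assumes "y \<in> D" shows "0 \<le> q y" "q y \<le> 1"
proof -
  have *: "0 \<le> snd (snd (snd y)) * fst y" using assms by auto
  have "snd (snd (snd y)) \<le> 1" "0 \<le> fst y" using assms e by auto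
  then have **: "snd (snd (snd y)) * fst y \<le> 1 * fst y" by (intro mult_right_mono)
  show "0 \<le> q y" "q y \<le> 1" using assms * ** unfolding q_def by auto
qed

text \<open>q vanishes only at \<sigma> = 1, \<epsilon> = 0. From there q is at most the sum of the
  changes in \<sigma> and \<epsilon>, each bounded by the norm, which gives the constant 2.\<close>

lemma q_lip:
  assumes "y \<in> D" "y' \<in> D" "q y' = 0"
  shows "q y \<le> 2 * norm (y - y')"
proof -
  obtain s u x \<epsilon> where y: "y = (s, u, x, \<epsilon>)" by (cases y) auto
  obtain s' u' x' \<epsilon>' where y': "y' = (s', u', x', \<epsilon>')" by (cases y') auto
  have nn: "0 \<le> \<epsilon>' * s'" "s' \<le> 1" "0 \<le> s'" using assms y' by auto
  have eq: "1 - s' + \<epsilon>' * s' = 0" using assms(3) by (simp add: q_def y')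
  then have s1: "s' = 1" using nn by linarith
  then have s': "s' = 1" "\<epsilon>' = 0" using eq by auto
  have "\<epsilon> * s \<le> \<epsilon> * 1" using assms(1) y by (intro mult_left_mono) auto
  then have "q y \<le> \<bar>s - s'\<bar> + \<bar>\<epsilon> - \<epsilon>'\<bar>" using s' by (simp add: q_def y)
  also have "\<bar>s - s'\<bar> \<le> norm (y - y')" using norm_fst_le[of "fst (y - y')" "snd (y - y')"] by (simp add: y y')
  also have "\<bar>\<epsilon> - \<epsilon>'\<bar> \<le> norm (y - y')"
    using norm_snd_le[of "snd (y - y')" "fst (y - y')"] norm_snd_le[of "snd (snd (y - y'))" "fst (snd (y - y'))"]
      norm_snd_le[of "snd (snd (snd (y - y')))" "fst (snd (snd (y - y')))"] by (simp add: y y')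
  finally show ?thesis by simp
qed

section \<open>Pointwise estimates away from the singular corner\<close>

context
  fixes y assumes y: "y \<in> D" and qy: "0 < q y"
begin

lemma X_mem: "X y \<in> {fst (snd (snd y))..0}"
proof -
  have 1: "0 \<le> (1 - fst y) * inverse (q y)" using y qy by auto
  have "0 \<le> snd (snd (snd y)) * fst y" using y by auto
  then have "1 - fst y \<le> q y" by (simp add: q_def)
  then have 2: "(1 - fst y) * inverse (q y) \<le> 1" using qy by (simp add: field_simps)
  have x: "fst (snd (snd y)) \<le> 0" using y ab by auto
  have "X y \<le> 0" unfolding X_def mult.assoc using 1 x by (intro mult_nonpos_nonneg)
  moreover have "fst (snd (snd y)) * 1 \<le> X y" unfolding X_def mult.assoc using 2 x by (intro mult_left_mono_neg)
  ultimately show ?thesis by simp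
qed

lemma X_mem': "X y \<in> {a..0}" using X_mem y by auto

text \<open>With v = \<sigma>/q the stretched time, \<theta> is |x0| v times a mean of h;
  \<open>mean_le\<close> and |x0| \<ge> -b make it decay at least linearly in v.\<close>

lemma \<theta>_le: "\<theta> y \<le> - ((- b) * c * (fst y * inverse (q y)))"
proof -
  have v: "0 \<le> fst y * inverse (q y)" using y qy by auto
  have m: "mean (fst (snd (snd y)), X y, snd (snd (snd y))) \<le> - c"
    unfolding mean_def fst_conv snd_conv by (rule mean_le) (use X_mem' y in auto)
  have "(- fst (snd (snd y)) * (fst y * inverse (q y))) * mean (fst (snd (snd y)), X y, snd (snd (snd y)))
      \<le> (- fst (snd (snd y)) * (fst y * inverse (q y))) * (- c)"
    by (rule mult_left_mono[OF m mult_nonneg_nonneg[OF _ v]]) (use y ab in auto)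
  also have "\<dots> \<le> ((- b) * (fst y * inverse (q y))) * (- c)"
    by (intro mult_right_mono_neg mult_right_mono v) (use y c in auto)
  finally show ?thesis by (simp add: \<theta>_def mult_ac)
qed

lemma \<theta>_nonpos: "\<theta> y \<le> 0"
proof -
  have "0 \<le> (- b) * c * (fst y * inverse (q y))" using y qy ab c by (intro mult_nonneg_nonneg) auto
  then show ?thesis using \<theta>_le by linarith
qed

text \<open>u \<le> 1 and \<theta> \<le> 0 leave z at most e times z0, which is the origin of the
  condition \<open>z0 * exp 1 \<le> zb\<close>.\<close>

lemma zeta_mem: assumes z0: "0 < z0" "z0 * exp 1 \<le> zb" shows "zeta z0 y \<in> {0..zb}" "0 < zeta z0 y"
proof -
  have "exp (fst (snd y)) * exp (\<theta> y) \<le> exp 1 * 1" using y \<theta>_nonpos by (intro mult_mono) auto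
  then have "zeta z0 y \<le> z0 * exp 1" unfolding zeta_def using z0 by (intro mult_left_mono) auto
  then have "zeta z0 y \<le> zb" using z0 by linarith
  then show "zeta z0 y \<in> {0..zb}" "0 < zeta z0 y" using z0 by (auto simp: zeta_def)
qed

text \<open>Converts decay in the stretched time v = \<sigma>/q into decay in 1/q. Either \<sigma>
  \<le> 1/2, and then q \<ge> 1/2, or 1 \<le> 2 \<sigma>, and then 1/q is at most 2 v.\<close>

lemma inverse_q_le: "inverse (q y) \<le> 2 * (1 + fst y * inverse (q y))"
proof (cases "fst y \<le> 1/2")
  case True
  have "0 \<le> snd (snd (snd y)) * fst y" using y by auto
  then have "1/2 \<le> q y" using True by (simp add: q_def)
  then have "inverse (q y) \<le> 2" using qy by (simp add: field_simps)
  moreover have "0 \<le> fst y * inverse (q y)" using y qy by auto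
  ultimately show ?thesis unfolding distrib_left by linarith
next
  case False
  then have "1 * inverse (q y) \<le> (2 * fst y) * inverse (q y)" using qy by (intro mult_right_mono) auto
  then show ?thesis by simp
qed

text \<open>For k = \<open>(- b) * c\<close> the two preceding estimates give exp \<theta> \<le> exp
  k exp (-k / (2 q)), and the last factor is below a multiple of every power of q. This is the
  flatness on which the smoothness at \<epsilon> = 0 rests.\<close>

lemma exp_\<theta>_le: "exp (\<theta> y) \<le> exp (- b * c) * ((real n + 1) * (2 / (- b * c))) ^ n * q y ^ n"
proof -
  define k where "k = (- b) * c"
  have k: "k > 0" unfolding k_def using ab c by (intro mult_pos_pos) auto
  have "\<theta> y \<le> k - k / 2 * inverse (q y)"
  proof -
    have "k / 2 * inverse (q y) \<le> k / 2 * (2 * (1 + fst y * inverse (q y)))" using inverse_q_le k by (intro mult_left_mono) auto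
    then show ?thesis using \<theta>_le by (simp add: k_def algebra_simps)
  qed
  then have "exp (\<theta> y) \<le> exp k * exp (- (k / 2 * inverse (q y)))" by (simp add: exp_add[symmetric])
  also have "\<dots> \<le> exp k * ((real n + 1) * inverse (k / 2 * inverse (q y))) ^ n"
    using k qy by (intro mult_left_mono exp_minus_le_inverse_power) auto
  also have "\<dots> = exp k * ((real n + 1) * (2 / k)) ^ n * q y ^ n"
    using k qy by (simp add: power_mult_distrib[symmetric] field_simps)
  finally show ?thesis by (simp add: k_def)
qed

end

section \<open>Regularity of the right-hand side up to the singular corner\<close>

abbreviation D' where "D' \<equiv> {y\<in>D. q y > 0}"
abbreviation G where "G \<equiv> poly_growth q D"

lemma G_add: "f \<in> G \<Longrightarrow> g \<in> G \<Longrightarrow> (\<lambda>p. f p + g p) \<in> G"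
  by (rule poly_growth_add[OF q_bounds(2)])

lemma G_const: "(\<lambda>_. k) \<in> G" by (rule poly_growth_bounded[of _ _ _ "\<bar>k\<bar>"]) simp

lemma coord_C:
  "C_k_class k G (\<lambda>y. fst y) D'" "C_k_class k G (\<lambda>y. fst (snd y)) D'"
  "C_k_class k G (\<lambda>y. fst (snd (snd y))) D'" "C_k_class k G (\<lambda>y. snd (snd (snd y))) D'"
  \<comment> \<open>\<open>1 - a\<close> bounds the absolute value of every coordinate on
    \<open>D\<close>.\<close>
  using e ab by (auto intro!: C_k_class_linear G_const poly_growth_bounded[where C="1 - a"]
      bounded_linear_fst bounded_linear_fst_comp bounded_linear_snd_comp bounded_linear_snd)

lemma mult_C: "C_k_class k G f D' \<Longrightarrow> C_k_class k G g D' \<Longrightarrow> C_k_class k G (\<lambda>y. f y * g y) D'"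
  by (rule C_k_class_mult[OF G_add poly_growth_mult])

lemma add_C: "C_k_class k G f D' \<Longrightarrow> C_k_class k G g D' \<Longrightarrow> C_k_class k G (\<lambda>y. f y + g y) D'"
  by (rule C_k_class_add[OF G_add])

lemma const_C: "C_k_class k G (\<lambda>y. t) D'"
  by (rule C_k_class_const[OF G_const])

lemma q_C: "C_k_class k G q D'"
proof -
  have "C_k_class k G (\<lambda>y. (1 + (-1) * fst y) + snd (snd (snd y)) * fst y) D'"
    by (intro add_C mult_C const_C coord_C)
  then show ?thesis unfolding q_def[abs_def] by simp
qed

lemma inverse_q_C: "C_k_class k G (\<lambda>y. inverse (q y)) D'"
proof (rule C_k_class_inverse[OF G_add poly_growth_mult G_const _ _ q_C])
  show "(\<lambda>p. inverse (q p)) \<in> G" unfolding poly_growth_def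
    by (auto intro!: exI[where x=1])
qed auto

lemma X_C: "C_k_class k G X D'"
proof -
  have "C_k_class k G (\<lambda>y. fst (snd (snd y)) * (1 + (-1) * fst y) * inverse (q y)) D'"
    by (intro add_C mult_C const_C coord_C inverse_q_C)
  then show ?thesis unfolding X_def[abs_def] by simp
qed

text \<open>A continuous function on a compact set stays bounded along any map into it, which is
  growth of order zero.\<close>

lemma compose_C:
  fixes \<Psi> :: "real \<times> real \<times> real \<times> real \<Rightarrow> 'b::euclidean_space"
  assumes \<phi>: "C_k_on k \<phi> T" and T: "compact T" and \<Psi>: "comp_C_k k G \<Psi> D'" "\<And>y. y \<in> D' \<Longrightarrow> \<Psi> y \<in> T"
  shows "C_k_class k G (\<lambda>y. \<phi> (\<Psi> y)) D'"
proof (rule C_k_class_compose[OF G_add poly_growth_mult _ _ \<phi>[unfolded C_k_on_iff_class]])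
  show "(\<lambda>y. \<psi> (\<Psi> y)) \<in> G" if "continuous_on T \<psi>" for \<psi>
  proof -
    have "bounded (\<psi> ` T)" using compact_continuous_image[OF that T] by (rule compact_imp_bounded)
    then obtain C where "\<And>t. t \<in> T \<Longrightarrow> \<bar>\<psi> t\<bar> \<le> C" unfolding bounded_iff by auto
    then show ?thesis using \<Psi>(2) by (intro poly_growth_bounded[where C=C]) auto
  qed
qed (use \<Psi> in \<open>auto simp: comp_C_k_def\<close>)

lemma \<theta>_C: "C_k_class r G \<theta> D'"
proof -
  have "C_k_class r G (\<lambda>y. mean (fst (snd (snd y)), X y, snd (snd (snd y)))) D'"
  proof (rule compose_C[OF mean_C])
    show "comp_C_k r G (\<lambda>y. (fst (snd (snd y)), X y, snd (snd (snd y)))) D'"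
      by (intro comp_C_k_Pair comp_C_k_real[THEN iffD2] coord_C X_C)
    show "(fst (snd (snd y)), X y, snd (snd (snd y))) \<in> {a..0} \<times> {a..0} \<times> {0..e}" if "y \<in> D'" for y
      using X_mem'[of y] that ab by auto
  qed (intro compact_Times compact_Icc)
  then show ?thesis unfolding \<theta>_def[abs_def]
    by (intro mult_C const_C coord_C inverse_q_C)
qed

abbreviation V where "V \<equiv> flat_at_zero q D"

lemma exp_\<theta>_C: "C_k_class r V (\<lambda>y. exp (\<theta> y)) D'"
proof (rule C_k_class_exp[OF flat_at_zero_add flat_at_zero_mult _ \<theta>_C])
  show "(\<lambda>y. exp (\<theta> y)) \<in> V" unfolding flat_at_zero_def mem_Collect_eq abs_exp_cancel using exp_\<theta>_le by blast
qed

lemma zeta_C: "C_k_class r V (zeta z0) D'"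
proof -
  have eu: "C_k_class r G (\<lambda>y. exp (fst (snd y))) D'"
    by (rule C_k_class_exp[OF G_add poly_growth_mult _ coord_C(2)])
       (auto intro!: poly_growth_bounded[where C="exp 1"])
  have "C_k_class r V (\<lambda>y. exp (\<theta> y) * (z0 * exp (fst (snd y)))) D'"
    by (rule C_k_class_mult[OF flat_at_zero_add flat_at_zero_mult exp_\<theta>_C mult_C[OF const_C eu]])
  then show ?thesis unfolding zeta_def[abs_def] by (simp add: mult_ac)
qed

text \<open>One flat factor suffices: \<open>zeta\<close> is flat through
  \<open>exp (\<theta> y)\<close>, while h1 along the orbit and the Jacobian 1/q^2 have polynomial
  growth together with their derivatives. Hence \<Phi> is flat and extends by 0 across q =
  0.\<close>

lemma F_C:
  assumes z0: "0 < z0" "z0 * exp 1 \<le> zb"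
  shows "C_k_on r (F z0) D"
  unfolding F_def[abs_def]
proof (rule C_k_on_flat_extension[OF _ q_bounds(1) q_lip])
  show "continuous_on D q" unfolding q_def[abs_def] by (intro continuous_intros)
  have h1C: "C_k_class r G (\<lambda>y. h1 (X y, zeta z0 y, snd (snd (snd y)))) D'"
  proof (rule compose_C[OF h1_C])
    have "C_k_class r G (zeta z0) D'"
      by (rule C_k_class_mono[OF zeta_C _ flat_subset_poly_growth]) simp
    then show "comp_C_k r G (\<lambda>y. (X y, zeta z0 y, snd (snd (snd y)))) D'"
      by (intro comp_C_k_Pair comp_C_k_real[THEN iffD2] coord_C X_C)
    show "(X y, zeta z0 y, snd (snd (snd y))) \<in> {a..0} \<times> {0..zb} \<times> {0..e}" if "y \<in> D'" for y
      using X_mem'[of y] zeta_mem[of y z0] z0 that by auto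
  qed (intro compact_Times compact_Icc)
  show "C_k_class r V (\<Phi> z0) D'" unfolding \<Phi>_def[abs_def]
    by (rule C_k_class_mult[OF flat_at_zero_add flat_at_zero_mult zeta_C mult_C[OF h1C mult_C[OF mult_C[OF const_C coord_C(3)]
          mult_C[OF inverse_q_C inverse_q_C]]]])
qed

end

text \<open>\<zeta> is the orbit as a graph over \<open>{x0..0}\<close>, and \<eta> is the value at
  \<open>x = 0\<close> of the correction u to ln (z / z0). The tolerance \<epsilon> and the factor
  \<open>exp 1\<close> both express |u| \<le> 1. The strict inequality after entry will exclude an
  early return to the section.\<close>

definition half_orbit ::
  "(real \<times> real \<times> real \<Rightarrow> real) \<Rightarrow> real \<Rightarrow> real \<Rightarrow> real \<Rightarrow> real \<Rightarrow> real \<Rightarrow> (real \<Rightarrow> real) \<Rightarrow> bool" where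
  "half_orbit h z0 c x0 \<epsilon> \<eta> \<zeta> \<longleftrightarrow>
     \<zeta> x0 = z0 \<and>
     (\<forall>x\<in>{x0..0}. 0 < \<zeta> x \<and>
        (\<zeta> has_real_derivative h (x, \<zeta> x, \<epsilon>) * \<zeta> x / \<epsilon>) (at x within {x0..0}) \<and>
        \<bar>\<epsilon> * ln (\<zeta> x / z0) - integral {x0..x} (\<lambda>s. h (s, 0, \<epsilon>))\<bar> \<le> \<epsilon> \<and>
        \<zeta> x \<le> z0 * exp 1 * exp (- (c * (x - x0) / \<epsilon>))) \<and>
     (\<forall>x\<in>{x0<..0}. \<zeta> x < z0) \<and>
     \<epsilon> * ln (\<zeta> 0 / z0) = integral {x0..0} (\<lambda>s. h (s, 0, \<epsilon>)) + \<epsilon> * \<eta>"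

section \<open>Size of the right-hand side and solution of the half problem\<close>

context half_system
begin

text \<open>Product of the bounds -a for |x0|, \<open>B\<close> for the Lipschitz constant of h in
  z, and \<open>exp 1\<close> for exp u.\<close>

definition K1 where "K1 = - a * B * exp 1"

lemma K1_nonneg: "0 \<le> K1" using ab B by (simp add: K1_def mult_nonpos_nonneg)

lemma abs_neg_mult_le: "x \<in> {a..b} \<Longrightarrow> 0 \<le> t \<Longrightarrow> \<bar>- x * t\<bar> \<le> (- a) * t"
  using ab by (simp add: abs_mult mult_right_mono)

text \<open>z times h1 is a difference of two values of h, so the Lipschitz constant
  \<open>B\<close> bounds it directly by \<open>B\<close> z.\<close>

lemma F_le:
  assumes z0: "0 < z0" "z0 * exp 1 \<le> zb" and y: "y \<in> D" and qy: "0 < q y"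
  shows "\<bar>F z0 y\<bar> \<le> z0 * K1 * (exp (\<theta> y) * (inverse (q y) * inverse (q y)))"
proof -
  have mem: "X y \<in> {a..0}" "zeta z0 y \<in> {0..zb}" "0 < zeta z0 y" "snd (snd (snd y)) \<in> {0..e}"
    using X_mem'[OF y qy] zeta_mem[OF y qy z0] y by auto
  have "\<bar>zeta z0 y * h1 (X y, zeta z0 y, snd (snd (snd y)))\<bar> \<le> B * \<bar>zeta z0 y - 0\<bar>"
    using h_lip[of "X y" "zeta z0 y" 0 "snd (snd (snd y))"] mem zb by (subst h1[symmetric]) auto
  also have "\<dots> = B * z0 * exp (\<theta> y) * exp (fst (snd y))" using mem by (simp add: zeta_def)
  also have "\<dots> \<le> B * z0 * exp (\<theta> y) * exp 1" using B z0 y by (intro mult_left_mono) auto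
  finally have 1: "\<bar>zeta z0 y * h1 (X y, zeta z0 y, snd (snd (snd y)))\<bar> \<le> B * z0 * exp (\<theta> y) * exp 1" .
  have "\<bar>- fst (snd (snd y)) * (inverse (q y) * inverse (q y))\<bar> \<le> (- a) * (inverse (q y) * inverse (q y))"
    by (rule abs_neg_mult_le) (use y qy in auto)
  with 1 have "\<bar>zeta z0 y * h1 (X y, zeta z0 y, snd (snd (snd y)))\<bar> * \<bar>- fst (snd (snd y)) * (inverse (q y) * inverse (q y))\<bar>
      \<le> (B * z0 * exp (\<theta> y) * exp 1) * ((- a) * (inverse (q y) * inverse (q y)))"
    using B z0 by (intro mult_mono) auto
  then show ?thesis using qy by (simp add: F_def \<Phi>_def K1_def abs_mult mult_ac)
qed

lemma F_diff_le:
  assumes z0: "0 < z0" "z0 * exp 1 \<le> zb" and y: "(s, u, p) \<in> D" "(s, u', p) \<in> D" and qy: "0 < q (s, u, p)"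
  shows "\<bar>F z0 (s, u, p) - F z0 (s, u', p)\<bar> \<le> z0 * K1 * (exp (\<theta> (s, u, p)) * (inverse (q (s, u, p)) * inverse (q (s, u, p)))) * \<bar>u - u'\<bar>"
proof -
  let ?y = "(s, u, p)" and ?y' = "(s, u', p)"
  have eq: "q ?y' = q ?y" "X ?y' = X ?y" "\<theta> ?y' = \<theta> ?y" by (simp_all add: q_def X_def \<theta>_def)
  have qy': "0 < q ?y'" using qy eq by simp
  have mem: "X ?y \<in> {a..0}" "zeta z0 ?y \<in> {0..zb}" "zeta z0 ?y' \<in> {0..zb}" "snd p \<in> {0..e}"
    using X_mem'[OF y(1) qy] zeta_mem[OF y(1) qy z0] zeta_mem[OF y(2) qy' z0] y by auto
  have "\<bar>zeta z0 ?y * h1 (X ?y, zeta z0 ?y, snd p) - zeta z0 ?y' * h1 (X ?y, zeta z0 ?y', snd p)\<bar> \<le> B * \<bar>zeta z0 ?y - zeta z0 ?y'\<bar>"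
    using h_lip[of "X ?y" "zeta z0 ?y" "zeta z0 ?y'" "snd p"] h1[of "X ?y" "zeta z0 ?y" "snd p"] h1[of "X ?y" "zeta z0 ?y'" "snd p"] mem
    by auto
  also have "zeta z0 ?y - zeta z0 ?y' = z0 * exp (\<theta> ?y) * (exp u - exp u')"
    by (simp add: zeta_def eq algebra_simps)
  also have "\<bar>\<dots>\<bar> = z0 * exp (\<theta> ?y) * \<bar>exp u - exp u'\<bar>" using z0 by (simp add: abs_mult)
  also have "B * \<dots> \<le> B * (z0 * exp (\<theta> ?y) * (exp 1 * \<bar>u - u'\<bar>))"
    using B z0 y by (intro mult_left_mono abs_exp_diff_le) auto
  finally have 1: "\<bar>zeta z0 ?y * h1 (X ?y, zeta z0 ?y, snd p) - zeta z0 ?y' * h1 (X ?y, zeta z0 ?y', snd p)\<bar>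
     \<le> B * (z0 * exp (\<theta> ?y) * (exp 1 * \<bar>u - u'\<bar>))" .
  have "\<bar>- fst p * (inverse (q ?y) * inverse (q ?y))\<bar> \<le> (- a) * (inverse (q ?y) * inverse (q ?y))"
    by (rule abs_neg_mult_le) (use y qy in auto)
  with 1 have 2: "\<bar>zeta z0 ?y * h1 (X ?y, zeta z0 ?y, snd p) - zeta z0 ?y' * h1 (X ?y, zeta z0 ?y', snd p)\<bar> * \<bar>- fst p * (inverse (q ?y) * inverse (q ?y))\<bar>
      \<le> B * (z0 * exp (\<theta> ?y) * (exp 1 * \<bar>u - u'\<bar>)) * ((- a) * (inverse (q ?y) * inverse (q ?y)))"
    using B z0 by (intro mult_mono) auto
  have "F z0 ?y - F z0 ?y' = (zeta z0 ?y * h1 (X ?y, zeta z0 ?y, snd p) - zeta z0 ?y' * h1 (X ?y, zeta z0 ?y', snd p)) * (- fst p * (inverse (q ?y) * inverse (q ?y)))"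
    using qy by (simp add: F_def \<Phi>_def eq left_diff_distrib mult.assoc)
  then have "\<bar>F z0 ?y - F z0 ?y'\<bar> = \<bar>zeta z0 ?y * h1 (X ?y, zeta z0 ?y, snd p) - zeta z0 ?y' * h1 (X ?y, zeta z0 ?y', snd p)\<bar> * \<bar>- fst p * (inverse (q ?y) * inverse (q ?y))\<bar>"
    by (simp only: abs_mult)
  with 2 show ?thesis by (simp add: K1_def mult_ac)
qed

text \<open>Flatness of order 2 cancels the Jacobian 1/q^2.\<close>

lemma exp_\<theta>_inverse_q_bound:
  obtains C where "0 \<le> C" "\<And>y. y \<in> D \<Longrightarrow> 0 < q y \<Longrightarrow> exp (\<theta> y) * (inverse (q y) * inverse (q y)) \<le> C"
proof -
  define C where "C = exp (- b * c) * ((real 2 + 1) * (2 / (- b * c))) ^ 2"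
  have "0 \<le> C" by (simp add: C_def)
  moreover have "exp (\<theta> y) * (inverse (q y) * inverse (q y)) \<le> C" if "y \<in> D" "0 < q y" for y
  proof -
    have "exp (\<theta> y) * (inverse (q y) * inverse (q y)) \<le> (C * q y ^ 2) * (inverse (q y) * inverse (q y))"
      using exp_\<theta>_le[OF that, of 2] that by (intro mult_right_mono) (auto simp: C_def)
    also have "\<dots> = C" using that by (simp add: power2_eq_square field_simps)
    finally show ?thesis .
  qed
  ultimately show ?thesis using that by blast
qed

lemma q_pos: "(s, u, x, \<epsilon>) \<in> D \<Longrightarrow> 0 < \<epsilon> \<Longrightarrow> 0 < q (s, u, x, \<epsilon>)"
proof -
  assume A: "(s, u, x, \<epsilon>) \<in> D" "0 < \<epsilon>"
  show ?thesis
  proof (cases "s = 0")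
    case True then show ?thesis by (simp add: q_def)
  next
    case False
    then have "0 < \<epsilon> * s" using A by auto
    then show ?thesis using A by (auto simp: q_def)
  qed
qed

text \<open>The last estimate is half of the bound on -\<theta> in \<open>\<theta>_le\<close>. It
  makes \<theta> + u negative as soon as \<sigma> > 0, which the bound |u| \<le> 1 alone could not
  do near the entry point.\<close>

lemma half_solution:
  obtains Z where "0 < Z" "Z * exp 1 \<le> zb"
    "\<And>z0. 0 < z0 \<Longrightarrow> z0 \<le> Z \<Longrightarrow> \<exists>u. continuous_on ({0..1} \<times> P) u \<and>
      (\<forall>s\<in>{0..1}. \<forall>p\<in>P. u (s, p) \<in> {-1..1}) \<and>
      (\<forall>\<sigma>\<in>{0..1}. \<forall>p\<in>P. u (\<sigma>, p) = integral {0..\<sigma>} (\<lambda>s. F z0 (s, u (s, p), p))) \<and>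
      C_k_on r u ({0..1} \<times> P) \<and>
      (\<forall>\<sigma>\<in>{0..1}. \<forall>x\<in>{a..b}. \<forall>\<epsilon>\<in>{0<..e}. \<bar>u (\<sigma>, x, \<epsilon>)\<bar> \<le> (- b) * c / 2 * (\<sigma> * inverse (q (\<sigma>, 0, x, \<epsilon>))))"
proof -
  obtain C where C: "0 \<le> C" "\<And>y. y \<in> D \<Longrightarrow> 0 < q y \<Longrightarrow> exp (\<theta> y) * (inverse (q y) * inverse (q y)) \<le> C"
    using exp_\<theta>_inverse_q_bound by blast
  \<comment> \<open>\<open>M\<close> dominates \<open>K1 * C\<close>, needed for the Picard
    estimates, and \<open>K1\<close>, needed for the estimate of u by the stretched time.\<close>
  define M where "M = K1 * (C + 1) + 1"
  have M: "0 < M" "K1 * C \<le> M" "K1 \<le> M" using K1_nonneg C(1) by (auto simp: M_def distrib_left add_nonneg_pos)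
  have bc: "0 < (- b) * c" using ab c by (intro mult_pos_pos) auto
  \<comment> \<open>The three terms keep z below zb, make the right-hand side and its Lipschitz
    constant at most 1/2, and make |u| at most half of the guaranteed decay.\<close>
  define Z where "Z = min (zb / exp 1) (min (1 / (2 * M)) ((- b) * c / (2 * M)))"
  have "0 < zb / exp 1" "0 < 1 / (2 * M)" "0 < (- b) * c / (2 * M)" using zb M bc by (intro divide_pos_pos; simp)+
  then have Z: "0 < Z" unfolding Z_def by (simp only: min_less_iff_conj)
  have Zzb: "Z * exp 1 \<le> zb"
  proof -
    have "Z \<le> zb / exp 1" by (simp add: Z_def)
    then show ?thesis by (simp add: pos_le_divide_eq)
  qed
  show ?thesis
  proof (rule that[OF Z Zzb])
    fix z0 assume z0: "0 < z0" "z0 \<le> Z"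
    have z0': "z0 * exp 1 \<le> zb" using z0 Zzb by (smt (verit) exp_gt_zero mult_right_mono)
    have zZ: "z0 * M \<le> Z * M" using z0 M by (intro mult_right_mono) auto
    have ZM: "Z * M \<le> 1/2" "Z * M \<le> (- b) * c / 2"
    proof -
      have "Z \<le> 1 / (2 * M)" "Z \<le> (- b) * c / (2 * M)" by (simp_all add: Z_def)
      then have "Z * (2 * M) \<le> 1" "Z * (2 * M) \<le> (- b) * c" 
        using M pos_le_divide_eq[of "2 * M" Z 1] pos_le_divide_eq[of "2 * M" Z "(- b) * c"] by linarith+
      then show "Z * M \<le> 1/2" "Z * M \<le> (- b) * c / 2" by simp_all
    qed
    have zM: "z0 * M \<le> 1/2" "z0 * M \<le> (- b) * c / 2" using zZ ZM by linarith+
    have zKC: "z0 * K1 * t \<le> 1/2" if "t \<le> C" "0 \<le> t" for t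
    proof -
      have "K1 * t \<le> K1 * C" using that K1_nonneg by (intro mult_left_mono)
      then have "z0 * (K1 * t) \<le> z0 * M" using M z0 by (intro mult_left_mono) auto
      then show ?thesis using zM by (simp add: mult.assoc)
    qed
    have Fz0: "F z0 y = 0" if "\<not> 0 < q y" for y using that by (simp add: F_def)
    have bd: "\<bar>F z0 (s, u, p)\<bar> \<le> 1" if "s \<in> {0..1}" "u \<in> {-1..1}" "p \<in> P" for s u p
    proof (cases "0 < q (s, u, p)")
      case True
      have y: "(s, u, p) \<in> D" using that by auto
      have "0 \<le> exp (\<theta> (s, u, p)) * (inverse (q (s, u, p)) * inverse (q (s, u, p)))" using True by simp
      from F_le[OF z0(1) z0' y True] zKC[OF C(2)[OF y True] this] show ?thesis by linarith
    qed (simp add: Fz0)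
    have lip: "\<bar>F z0 (s, u, p) - F z0 (s, u', p)\<bar> \<le> 1/2 * \<bar>u - u'\<bar>" if "s \<in> {0..1}" "u \<in> {-1..1}" "u' \<in> {-1..1}" "p \<in> P" for s u u' p
    proof (cases "0 < q (s, u, p)")
      case True
      have y: "(s, u, p) \<in> D" "(s, u', p) \<in> D" using that by auto
      have "0 \<le> exp (\<theta> (s, u, p)) * (inverse (q (s, u, p)) * inverse (q (s, u, p)))" using True by simp
      from mult_right_mono[OF zKC[OF C(2)[OF y(1) True] this], of "\<bar>u - u'\<bar>"] F_diff_le[OF z0(1) z0' y True]
      show ?thesis by linarith
    next
      case False
      then have "\<not> 0 < q (s, u', p)" by (simp add: q_def)
      then show ?thesis using False by (simp add: Fz0)
    qed
    have FC: "C_k_on r (F z0) D" by (rule F_C[OF z0(1) z0'])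
    have cP: "convex P" by (intro convex_Times convex_real_interval)
    obtain u where u: "continuous_on ({0..1} \<times> P) u" "\<And>s p. s \<in> {0..1} \<Longrightarrow> p \<in> P \<Longrightarrow> u (s, p) \<in> {-1..1}"
      "\<And>\<sigma> p. \<sigma> \<in> {0..1} \<Longrightarrow> p \<in> P \<Longrightarrow> u (\<sigma>, p) = integral {0..\<sigma>} (\<lambda>s. F z0 (s, u (s, p), p))"
      by (rule picard_solution[OF C_k_on_continuous[OF FC] bd lip cP], assumption+, rule that)
    have uC: "C_k_on r u ({0..1} \<times> P)"
      by (rule C_k_on_ode_solution[OF cP _ u(1) u(2) u(3) FC]) auto
    have "\<bar>u (\<sigma>, x, \<epsilon>)\<bar> \<le> (- b) * c / 2 * (\<sigma> * inverse (q (\<sigma>, 0, x, \<epsilon>)))"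
      if \<sigma>: "\<sigma> \<in> {0..1}" and x: "x \<in> {a..b}" and \<epsilon>: "\<epsilon> \<in> {0<..e}" for \<sigma> x \<epsilon>
    proof -
      let ?p = "(x, \<epsilon>)"
      have p: "?p \<in> P" using x \<epsilon> by auto
      have Q: "0 < 1 - s + \<epsilon> * s" if "s \<in> {0..1}" for s
        using q_pos[of s 0 x \<epsilon>] that x \<epsilon> by (auto simp: q_def)
      have sub: "{0..\<sigma>} \<subseteq> {0..1}" using \<sigma> by auto
      \<comment> \<open>The primitive of 1/q^2 is s/q, the stretched time itself.\<close>
      have int: "((\<lambda>s. z0 * K1 * (inverse (1 - s + \<epsilon> * s) * inverse (1 - s + \<epsilon> * s))) has_integral
           (z0 * K1 * (\<sigma> * inverse (1 - \<sigma> + \<epsilon> * \<sigma>)) - z0 * K1 * (0 * inverse (1 - 0 + \<epsilon> * 0)))) {0..\<sigma>}"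
      proof (rule fundamental_theorem_of_calculus)
        fix s assume "s \<in> {0..\<sigma>}"
        then have "0 < 1 - s + \<epsilon> * s" using Q sub by blast
        then have "((\<lambda>s. z0 * K1 * (s * inverse (1 - s + \<epsilon> * s))) has_real_derivative
            z0 * K1 * (inverse (1 - s + \<epsilon> * s) * inverse (1 - s + \<epsilon> * s))) (at s within {0..\<sigma>})"
          by (auto intro!: derivative_eq_intros simp: field_simps)
        then show "((\<lambda>s. z0 * K1 * (s * inverse (1 - s + \<epsilon> * s))) has_vector_derivative
            z0 * K1 * (inverse (1 - s + \<epsilon> * s) * inverse (1 - s + \<epsilon> * s))) (at s within {0..\<sigma>})"
          by (simp add: has_real_derivative_iff_has_vector_derivative)
      qed (use \<sigma> in auto)
      have cont: "continuous_on {0..1} (\<lambda>s. F z0 (s, u (s, ?p), ?p))"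
        using continuous_on_slice1[OF u(1) p] u(2)[OF _ p] p
        by (intro continuous_on_compose2[OF C_k_on_continuous[OF FC]]) (auto intro!: continuous_intros)
      have "norm (integral {0..\<sigma>} (\<lambda>s. F z0 (s, u (s, ?p), ?p))) \<le>
          integral {0..\<sigma>} (\<lambda>s. z0 * K1 * (inverse (1 - s + \<epsilon> * s) * inverse (1 - s + \<epsilon> * s)))"
      proof (rule integral_norm_bound_integral)
        show "(\<lambda>s. F z0 (s, u (s, ?p), ?p)) integrable_on {0..\<sigma>}"
          using cont sub by (intro integrable_continuous_real continuous_on_subset[OF cont])
        show "(\<lambda>s. z0 * K1 * (inverse (1 - s + \<epsilon> * s) * inverse (1 - s + \<epsilon> * s))) integrable_on {0..\<sigma>}"
          using int by blast
        fix s assume "s \<in> {0..\<sigma>}"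
        then have s: "s \<in> {0..1}" using sub by blast
        have y: "(s, u (s, ?p), ?p) \<in> D" using s u(2)[OF s p] p by auto
        have qy: "0 < q (s, u (s, ?p), ?p)" using q_pos[OF y] \<epsilon> by auto
        have "exp (\<theta> (s, u (s, ?p), ?p)) \<le> 1" using \<theta>_nonpos[OF y qy] by simp
        then have "z0 * K1 * (exp (\<theta> (s, u (s, ?p), ?p)) * (inverse (q (s, u (s, ?p), ?p)) * inverse (q (s, u (s, ?p), ?p))))
            \<le> z0 * K1 * (1 * (inverse (q (s, u (s, ?p), ?p)) * inverse (q (s, u (s, ?p), ?p))))"
          using z0 K1_nonneg qy by (intro mult_left_mono mult_right_mono mult_nonneg_nonneg) auto
        then show "norm (F z0 (s, u (s, ?p), ?p)) \<le> z0 * K1 * (inverse (1 - s + \<epsilon> * s) * inverse (1 - s + \<epsilon> * s))"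
          using F_le[OF z0(1) z0' y qy] by (simp add: q_def)
      qed
      also have "\<dots> = z0 * K1 * (\<sigma> * inverse (1 - \<sigma> + \<epsilon> * \<sigma>))" by (simp only: integral_unique[OF int])
      also have "\<dots> \<le> (- b) * c / 2 * (\<sigma> * inverse (1 - \<sigma> + \<epsilon> * \<sigma>))"
      proof (rule mult_right_mono)
        have "z0 * K1 \<le> z0 * M" using M z0 by (intro mult_left_mono) auto
        then show "z0 * K1 \<le> (- b) * c / 2" using zM by linarith
        show "0 \<le> \<sigma> * inverse (1 - \<sigma> + \<epsilon> * \<sigma>)" using Q[OF \<sigma>] \<sigma> by simp
      qed
      finally show ?thesis using u(3)[OF \<sigma> p] by (simp add: q_def)
    qed
    then show "\<exists>u. continuous_on ({0..1} \<times> P) u \<and>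
      (\<forall>s\<in>{0..1}. \<forall>p\<in>P. u (s, p) \<in> {-1..1}) \<and>
      (\<forall>\<sigma>\<in>{0..1}. \<forall>p\<in>P. u (\<sigma>, p) = integral {0..\<sigma>} (\<lambda>s. F z0 (s, u (s, p), p))) \<and>
      C_k_on r u ({0..1} \<times> P) \<and>
      (\<forall>\<sigma>\<in>{0..1}. \<forall>x\<in>{a..b}. \<forall>\<epsilon>\<in>{0<..e}. \<bar>u (\<sigma>, x, \<epsilon>)\<bar> \<le> (- b) * c / 2 * (\<sigma> * inverse (q (\<sigma>, 0, x, \<epsilon>))))"
      using u uC by blast
  qed
qed

text \<open>For \<epsilon> > 0 the substitution is undone by the map \<open>sg\<close> from x to
  \<sigma>. The point \<open>x = 0\<close> corresponds to \<sigma> = 1 for every such \<epsilon>, so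
  \<eta> is u at \<sigma> = 1, a function that is of class C^r also at \<epsilon> = 0.\<close>

lemma half_orbits:
  obtains Z where "0 < Z"
    "\<And>z0. 0 < z0 \<Longrightarrow> z0 \<le> Z \<Longrightarrow> \<exists>\<eta>. C_k_on r \<eta> P \<and>
      (\<forall>x0\<in>{a..b}. \<forall>\<epsilon>\<in>{0<..e}. \<exists>\<zeta>. half_orbit h z0 c x0 \<epsilon> (\<eta> (x0, \<epsilon>)) \<zeta>)"
proof -
  obtain Z where Z: "0 < Z" "Z * exp 1 \<le> zb" and sol: "\<And>z0. 0 < z0 \<Longrightarrow> z0 \<le> Z \<Longrightarrow> \<exists>u. continuous_on ({0..1} \<times> P) u \<and>
      (\<forall>s\<in>{0..1}. \<forall>p\<in>P. u (s, p) \<in> {-1..1}) \<and>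
      (\<forall>\<sigma>\<in>{0..1}. \<forall>p\<in>P. u (\<sigma>, p) = integral {0..\<sigma>} (\<lambda>s. F z0 (s, u (s, p), p))) \<and>
      C_k_on r u ({0..1} \<times> P) \<and>
      (\<forall>\<sigma>\<in>{0..1}. \<forall>x\<in>{a..b}. \<forall>\<epsilon>\<in>{0<..e}. \<bar>u (\<sigma>, x, \<epsilon>)\<bar> \<le> (- b) * c / 2 * (\<sigma> * inverse (q (\<sigma>, 0, x, \<epsilon>))))"
    by (rule half_solution, rule that) 
  show ?thesis
  proof (rule that[OF Z(1)])
    fix z0 assume z0: "0 < z0" "z0 \<le> Z"
    have z0': "z0 * exp 1 \<le> zb" using z0 Z(2) by (smt (verit) exp_gt_zero mult_right_mono)
    obtain u where u: "continuous_on ({0..1} \<times> P) u" "\<And>s p. s \<in> {0..1} \<Longrightarrow> p \<in> P \<Longrightarrow> u (s, p) \<in> {-1..1}"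
      "\<And>\<sigma> p. \<sigma> \<in> {0..1} \<Longrightarrow> p \<in> P \<Longrightarrow> u (\<sigma>, p) = integral {0..\<sigma>} (\<lambda>s. F z0 (s, u (s, p), p))"
      "C_k_on r u ({0..1} \<times> P)"
      "\<And>\<sigma> x \<epsilon>. \<sigma>\<in>{0..1} \<Longrightarrow> x\<in>{a..b} \<Longrightarrow> \<epsilon>\<in>{0<..e} \<Longrightarrow> \<bar>u (\<sigma>, x, \<epsilon>)\<bar> \<le> (- b) * c / 2 * (\<sigma> * inverse (q (\<sigma>, 0, x, \<epsilon>)))"
      using sol[OF z0] by auto
    have \<eta>: "C_k_on r (\<lambda>p. u (1, p)) P"
      by (rule C_k_on_compose[OF u(4) comp_C_k_Pair[OF comp_C_k_UNIV_real[THEN iffD2, OF C_k_on_const] comp_C_k_linear[OF bounded_linear_ident]]])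
         auto
    have "\<exists>\<zeta>. half_orbit h z0 c x0 \<epsilon> (u (1, x0, \<epsilon>)) \<zeta>" if x0: "x0 \<in> {a..b}" and \<epsilon>: "\<epsilon> \<in> {0<..e}" for x0 \<epsilon>
    proof -
      have p: "(x0, \<epsilon>) \<in> P" and x0n: "x0 < 0" and ep: "0 < \<epsilon>" "\<epsilon> \<le> 1" using x0 \<epsilon> ab e by auto
      \<comment> \<open>Inserting v = (x - x0) / (\<epsilon> |x0|) into \<sigma> = v / (1 + v (1 -
        \<epsilon>)) and clearing the inner fraction gives \<sigma> = (x - x0) /
        \<open>N x\<close>.\<close>
      define N where "N x = - \<epsilon> * x0 + (x - x0) * (1 - \<epsilon>)" for x
      define sg where "sg x = (x - x0) * inverse (N x)" for x
      define I where "I x = integral {x0..x} (\<lambda>s. h (s, 0, \<epsilon>))" for x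
      define W where "W x = u (sg x, x0, \<epsilon>) + I x / \<epsilon>" for x
      define \<zeta> where "\<zeta> x = z0 * exp (W x)" for x
      have ex0: "0 < - \<epsilon> * x0" using x0n ep by (simp add: mult_pos_neg)
      have N: "0 < N x" "- \<epsilon> * x0 \<le> N x" if "x \<in> {x0..0}" for x
      proof -
        have "0 \<le> (x - x0) * (1 - \<epsilon>)" using that ep by (intro mult_nonneg_nonneg) auto
        then show "0 < N x" "- \<epsilon> * x0 \<le> N x" using ex0 unfolding N_def by linarith+
      qed
      have N_eq: "N x - (x - x0) = - \<epsilon> * x" for x by (simp add: N_def algebra_simps)
      have sg: "sg x \<in> {0..1}" if x: "x \<in> {x0..0}" for x
      proof -
        have "0 \<le> - \<epsilon> * x" using x ep by (simp add: mult_nonneg_nonpos)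
        then have "x - x0 \<le> N x" using N_eq[of x] by linarith
        then show ?thesis using N[OF x] x by (auto simp: sg_def field_simps)
      qed
      have q_sg: "q (sg x, v, x0, \<epsilon>) = - \<epsilon> * x0 * inverse (N x)" if x: "x \<in> {x0..0}" for x v
      proof -
        have "q (sg x, v, x0, \<epsilon>) * N x = N x - (x - x0) * (1 - \<epsilon>)"
          using N[OF x] by (simp add: q_def sg_def algebra_simps)
        also have "\<dots> = - \<epsilon> * x0" by (simp add: N_def)
        finally show ?thesis using N[OF x] by (simp add: field_simps)
      qed
      have iq_sg: "inverse (q (sg x, v, x0, \<epsilon>)) = N x * inverse (- \<epsilon> * x0)" if x: "x \<in> {x0..0}" for x v
        unfolding q_sg[OF x] by (simp add: nonzero_inverse_mult_distrib)
      have v_sg: "sg x * inverse (q (sg x, v, x0, \<epsilon>)) = (x - x0) * inverse (- \<epsilon> * x0)" if x: "x \<in> {x0..0}" for x v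
      proof -
        have "sg x * (N x * inverse (- \<epsilon> * x0)) = (x - x0) * inverse (- \<epsilon> * x0)" using N[OF x] by (simp add: sg_def)
        then show ?thesis unfolding iq_sg[OF x] .
      qed
      have X_sg: "X (sg x, v, x0, \<epsilon>) = x" if x: "x \<in> {x0..0}" for x v
      proof -
        have "X (sg x, v, x0, \<epsilon>) = x0 * ((1 - sg x) * N x) * inverse (- \<epsilon> * x0)"
          by (simp add: X_def iq_sg[OF x])
        also have "(1 - sg x) * N x = N x - (x - x0)" 
        proof -
          have "sg x * N x = x - x0" using N(1)[OF x] by (simp add: sg_def)
          then show ?thesis by (simp add: left_diff_distrib)
        qed
        also have "\<dots> = - \<epsilon> * x" by (rule N_eq)
        finally show ?thesis using x0n ep by (simp add: field_simps)
      qed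
      have D: "(sg x, u (sg x, x0, \<epsilon>), x0, \<epsilon>) \<in> D" if x: "x \<in> {x0..0}" for x
        using sg[OF x] u(2)[OF sg[OF x] p] p by auto
      have sub: "{x0..0} \<subseteq> {a..0}" using x0 by auto
      have h0: "continuous_on {a..0} (\<lambda>s. h (s, 0, \<epsilon>))"
        using \<epsilon> zb by (intro continuous_on_compose2[OF C_k_on_continuous[OF h_C]]) (auto intro!: continuous_intros)
      have I_mean: "I x = (x - x0) * mean (x0, x, \<epsilon>)" if x: "x \<in> {x0..0}" for x
        unfolding I_def mean_def fst_conv snd_conv
        by (rule integral_eq_segment_mean) (use x sub in \<open>auto intro: continuous_on_subset[OF h0]\<close>)
      have \<theta>_sg: "\<theta> (sg x, v, x0, \<epsilon>) = I x / \<epsilon>" if x: "x \<in> {x0..0}" for x v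
        unfolding \<theta>_def fst_conv snd_conv v_sg[OF x] X_sg[OF x] I_mean[OF x]
        using x0n ep by (simp add: field_simps)
      have zeta_sg: "zeta z0 (sg x, u (sg x, x0, \<epsilon>), x0, \<epsilon>) = \<zeta> x" if x: "x \<in> {x0..0}" for x
        unfolding zeta_def \<theta>_sg[OF x] by (simp add: \<zeta>_def W_def exp_add)
      have \<zeta>_mem: "0 < \<zeta> x" "\<zeta> x \<le> zb" if x: "x \<in> {x0..0}" for x
        using zeta_mem[OF D[OF x] q_pos[OF D[OF x] ep(1)] z0(1) z0'] by (auto simp: zeta_sg[OF x])
      have I_le: "I x / \<epsilon> \<le> - (c * (x - x0) / \<epsilon>)" if x: "x \<in> {x0..0}" for x
      proof -
        have "mean (x0, x, \<epsilon>) \<le> - c" unfolding mean_def fst_conv snd_conv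
          by (rule mean_le) (use x x0 sub \<epsilon> in auto)
        then have "I x \<le> (x - x0) * (- c)" unfolding I_mean[OF x] using x by (intro mult_left_mono) auto
        then show ?thesis using ep by (simp add: field_simps)
      qed
      have W_der: "(W has_real_derivative h (x, \<zeta> x, \<epsilon>) / \<epsilon>) (at x within {x0..0})" if x: "x \<in> {x0..0}" for x
      proof -
        let ?y = "(sg x, u (sg x, x0, \<epsilon>), x0, \<epsilon>)"
        have cont: "continuous_on {0..1} (\<lambda>s. F z0 (s, u (s, x0, \<epsilon>), x0, \<epsilon>))"
          using continuous_on_slice1[OF u(1) p] u(2)[OF _ p] p
          by (intro continuous_on_compose2[OF C_k_on_continuous[OF F_C[OF z0(1) z0']]]) (auto intro!: continuous_intros)
        have "((\<lambda>\<sigma>. integral {0..\<sigma>} (\<lambda>s. F z0 (s, u (s, x0, \<epsilon>), x0, \<epsilon>))) has_real_derivative F z0 ?y) (at (sg x) within {0..1})"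
          using integral_has_vector_derivative[OF cont sg[OF x]] by (simp add: has_real_derivative_iff_has_vector_derivative)
        then have "((\<lambda>\<sigma>. u (\<sigma>, x0, \<epsilon>)) has_real_derivative F z0 ?y) (at (sg x) within {0..1})"
          unfolding has_field_derivative_def
          by (rule has_derivative_transform[OF sg[OF x], rotated]) (simp add: u(3)[OF _ p])
        then have 1: "((\<lambda>\<sigma>. u (\<sigma>, x0, \<epsilon>)) has_real_derivative F z0 ?y) (at (sg x) within sg ` {x0..0})"
          by (rule DERIV_subset) (use sg in auto)
        have 2: "(sg has_real_derivative - \<epsilon> * x0 * (inverse (N x) * inverse (N x))) (at x within {x0..0})"
        proof -
          have "(N has_real_derivative (1 - \<epsilon>)) (at x within {x0..0})"
            unfolding N_def[abs_def] by (auto intro!: derivative_eq_intros)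
          then have "(sg has_real_derivative (1 * inverse (N x) + (- (inverse (N x) * (1 - \<epsilon>) * inverse (N x))) * (x - x0))) (at x within {x0..0})"
            unfolding sg_def[abs_def] using N(1)[OF x]
            by (auto intro!: derivative_eq_intros)
          moreover have "1 * inverse (N x) + (- (inverse (N x) * (1 - \<epsilon>) * inverse (N x))) * (x - x0) = (N x - (1 - \<epsilon>) * (x - x0)) * (inverse (N x) * inverse (N x))"
            using N(1)[OF x] by (simp add: field_simps)
          moreover have "N x - (1 - \<epsilon>) * (x - x0) = - \<epsilon> * x0" by (simp add: N_def)
          ultimately show ?thesis by simp
        qed
        have 3: "((\<lambda>x. u (sg x, x0, \<epsilon>)) has_real_derivative F z0 ?y * (- \<epsilon> * x0 * (inverse (N x) * inverse (N x)))) (at x within {x0..0})"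
          using DERIV_image_chain[OF 1 2] by (simp add: o_def)
        have hc: "continuous_on {x0..0} (\<lambda>s. h (s, 0, \<epsilon>))" by (rule continuous_on_subset[OF h0 sub])
        have 4: "(I has_real_derivative h (x, 0, \<epsilon>)) (at x within {x0..0})"
          using integral_has_vector_derivative[OF hc x] unfolding I_def[abs_def]
          by (simp add: has_real_derivative_iff_has_vector_derivative)
        have "(W has_real_derivative F z0 ?y * (- \<epsilon> * x0 * (inverse (N x) * inverse (N x))) + h (x, 0, \<epsilon>) / \<epsilon>) (at x within {x0..0})"
          unfolding W_def[abs_def] by (intro DERIV_add 3 DERIV_cdivide 4)
        \<comment> \<open>The derivative of \<open>sg\<close> equals q^2 / (\<epsilon> |x0|), so it
          cancels the factor |x0| / q^2 of \<Phi> and leaves 1/\<epsilon>.\<close>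
        moreover have A: "F z0 ?y * (- \<epsilon> * x0 * (inverse (N x) * inverse (N x))) = \<zeta> x * h1 (x, \<zeta> x, \<epsilon>) / \<epsilon>"
          using q_pos[OF D[OF x] ep(1)] N(1)[OF x] x0n ep
          unfolding F_def \<Phi>_def fst_conv snd_conv zeta_sg[OF x] X_sg[OF x] iq_sg[OF x] by (simp add: field_simps)
        have B: "\<zeta> x * h1 (x, \<zeta> x, \<epsilon>) = h (x, \<zeta> x, \<epsilon>) - h (x, 0, \<epsilon>)"
          using \<zeta>_mem[OF x] x sub \<epsilon> by (intro h1[symmetric]) auto
        have "F z0 ?y * (- \<epsilon> * x0 * (inverse (N x) * inverse (N x))) + h (x, 0, \<epsilon>) / \<epsilon> = h (x, \<zeta> x, \<epsilon>) / \<epsilon>"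
          unfolding A B by (simp add: diff_divide_distrib)
        ultimately show ?thesis by (simp only:)
      qed
      have u_le: "\<bar>u (sg x, x0, \<epsilon>)\<bar> \<le> 1" if x: "x \<in> {x0..0}" for x using u(2)[OF sg[OF x] p] by auto
      have ln_\<zeta>: "ln (\<zeta> x / z0) = W x" for x using z0 by (simp add: \<zeta>_def)
      have W0: "W x0 = 0" using u(3)[of 0 "(x0, \<epsilon>)"] p by (simp add: W_def sg_def I_def)
      have "half_orbit h z0 c x0 \<epsilon> (u (1, x0, \<epsilon>)) \<zeta>"
        unfolding half_orbit_def
      proof (intro conjI ballI)
        show "\<zeta> x0 = z0" using W0 by (simp add: \<zeta>_def)
        have "sg 0 = 1" using x0n ep ex0 by (simp add: sg_def N_def algebra_simps)
        then show "\<epsilon> * ln (\<zeta> 0 / z0) = integral {x0..0} (\<lambda>s. h (s, 0, \<epsilon>)) + \<epsilon> * u (1, x0, \<epsilon>)"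
          unfolding ln_\<zeta> using ep by (simp add: W_def I_def field_simps)
      next
        fix x assume x: "x \<in> {x0..0}"
        show "0 < \<zeta> x" by (rule \<zeta>_mem(1)[OF x])
        show "(\<zeta> has_real_derivative h (x, \<zeta> x, \<epsilon>) * \<zeta> x / \<epsilon>) (at x within {x0..0})"
          unfolding \<zeta>_def[abs_def] using W_der[OF x] by (auto intro!: derivative_eq_intros simp: \<zeta>_def)
        have "\<epsilon> * ln (\<zeta> x / z0) - I x = \<epsilon> * u (sg x, x0, \<epsilon>)" unfolding ln_\<zeta> W_def using ep by (simp add: field_simps)
        moreover have "\<bar>\<epsilon> * u (sg x, x0, \<epsilon>)\<bar> \<le> \<epsilon>" using u_le[OF x] ep by (simp add: abs_mult)
        ultimately show "\<bar>\<epsilon> * ln (\<zeta> x / z0) - integral {x0..x} (\<lambda>s. h (s, 0, \<epsilon>))\<bar> \<le> \<epsilon>" by (simp add: I_def)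
        have "W x \<le> 1 - c * (x - x0) / \<epsilon>" unfolding W_def using u_le[OF x] I_le[OF x] by linarith
        then have "z0 * exp (W x) \<le> z0 * (exp 1 * exp (- (c * (x - x0) / \<epsilon>)))"
          using z0 by (simp add: exp_add[symmetric])
        then show "\<zeta> x \<le> z0 * exp 1 * exp (- (c * (x - x0) / \<epsilon>))" by (simp add: \<zeta>_def)
      next
        fix x assume "x \<in> {x0<..0}"
        then have x: "x \<in> {x0..0}" and xx: "0 < x - x0" by auto
        \<comment> \<open>Strictness: |u| is at most half of c (x - x0) / \<epsilon>, while the
          integral part of \<open>W\<close> is at most minus that whole amount.\<close>
        have "\<bar>u (sg x, x0, \<epsilon>)\<bar> \<le> (- b) * c / 2 * ((x - x0) * inverse (- \<epsilon> * x0))"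
          using u(5)[OF sg[OF x] x0 \<epsilon>] unfolding v_sg[OF x] .
        also have "\<dots> \<le> (- x0) * c / 2 * ((x - x0) * inverse (- \<epsilon> * x0))"
        proof (intro mult_right_mono divide_right_mono)
          show "0 \<le> (x - x0) * inverse (- \<epsilon> * x0)"
            using xx less_imp_le[OF positive_imp_inverse_positive[OF ex0]] by (intro mult_nonneg_nonneg) auto
        qed (use x0 c in auto)
        also have "\<dots> = c * (x - x0) / \<epsilon> / 2" using x0n ep by (simp add: field_simps)
        also have "\<dots> < c * (x - x0) / \<epsilon>"
        proof -
          have "0 < c * (x - x0) / \<epsilon>" using c xx ep by (intro divide_pos_pos mult_pos_pos)
          then show ?thesis by (metis half_gt_zero_iff field_sum_of_halves less_add_same_cancel1)
        qed
        finally have "W x < 0" unfolding W_def using I_le[OF x] by linarith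
        then show "\<zeta> x < z0" using z0 by (simp add: \<zeta>_def)
      qed
      then show ?thesis by blast
    qed
    with \<eta> show "\<exists>\<eta>. C_k_on r \<eta> P \<and>
      (\<forall>x0\<in>{a..b}. \<forall>\<epsilon>\<in>{0<..e}. \<exists>\<zeta>. half_orbit h z0 c x0 \<epsilon> (\<eta> (x0, \<epsilon>)) \<zeta>)"
      by (intro exI[where x="\<lambda>p. u (1, p)"]) simp
  qed
qed

end

text \<open>Supplies the data of \<open>half_system\<close>. The factor h1 is a mean of the partial
  derivative of h in z, which is where one order of smoothness is lost; the decay of means is
  obtained at \<epsilon> = 0 and extended to small \<epsilon> by compactness.\<close>

lemma half_problem:
  fixes h :: "real \<times> real \<times> real \<Rightarrow> real"
  assumes h: "C_k_on (Suc r) h ({a..0} \<times> {0..zb} \<times> {0..eb})"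
    and ab: "a \<le> b" "b < 0" and zb: "0 < zb" and eb: "0 < eb"
    and neg: "\<And>x. a \<le> x \<Longrightarrow> x < 0 \<Longrightarrow> h (x, 0, 0) < 0"
  obtains c e Z where "0 < c" "0 < e" "e \<le> eb" "0 < Z"
    "\<And>z0. 0 < z0 \<Longrightarrow> z0 \<le> Z \<Longrightarrow> \<exists>\<eta>. C_k_on r \<eta> ({a..b} \<times> {0..e}) \<and>
      (\<forall>x0\<in>{a..b}. \<forall>\<epsilon>\<in>{0<..e}. \<exists>\<zeta>. half_orbit h z0 c x0 \<epsilon> (\<eta> (x0, \<epsilon>)) \<zeta>)"
proof -
  let ?T = "{a..0} \<times> {0..zb} \<times> {0..eb}"
  have T: "convex ?T" "compact ?T" by (intro convex_Times convex_real_interval, intro compact_Times compact_Icc)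
  obtain A where A: "\<And>p. p \<in> ?T \<Longrightarrow> has_partials h A p ?T"
    "\<And>b. b \<in> Basis \<Longrightarrow> C_k_on r (A b) ?T" by (rule C_k_on_SucE[OF h], rule that)
  have contA: "\<And>b. b \<in> Basis \<Longrightarrow> continuous_on ?T (A b)" by (rule C_k_on_continuous[OF A(2)])
  define hz where "hz = A (0, 1, 0)"
  have basis: "(0, 1, 0) \<in> (Basis :: (real \<times> real \<times> real) set)" by (simp add: Basis_prod_def)
  have hz: "C_k_on r hz ?T" "continuous_on ?T hz" unfolding hz_def by (rule A(2)[OF basis], rule contA[OF basis])
  have "bounded (hz ` ?T)" using compact_continuous_image[OF hz(2) T(2)] by (rule compact_imp_bounded)
  then obtain B where B: "0 < B" "\<And>y. y \<in> ?T \<Longrightarrow> \<bar>hz y\<bar> \<le> B" unfolding bounded_pos by auto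
  have diff: "h (x, z, \<epsilon>) - h (x, z', \<epsilon>) = (z - z') * segment_mean hz (x, z', \<epsilon>) (x, z, \<epsilon>)"
    if "x \<in> {a..0}" "z \<in> {0..zb}" "z' \<in> {0..zb}" "\<epsilon> \<in> {0..eb}" for x z z' \<epsilon>
  proof -
    have "h (x, z, \<epsilon>) - h (x, z', \<epsilon>) = (\<Sum>b\<in>Basis. (((x, z, \<epsilon>) - (x, z', \<epsilon>)) \<bullet> b) * segment_mean (A b) (x, z', \<epsilon>) (x, z, \<epsilon>))"
      by (rule difference_eq_segment_mean[OF T(1) _ _ A(1) contA]) (use that in auto)
    then show ?thesis by (simp add: sum_Basis_prod hz_def)
  qed
  have mean_bd: "\<bar>segment_mean hz p q\<bar> \<le> B" if "p \<in> ?T" "q \<in> ?T" for p q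
  proof -
    have mem: "p + \<tau> *\<^sub>R (q - p) \<in> ?T" if "\<tau> \<in> {0..1}" for \<tau>
      by (rule convex_segment_mem[OF T(1)]) (use that \<open>p \<in> ?T\<close> \<open>q \<in> ?T\<close> in auto)
    have "norm (integral {0..1} (\<lambda>\<tau>. hz (p + \<tau> *\<^sub>R (q - p)))) \<le> B * (1 - 0)"
    proof (rule integral_bound)
      show "continuous_on {0..1} (\<lambda>\<tau>. hz (p + \<tau> *\<^sub>R (q - p)))"
        by (rule continuous_on_compose2[OF hz(2) _ image_subsetI[OF mem]]) (intro continuous_intros)
      show "norm (hz (p + \<tau> *\<^sub>R (q - p))) \<le> B" if "\<tau> \<in> {0..1}" for \<tau> using B(2)[OF mem[OF that]] by simp
    qed simp
    then show ?thesis by (simp add: segment_mean_def)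
  qed
  define h1 where "h1 y = integral {0..1} (\<lambda>\<tau>. hz (fst y, \<tau> * fst (snd y), snd (snd y)))" for y
  have h1: "C_k_on r h1 ?T" unfolding h1_def[abs_def]
  proof -
    have "C_k_on r (\<lambda>y. hz (fst (snd y), fst y * fst (snd (snd y)), snd (snd (snd y)))) ({0..1} \<times> ?T)"
    proof (rule C_k_on_compose[OF hz(1)])
      show "comp_C_k r UNIV (\<lambda>y. (fst (snd y), fst y * fst (snd (snd y)), snd (snd (snd y)))) ({0..1::real} \<times> ?T)"
        by (intro comp_C_k_Pair; unfold comp_C_k_UNIV_real; (intro C_k_on_mult)?)
           (intro C_k_on_linear bounded_linear_fst bounded_linear_fst_comp bounded_linear_snd_comp bounded_linear_snd)+
      show "(fst (snd y), fst y * fst (snd (snd y)), snd (snd (snd y))) \<in> ?T" if y: "y \<in> {0..1::real} \<times> ?T" for y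
      proof -
        have "fst y * fst (snd (snd y)) \<le> 1 * zb" using y zb by (intro mult_mono) auto
        then show ?thesis using y by auto
      qed
    qed
    from C_k_on_integral_param[OF T(1) this]
    show "C_k_on r (\<lambda>y. integral {0..1} (\<lambda>\<tau>. hz (fst y, \<tau> * fst (snd y), snd (snd y)))) ?T" by (simp del: C_k_on.simps)
  qed
  have h1_eq: "h (x, z, \<epsilon>) - h (x, 0, \<epsilon>) = z * h1 (x, z, \<epsilon>)"
    if "x \<in> {a..0}" "z \<in> {0..zb}" "\<epsilon> \<in> {0..eb}" for x z \<epsilon>
    using diff[of x z 0 \<epsilon>] that zb by (simp add: h1_def segment_mean_def)
  have contg: "continuous_on {a..0} (\<lambda>s. h (s, 0, 0))"
    by (rule continuous_on_compose2[OF C_k_on_continuous[OF h]]) (use zb eb in \<open>auto intro!: continuous_intros\<close>)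
  have g0: "h (0, 0, 0) \<le> 0"
  proof (rule continuous_le_on_closure[where S="{a..<0}" and f="\<lambda>s. h (s, 0, 0)"])
    have "closure {a..<0} = {a..0}" using ab by (intro closure_atLeastLessThan) auto
    then show "continuous_on (closure {a..<0}) (\<lambda>s. h (s, 0, 0))" "0 \<in> closure {a..<0}" using contg ab by auto
    show "h (x, 0, 0) \<le> 0" if "x \<in> {a..<0}" for x using neg[of x] that by auto
  qed
  have g_le: "h (x, 0, 0) \<le> 0" if "x \<in> {a..0}" for x using neg[of x] g0 that by (cases "x = 0") auto
  \<comment> \<open>At \<epsilon> = 0 the integrand of this mean is nonnegative and positive at its
    starting point x0 < 0, so the mean is positive even when the segment reaches the zero of h at
    \<open>x = 0\<close>.\<close>
  define \<phi> where "\<phi> y = - segment_mean (\<lambda>s. h (s, 0, snd y)) (fst (fst y)) (snd (fst y))" for y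
  let ?K = "{a..b} \<times> {a..0}"
  have mem: "x0 + \<tau> * (x - x0) \<in> {a..0}" if "x0 \<in> {a..b}" "x \<in> {a..0}" "\<tau> \<in> {0..1}" for x0 x \<tau>
    using convex_segment_mem[of "{a..0}" x0 x \<tau>] that ab by auto
  have "continuous_on ({0..1} \<times> (?K \<times> {0..eb})) (\<lambda>y. h (fst (fst (snd y)) + fst y * (snd (fst (snd y)) - fst (fst (snd y))), 0, snd (snd y)))"
    by (rule continuous_on_compose2[OF C_k_on_continuous[OF h]]) (use mem zb in \<open>auto intro!: continuous_intros\<close>)
  from continuous_on_integral_param[OF this]
  have cont\<phi>: "continuous_on (?K \<times> {0..eb}) \<phi>"
    unfolding \<phi>_def[abs_def] segment_mean_def by (intro continuous_on_minus) simp
  have pos: "\<phi> (k, 0) > 0" if k: "k \<in> ?K" for k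
  proof -
    obtain x0 x where k_eq: "k = (x0, x)" and x0: "x0 \<in> {a..b}" and x: "x \<in> {a..0}" using k by auto
    have cont: "continuous_on {0..1} (\<lambda>\<tau>. - h (x0 + \<tau> * (x - x0), 0, 0))"
      by (intro continuous_on_minus continuous_on_compose2[OF contg]) (use mem[OF x0 x] in \<open>auto intro!: continuous_intros\<close>)
    have nn: "0 \<le> - h (x0 + \<tau> * (x - x0), 0, 0)" if "\<tau> \<in> {0..1}" for \<tau> using g_le[OF mem[OF x0 x that]] by simp
    have "0 \<le> integral {0..1} (\<lambda>\<tau>. - h (x0 + \<tau> * (x - x0), 0, 0))"
      by (rule integral_nonneg[OF integrable_continuous_real[OF cont] nn])
    moreover have "integral {0..1} (\<lambda>\<tau>. - h (x0 + \<tau> * (x - x0), 0, 0)) \<noteq> 0"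
    proof
      assume "integral {0..1} (\<lambda>\<tau>. - h (x0 + \<tau> * (x - x0), 0, 0)) = 0"
      then have "\<forall>\<tau>\<in>{0..1}. - h (x0 + \<tau> * (x - x0), 0, 0) = 0"
        using integral_eq_0_iff[OF cont _ nn] by auto
      then have "h (x0, 0, 0) = 0" by (auto dest: bspec[of _ _ 0])
      then show False using neg[of x0] x0 ab by auto
    qed
    ultimately show ?thesis by (simp add: \<phi>_def k_eq segment_mean_def)
  qed
  obtain c \<delta> where c: "c > 0" "\<delta> > 0" "\<And>k m. k \<in> ?K \<Longrightarrow> m \<in> {0..eb} \<Longrightarrow> dist m 0 < \<delta> \<Longrightarrow> c \<le> \<phi> (k, m)"
    by (rule compact_uniform_lower_bound[OF cont\<phi> _ _ _ pos]) (use eb in \<open>auto intro: compact_Times\<close>)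
  \<comment> \<open>The cap 1 ensures q \<le> 1, and half of \<delta> makes the distance condition
    strict on the closed interval.\<close>
  define e where "e = min (min eb 1) (\<delta> / 2)"
  have e: "0 < e" "e \<le> eb" "e \<le> 1" "e < \<delta>" using eb c by (auto simp: e_def)
  have sub: "{a..0} \<times> {0..zb} \<times> {0..e} \<subseteq> ?T" using e by auto
  note pos_c = c(1) and e_bounds = e(1,2)
  interpret half_system h h1 r a b zb e B c
  proof
    show "C_k_on r h ({a..0} \<times> {0..zb} \<times> {0..e})" by (rule C_k_on_subset[OF C_k_on_Suc_imp[OF h] sub])
    show "C_k_on r h1 ({a..0} \<times> {0..zb} \<times> {0..e})" by (rule C_k_on_subset[OF h1 sub])
    show "h (x, z, \<epsilon>) - h (x, 0, \<epsilon>) = z * h1 (x, z, \<epsilon>)"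
      if "x \<in> {a..0}" "z \<in> {0..zb}" "\<epsilon> \<in> {0..e}" for x z \<epsilon> using h1_eq that e by auto
    show "\<bar>h (x, z, \<epsilon>) - h (x, z', \<epsilon>)\<bar> \<le> B * \<bar>z - z'\<bar>"
      if "x \<in> {a..0}" "z \<in> {0..zb}" "z' \<in> {0..zb}" "\<epsilon> \<in> {0..e}" for x z z' \<epsilon>
    proof -
      have "\<epsilon> \<in> {0..eb}" using that e by auto
      then have "\<bar>h (x, z, \<epsilon>) - h (x, z', \<epsilon>)\<bar> = \<bar>z - z'\<bar> * \<bar>segment_mean hz (x, z', \<epsilon>) (x, z, \<epsilon>)\<bar>"
        using diff that by (simp add: abs_mult)
      also have "\<dots> \<le> \<bar>z - z'\<bar> * B" using that \<open>\<epsilon> \<in> {0..eb}\<close> by (intro mult_left_mono mean_bd) auto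
      finally show ?thesis by (simp add: mult.commute)
    qed
    show "segment_mean (\<lambda>s. h (s, 0, \<epsilon>)) x0 x \<le> - c" if "x0 \<in> {a..b}" "x \<in> {a..0}" "\<epsilon> \<in> {0..e}" for x0 x \<epsilon>
      using c(3)[of "(x0, x)" \<epsilon>] that e by (auto simp: \<phi>_def)
  qed (use ab zb e c B in auto)
  show ?thesis by (rule half_orbits) (rule that[OF pos_c e_bounds])
qed

section \<open>Implicit functions\<close>

text \<open>Joins the two halves of an orbit at \<open>x = 0\<close>, where both one-sided
  derivatives exist and agree.\<close>

lemma has_real_derivative_glue:
  fixes f :: "real \<Rightarrow> real"
  assumes abc: "a \<le> b" "b \<le> c" and x: "x \<in> {a..c}"
    and l: "x \<le> b \<Longrightarrow> (f has_real_derivative D) (at x within {a..b})"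
    and r: "b \<le> x \<Longrightarrow> (f has_real_derivative D) (at x within {b..c})"
  shows "(f has_real_derivative D) (at x within {a..c})"
proof -
  have U: "{a..c} = {a..b} \<union> {b..c}" using abc by auto
  consider "x < b" | "x = b" | "b < x" by linarith
  then show ?thesis
  proof cases
    case 1
    have "at x within {a..c} = at x within {a..b}"
      by (rule at_within_nhd[of _ "{..<b}"]) (use 1 abc in auto)
    then show ?thesis using l 1 by simp
  next
    case 2
    then show ?thesis using l r unfolding U has_field_derivative_iff
      unfolding at_within_union by (auto intro: filterlim_sup)
  next
    case 3
    have "at x within {a..c} = at x within {b..c}"
      by (rule at_within_nhd[of _ "{b<..}"]) (use 3 abc in auto)
    then show ?thesis using r 3 by simp
  qed
qed

lemma segment_mean_ge:
  assumes S: "convex S" "p \<in> S" "q \<in> S" and A: "continuous_on S A" and m: "\<And>y. y \<in> S \<Longrightarrow> m \<le> A y"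
  shows "m \<le> segment_mean A p q"
proof -
  have mem: "p + \<tau> *\<^sub>R (q - p) \<in> S" if "\<tau> \<in> {0..1}" for \<tau> by (rule convex_segment_mem[OF S that])
  have "continuous_on {0..1} (\<lambda>\<tau>. A (p + \<tau> *\<^sub>R (q - p)))"
    by (rule continuous_on_compose2[OF A _ image_subsetI[OF mem]]) (intro continuous_intros)
  then have int: "(\<lambda>\<tau>. A (p + \<tau> *\<^sub>R (q - p))) integrable_on {0..1}" by (rule integrable_continuous_real)
  have "integral {0..1::real} (\<lambda>_. m) \<le> integral {0..1} (\<lambda>\<tau>. A (p + \<tau> *\<^sub>R (q - p)))"
    by (rule integral_le[OF _ int]) (use m mem in auto)
  then show ?thesis by (simp add: segment_mean_def)
qed

lemma C_1_lipschitz: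
  fixes F :: "'a::euclidean_space \<Rightarrow> real"
  assumes S: "convex S" "compact S" and F: "C_k_on (Suc k) F S"
  obtains L where "0 < L" "\<And>p q. p \<in> S \<Longrightarrow> q \<in> S \<Longrightarrow> \<bar>F q - F p\<bar> \<le> L * norm (q - p)"
proof -
  obtain A where A: "\<And>p. p \<in> S \<Longrightarrow> has_partials F A p S"
    "\<And>b. b \<in> Basis \<Longrightarrow> C_k_on k (A b) S" by (rule C_k_on_SucE[OF F], rule that)
  have contA: "\<And>b. b \<in> Basis \<Longrightarrow> continuous_on S (A b)" by (rule C_k_on_continuous[OF A(2)])
  have "\<exists>B. \<forall>y\<in>S. \<bar>A b y\<bar> \<le> B" if "b \<in> Basis" for b
  proof -
    have "bounded (A b ` S)" using compact_continuous_image[OF contA[OF that] S(2)] by (rule compact_imp_bounded)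
    then show ?thesis unfolding bounded_iff by auto
  qed
  then have "\<forall>b\<in>Basis. \<exists>B. \<forall>y\<in>S. \<bar>A b y\<bar> \<le> B" by blast
  from bchoice[OF this] obtain B where B: "\<forall>b\<in>Basis. \<forall>y\<in>S. \<bar>A b y\<bar> \<le> B b" by (elim exE)
  define L where "L = (\<Sum>b\<in>Basis. \<bar>B b\<bar>) + 1"
  have L0: "0 < L" unfolding L_def by (intro add_nonneg_pos sum_nonneg) auto
  show ?thesis
  proof (rule that[OF L0])
    fix p q assume pq: "p \<in> S" "q \<in> S"
    have "F q - F p = (\<Sum>b\<in>Basis. ((q - p) \<bullet> b) * segment_mean (A b) p q)"
      by (rule difference_eq_segment_mean[OF S(1) pq A(1) contA])
    also have "\<bar>\<dots>\<bar> \<le> (\<Sum>b\<in>Basis. norm (q - p) * \<bar>B b\<bar>)"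
    proof (rule order_trans[OF sum_abs], rule sum_mono)
      fix b :: 'a assume b: "b \<in> Basis"
      have "- \<bar>B b\<bar> \<le> segment_mean (A b) p q"
        by (rule segment_mean_ge[OF S(1) pq contA[OF b]]) (use B b in fastforce)
      moreover have "- \<bar>B b\<bar> \<le> segment_mean (\<lambda>y. - A b y) p q"
        by (rule segment_mean_ge[OF S(1) pq continuous_on_minus[OF contA[OF b]]]) (use B b in fastforce)
      ultimately have "\<bar>segment_mean (A b) p q\<bar> \<le> \<bar>B b\<bar>" by (simp add: segment_mean_def)
      then show "\<bar>((q - p) \<bullet> b) * segment_mean (A b) p q\<bar> \<le> norm (q - p) * \<bar>B b\<bar>"
        unfolding abs_mult using b by (intro mult_mono Basis_le_norm) auto
    qed
    also have "\<dots> = norm (q - p) * (\<Sum>b\<in>Basis. \<bar>B b\<bar>)" by (simp add: sum_distrib_left)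
    also have "\<dots> \<le> norm (q - p) * L" by (intro mult_left_mono) (simp_all add: L_def)
    also have "\<dots> = L * norm (q - p)" by (rule mult.commute)
    finally show "\<bar>F q - F p\<bar> \<le> L * norm (q - p)" .
  qed
qed

text \<open>Quantitative monotonicity in y replaces a nonzero partial derivative: it gives
  continuity of \<xi> at once and bounds the partial derivative in y below by m, up to the boundary
  of the box. Solving the Hadamard identity for the increment of \<xi> then exhibits continuous
  coefficients, and their diagonal values are quotients of partial derivatives of \<open>G\<close>
  along \<xi>.\<close>

theorem C_k_on_implicit_function:
  fixes G :: "'a::euclidean_space \<times> real \<Rightarrow> real"
  assumes S: "convex S" "compact S" and c: "c1 < c2" and m: "0 < m"
    and G0: "continuous_on (S \<times> {c1..c2}) G"
    and mono: "\<And>p y y'. p \<in> S \<Longrightarrow> y \<in> {c1..c2} \<Longrightarrow> y' \<in> {c1..c2} \<Longrightarrow> y \<le> y' \<Longrightarrow> m * (y' - y) \<le> G (p, y') - G (p, y)"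
    and \<xi>: "\<And>p. p \<in> S \<Longrightarrow> \<xi> p \<in> {c1..c2}" "\<And>p. p \<in> S \<Longrightarrow> G (p, \<xi> p) = 0"
  shows "C_k_on k G (S \<times> {c1..c2}) \<Longrightarrow> C_k_on k \<xi> S"
proof -
  let ?J = "{c1..c2}"
  have D: "convex (S \<times> ?J)" "compact (S \<times> ?J)" using S by (auto intro: convex_Times compact_Times)
  have mono': "m * \<bar>y' - y\<bar> \<le> \<bar>G (p, y') - G (p, y)\<bar>" if "p \<in> S" "y \<in> ?J" "y' \<in> ?J" for p y y'
    using mono[OF that(1) that(2) that(3)] mono[OF that(1) that(3) that(2)] by (cases "y \<le> y'") (auto simp: abs_if)
  have \<xi>_cont: "continuous_on S \<xi>"
    unfolding continuous_on_iff
  proof (intro ballI allI impI)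
    fix p and d :: real assume p: "p \<in> S" and d: "0 < d"
    have "uniformly_continuous_on (S \<times> ?J) G" by (rule compact_uniformly_continuous[OF G0 D(2)])
    moreover have "0 < m * d" using m d by simp
    ultimately obtain \<delta> where \<delta>: "\<delta> > 0" "\<And>x y. x \<in> S \<times> ?J \<Longrightarrow> y \<in> S \<times> ?J \<Longrightarrow> dist y x < \<delta> \<Longrightarrow> dist (G y) (G x) < m * d"
      unfolding uniformly_continuous_on_def by meson
    have "dist (\<xi> q) (\<xi> p) < d" if q: "q \<in> S" "dist q p < \<delta>" for q
    proof -
      have "m * \<bar>\<xi> q - \<xi> p\<bar> \<le> \<bar>G (p, \<xi> q) - G (p, \<xi> p)\<bar>" using p q \<xi> by (intro mono') auto
      also have "\<dots> = dist (G (p, \<xi> q)) (G (q, \<xi> q))" using p q \<xi> by (simp add: dist_real_def)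
      also have "\<dots> < m * d" using p q \<xi> by (intro \<delta>(2)) (auto simp: dist_Pair_Pair dist_commute)
      finally show ?thesis using m by (simp add: dist_real_def)
    qed
    then show "\<exists>\<delta>>0. \<forall>q\<in>S. dist q p < \<delta> \<longrightarrow> dist (\<xi> q) (\<xi> p) < d" using \<delta>(1) by blast
  qed
  define w where "w p = (p, \<xi> p)" for p
  have w_mem: "w p \<in> S \<times> ?J" if "p \<in> S" for p using that \<xi>(1) by (auto simp: w_def)
  have w_cont: "continuous_on S w" unfolding w_def[abs_def] by (intro continuous_intros \<xi>_cont)
  show "C_k_on k G (S \<times> ?J) \<Longrightarrow> C_k_on k \<xi> S"
  proof (induction k)
    case 0
    show ?case using \<xi>_cont by simp
  next
    case (Suc k)
    have \<xi>C: "C_k_on k \<xi> S" by (rule Suc.IH[OF C_k_on_Suc_imp[OF Suc.prems]])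
    obtain A where A: "\<And>p. p \<in> S \<times> ?J \<Longrightarrow> has_partials G A p (S \<times> ?J)"
      "\<And>b. b \<in> Basis \<Longrightarrow> C_k_on k (A b) (S \<times> ?J)" by (rule C_k_on_SucE[OF Suc.prems], rule that)
    have contA: "\<And>b. b \<in> Basis \<Longrightarrow> continuous_on (S \<times> ?J) (A b)" by (rule C_k_on_continuous[OF A(2)])
    have basis: "(0, 1) \<in> (Basis :: ('a \<times> real) set)" "\<And>b. b \<in> Basis \<Longrightarrow> (b, 0) \<in> (Basis :: ('a \<times> real) set)"
      by (auto simp: Basis_prod_def)
    \<comment> \<open>The monotonicity bound passes to the limit of difference quotients; c1 < c2
      makes v a limit point of the interval.\<close>
    have Ay: "m \<le> A (0, 1) y" if y: "y \<in> S \<times> ?J" for y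
    proof -
      obtain p v where pv: "y = (p, v)" "p \<in> S" "v \<in> ?J" using y by auto
      have "((\<lambda>v. (p, v)) has_derivative (\<lambda>h. (0, h))) (at v within ?J)" by (auto intro!: derivative_eq_intros)
      moreover have "(G has_derivative (\<lambda>d. \<Sum>b\<in>Basis. (d \<bullet> b) * A b y)) (at (p, v) within (\<lambda>v. (p, v)) ` ?J)"
        using A(1)[OF y] pv by (auto intro: has_derivative_subset)
      ultimately have "((\<lambda>v. G (p, v)) has_derivative (\<lambda>h. \<Sum>b\<in>Basis. ((0, h) \<bullet> b) * A b y)) (at v within ?J)"
        using diff_chain_within by (fastforce simp: o_def)
      then have "((\<lambda>v. G (p, v)) has_real_derivative A (0, 1) y) (at v within ?J)"
        unfolding has_field_derivative_def by (rule has_derivative_eq_rhs) (simp add: sum_Basis_prod fun_eq_iff)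
      then have lim: "((\<lambda>v'. (G (p, v') - G (p, v)) / (v' - v)) \<longlongrightarrow> A (0, 1) y) (at v within ?J)"
        by (simp add: has_field_derivative_iff)
      have "v islimpt ?J" using c pv(3) by (intro connected_imp_perfect) (auto simp: connected_Icc)
      then have nt: "at v within ?J \<noteq> bot" by (simp add: trivial_limit_within)
      have "m \<le> (G (p, v') - G (p, v)) / (v' - v)" if "v' \<in> ?J" "v' \<noteq> v" for v'
      proof (cases "v \<le> v'")
        case True then show ?thesis using mono[OF pv(2,3) that(1)] that by (simp add: pos_le_divide_eq)
      next
        case False then show ?thesis using mono[OF pv(2) that(1) pv(3)] that by (simp add: neg_le_divide_eq algebra_simps)
      qed
      then have "\<forall>\<^sub>F v' in at v within ?J. m \<le> (G (p, v') - G (p, v)) / (v' - v)"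
        by (auto simp: eventually_at intro!: exI[where x=1])
      then show ?thesis by (rule tendsto_lowerbound[OF lim _ nt])
    qed
    \<comment> \<open>Implicit differentiation in two-point form; the denominator is a mean of a
      function bounded below by m.\<close>
    define B where "B b p q = - segment_mean (A (b, 0)) (w p) (w q) / segment_mean (A (0, 1)) (w p) (w q)" for b p q
    have my: "m \<le> segment_mean (A (0, 1)) (w p) (w q)" if "p \<in> S" "q \<in> S" for p q
      by (rule segment_mean_ge[OF D(1) w_mem[OF that(1)] w_mem[OF that(2)] contA[OF basis(1)] Ay])
    have sm_cont: "continuous_on S (\<lambda>q. segment_mean (A b) (w p) (w q))" if "b \<in> Basis" "p \<in> S" for b p
      using continuous_on_compose2[OF continuous_on_slice2[OF continuous_on_segment_mean[OF contA[OF that(1)] D(1)] w_mem[OF that(2)]] w_cont] w_mem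
      by auto
    have der: "(\<xi> has_derivative (\<lambda>d. \<Sum>b\<in>Basis. (d \<bullet> b) * B b p p)) (at p within S)" if p: "p \<in> S" for p
    proof (rule has_derivative_difference_form[where B="\<lambda>b. B b p", OF _ _ p])
      fix q assume q: "q \<in> S"
      have "0 = G (w q) - G (w p)" using \<xi> p q by (simp add: w_def)
      also have "\<dots> = (\<Sum>b\<in>Basis. ((w q - w p) \<bullet> b) * segment_mean (A b) (w p) (w q))"
        by (rule difference_eq_segment_mean[OF D(1) w_mem[OF p] w_mem[OF q] A(1) contA])
      also have "\<dots> = (\<Sum>b\<in>Basis. ((q - p) \<bullet> b) * segment_mean (A (b, 0)) (w p) (w q)) + (\<xi> q - \<xi> p) * segment_mean (A (0, 1)) (w p) (w q)"
        unfolding sum_Basis_prod by (simp add: w_def)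
      finally have "\<xi> q - \<xi> p = - (\<Sum>b\<in>Basis. ((q - p) \<bullet> b) * segment_mean (A (b, 0)) (w p) (w q)) / segment_mean (A (0, 1)) (w p) (w q)"
        using my[OF p q] m by (simp add: field_simps)
      then show "\<xi> q - \<xi> p = (\<Sum>b\<in>Basis. ((q - p) \<bullet> b) * B b p q)"
        by (simp add: B_def sum_divide_distrib sum_negf)
    next
      fix b :: 'a assume b: "b \<in> Basis"
      have "continuous_on S (B b p)" unfolding B_def[abs_def]
        using my[OF p] m by (intro continuous_on_divide continuous_on_minus sm_cont basis b p) fastforce
      then show "continuous (at p within S) (B b p)" using p unfolding continuous_on_eq_continuous_within by blast
    qed
    show ?case
    proof (rule C_k_on_SucI[where A="\<lambda>b p. B b p p", OF der])
      fix b :: 'a assume b: "b \<in> Basis"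
      have w: "comp_C_k k UNIV w S" unfolding w_def[abs_def]
        by (rule comp_C_k_Pair[OF comp_C_k_linear[OF bounded_linear_ident] comp_C_k_UNIV_real[THEN iffD2, OF \<xi>C]])
      have "C_k_on k (\<lambda>p. - A (b, 0) (w p) / A (0, 1) (w p)) S"
      proof (rule C_k_on_divide[OF C_k_on_minus])
        show "C_k_on k (\<lambda>p. A (b, 0) (w p)) S" by (rule C_k_on_compose[OF A(2)[OF basis(2)[OF b]] w w_mem])
        show "C_k_on k (\<lambda>p. A (0, 1) (w p)) S" by (rule C_k_on_compose[OF A(2)[OF basis(1)] w w_mem])
        show "A (0, 1) (w p) \<noteq> 0" if "p \<in> S" for p using Ay[OF w_mem[OF that]] m by auto
      qed
      then show "C_k_on k (\<lambda>p. B b p p) S" by (simp add: B_def)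
    qed
  qed
qed

section \<open>Matching entry and exit\<close>

text \<open>For \<open>x \<ge> 0\<close> the estimates are anchored at the exit point and run
  backwards, as reflection produces them; this accounts for the sign + of the integral. Strictness
  is required on \<open>{0<..<x1}\<close>, the part of the orbit that could meet the section before
  x1.\<close>

definition connecting_orbit ::
  "(real \<times> real \<times> real \<Rightarrow> real) \<Rightarrow> real \<Rightarrow> real \<Rightarrow> real \<Rightarrow> real \<Rightarrow> real \<Rightarrow> (real \<Rightarrow> real) \<Rightarrow> bool" where
  "connecting_orbit h z0 c x0 x1 \<epsilon> \<zeta> \<longleftrightarrow>
     0 < x1 \<and> \<zeta> x0 = z0 \<and> \<zeta> x1 = z0 \<and>
     (\<forall>x\<in>{x0..x1}. 0 < \<zeta> x \<and> \<zeta> x \<le> z0 \<and>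
        (\<zeta> has_real_derivative h (x, \<zeta> x, \<epsilon>) * \<zeta> x / \<epsilon>) (at x within {x0..x1})) \<and>
     (\<forall>x\<in>{0<..<x1}. \<zeta> x < z0) \<and>
     (\<forall>x\<in>{x0..0}. \<bar>\<epsilon> * ln (\<zeta> x / z0) - integral {x0..x} (\<lambda>s. h (s, 0, \<epsilon>))\<bar> \<le> \<epsilon> \<and>
        \<zeta> x \<le> z0 * exp 1 * exp (- (c * (x - x0) / \<epsilon>))) \<and>
     (\<forall>x\<in>{0..x1}. \<bar>\<epsilon> * ln (\<zeta> x / z0) + integral {x..x1} (\<lambda>s. h (s, 0, \<epsilon>))\<bar> \<le> \<epsilon> \<and>
        \<zeta> x \<le> z0 * exp 1 * exp (- (c * (x1 - x) / \<epsilon>)))"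

text \<open>Reflecting x and changing the sign of h turns the exit into an entry at -x1. The
  hypothesis \<open>match\<close> says precisely that both halves have the same logarithm at
  \<open>x = 0\<close>, so they join to one solution.\<close>

lemma half_orbits_connect:
  fixes h :: "real \<times> real \<times> real \<Rightarrow> real"
  defines "hp \<equiv> \<lambda>y. - h (- fst y, snd y)"
  assumes x: "x0 < 0" "0 < x1" and \<epsilon>: "0 < \<epsilon>" and z0: "0 < z0" and c: "c \<le> cm" "c \<le> cp"
    and m: "half_orbit h z0 cm x0 \<epsilon> \<eta>m \<zeta>m" and p: "half_orbit hp z0 cp (- x1) \<epsilon> \<eta>p \<zeta>p"
    and cont: "continuous_on {x0..x1} (\<lambda>s. h (s, 0, \<epsilon>))"
    and match: "integral {x0..x1} (\<lambda>s. h (s, 0, \<epsilon>)) + \<epsilon> * (\<eta>m - \<eta>p) = 0"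
  shows "connecting_orbit h z0 c x0 x1 \<epsilon> (\<lambda>x. if x \<le> 0 then \<zeta>m x else \<zeta>p (- x))"
proof -
  let ?\<zeta> = "\<lambda>x. if x \<le> 0 then \<zeta>m x else \<zeta>p (- x)"
  let ?I = "\<lambda>a b. integral {a..b} (\<lambda>s. h (s, 0, \<epsilon>))"
  have M: "\<zeta>m x0 = z0" "\<And>x. x \<in> {x0..0} \<Longrightarrow> 0 < \<zeta>m x"
    "\<And>x. x \<in> {x0..0} \<Longrightarrow> (\<zeta>m has_real_derivative h (x, \<zeta>m x, \<epsilon>) * \<zeta>m x / \<epsilon>) (at x within {x0..0})"
    "\<And>x. x \<in> {x0..0} \<Longrightarrow> \<bar>\<epsilon> * ln (\<zeta>m x / z0) - ?I x0 x\<bar> \<le> \<epsilon>"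
    "\<And>x. x \<in> {x0..0} \<Longrightarrow> \<zeta>m x \<le> z0 * exp 1 * exp (- (cm * (x - x0) / \<epsilon>))"
    "\<And>x. x \<in> {x0<..0} \<Longrightarrow> \<zeta>m x < z0"
    "\<epsilon> * ln (\<zeta>m 0 / z0) = ?I x0 0 + \<epsilon> * \<eta>m"
    using m unfolding half_orbit_def by auto
  have P: "\<zeta>p (- x1) = z0" "\<And>x. x \<in> {- x1..0} \<Longrightarrow> 0 < \<zeta>p x"
    "\<And>x. x \<in> {- x1..0} \<Longrightarrow> (\<zeta>p has_real_derivative hp (x, \<zeta>p x, \<epsilon>) * \<zeta>p x / \<epsilon>) (at x within {- x1..0})"
    "\<And>x. x \<in> {- x1..0} \<Longrightarrow> \<bar>\<epsilon> * ln (\<zeta>p x / z0) - integral {- x1..x} (\<lambda>s. hp (s, 0, \<epsilon>))\<bar> \<le> \<epsilon>"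
    "\<And>x. x \<in> {- x1..0} \<Longrightarrow> \<zeta>p x \<le> z0 * exp 1 * exp (- (cp * (x - - x1) / \<epsilon>))"
    "\<And>x. x \<in> {- x1<..0} \<Longrightarrow> \<zeta>p x < z0"
    "\<epsilon> * ln (\<zeta>p 0 / z0) = integral {- x1..0} (\<lambda>s. hp (s, 0, \<epsilon>)) + \<epsilon> * \<eta>p"
    using p unfolding half_orbit_def by auto
  have refl: "integral {- x1..- x} (\<lambda>s. hp (s, 0, \<epsilon>)) = - ?I x x1" for x
    using Henstock_Kurzweil_Integration.integral_reflect_real[of x1 x "\<lambda>s. h (s, 0, \<epsilon>)"] by (simp add: hp_def)
  have "?I x0 0 + ?I 0 x1 = ?I x0 x1"
    by (rule Henstock_Kurzweil_Integration.integral_combine) (use x cont in \<open>auto intro: integrable_continuous_real\<close>)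
  then have "\<epsilon> * ln (\<zeta>m 0 / z0) = \<epsilon> * ln (\<zeta>p 0 / z0)"
    using M(7) P(7) match refl[of 0] by (simp add: algebra_simps)
  then have "ln (\<zeta>m 0 / z0) = ln (\<zeta>p 0 / z0)" using \<epsilon> by simp
  then have eq0: "\<zeta>m 0 = \<zeta>p 0" using M(2)[of 0] P(2)[of 0] x z0 by simp
  have right: "?\<zeta> x = \<zeta>p (- x)" if "0 \<le> x" for x using that eq0 by auto
  have decay: "z0 * exp 1 * exp (- (k * t / \<epsilon>)) \<le> z0 * exp 1 * exp (- (c * t / \<epsilon>))" if "c \<le> k" "0 \<le> t" for k t
    using that z0 \<epsilon> by (intro mult_left_mono) (auto simp: mult_right_mono divide_right_mono)
  have der: "(?\<zeta> has_real_derivative h (x, ?\<zeta> x, \<epsilon>) * ?\<zeta> x / \<epsilon>) (at x within {x0..x1})" if xx: "x \<in> {x0..x1}" for x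
  proof (rule has_real_derivative_glue[of x0 0])
    assume "x \<le> 0"
    then have x': "x \<in> {x0..0}" using xx by auto
    have "(?\<zeta> has_real_derivative h (x, \<zeta>m x, \<epsilon>) * \<zeta>m x / \<epsilon>) (at x within {x0..0})"
      unfolding has_field_derivative_def
      by (rule has_derivative_transform[OF x' _ M(3)[OF x', unfolded has_field_derivative_def]]) auto
    then show "(?\<zeta> has_real_derivative h (x, ?\<zeta> x, \<epsilon>) * ?\<zeta> x / \<epsilon>) (at x within {x0..0})" using \<open>x \<le> 0\<close> by simp
  next
    assume "0 \<le> x"
    then have x': "x \<in> {0..x1}" and xm: "- x \<in> {- x1..0}" using xx by auto
    have 1: "(\<zeta>p has_real_derivative hp (- x, \<zeta>p (- x), \<epsilon>) * \<zeta>p (- x) / \<epsilon>) (at (- x) within uminus ` {0..x1})"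
      by (rule DERIV_subset[OF P(3)[OF xm]]) auto
    have right': "?\<zeta> t = \<zeta>p (- t)" if "t \<in> {0..x1}" for t by (rule right) (use that in simp)
    have 2: "(uminus has_real_derivative - 1) (at x within {0..x1})" by (auto intro!: derivative_eq_intros)
    have 3: "((\<lambda>x. \<zeta>p (- x)) has_real_derivative h (x, \<zeta>p (- x), \<epsilon>) * \<zeta>p (- x) / \<epsilon>) (at x within {0..x1})"
      using DERIV_image_chain[OF 1 2] by (simp add: o_def hp_def)
    have "(?\<zeta> has_real_derivative h (x, \<zeta>p (- x), \<epsilon>) * \<zeta>p (- x) / \<epsilon>) (at x within {0..x1})"
      unfolding has_field_derivative_def
      by (rule has_derivative_transform[OF x' right' 3[unfolded has_field_derivative_def]])
    then show "(?\<zeta> has_real_derivative h (x, ?\<zeta> x, \<epsilon>) * ?\<zeta> x / \<epsilon>) (at x within {0..x1})"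
      unfolding right[OF \<open>0 \<le> x\<close>] .
  qed (use x xx in auto)
  show ?thesis unfolding connecting_orbit_def
  proof (intro conjI ballI)
    show "0 < x1" "?\<zeta> x0 = z0" "?\<zeta> x1 = z0" using x M(1) P(1) by auto
  next
    fix xa assume xa: "xa \<in> {x0..x1}"
    show "0 < ?\<zeta> xa" using M(2)[of xa] P(2)[of "- xa"] xa by auto
    show "?\<zeta> xa \<le> z0"
      using M(1) M(6)[of xa] P(1) P(6)[of "- xa"] xa by (cases "xa = x0"; cases "xa = x1"; cases "xa \<le> 0"; force)
    show "(?\<zeta> has_real_derivative h (xa, ?\<zeta> xa, \<epsilon>) * ?\<zeta> xa / \<epsilon>) (at xa within {x0..x1})" by (rule der[OF xa])
  next
    fix xa assume "xa \<in> {0<..<x1}"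
    then show "?\<zeta> xa < z0" using P(6)[of "- xa"] by auto
  next
    fix xa assume xa: "xa \<in> {x0..0}"
    show "\<bar>\<epsilon> * ln (?\<zeta> xa / z0) - ?I x0 xa\<bar> \<le> \<epsilon>" using M(4)[OF xa] xa by auto
    have "\<zeta>m xa \<le> z0 * exp 1 * exp (- (c * (xa - x0) / \<epsilon>))"
      using M(5)[OF xa] decay[OF c(1), of "xa - x0"] xa by auto
    then show "?\<zeta> xa \<le> z0 * exp 1 * exp (- (c * (xa - x0) / \<epsilon>))" using xa by simp
  next
    fix xa assume xa: "xa \<in> {0..x1}"
    then have xm: "- xa \<in> {- x1..0}" and ge: "0 \<le> xa" by auto
    show "\<bar>\<epsilon> * ln (?\<zeta> xa / z0) + ?I xa x1\<bar> \<le> \<epsilon>" using P(4)[OF xm] unfolding right[OF ge] refl by simp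
    have "\<zeta>p (- xa) \<le> z0 * exp 1 * exp (- (c * (x1 - xa) / \<epsilon>))"
      using P(5)[OF xm] decay[OF c(2), of "x1 - xa"] xa by auto
    then show "?\<zeta> xa \<le> z0 * exp 1 * exp (- (c * (x1 - xa) / \<epsilon>))" unfolding right[OF ge] .
  qed
qed

text \<open>At \<epsilon> = 0 the matching function \<open>G\<close> is the integral of h up to y,
  which changes sign between c1 and c2 and increases in y because h is positive on
  \<open>{c1..c2}\<close>, away from the turning point. Both facts survive for small \<epsilon>, so
  \<open>G\<close> has a zero by the intermediate value theorem and it is smooth by the implicit
  function theorem. \<open>1 \<le> r\<close> provides the Lipschitz constant of the perturbing
  term.\<close>

lemma return_map:
  fixes h :: "real \<times> real \<times> real \<Rightarrow> real"
  assumes r: "1 \<le> r" and h: "C_k_on (Suc r) h ({a..c2} \<times> {0..zb} \<times> {0..eb})"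
    and ab: "a \<le> b" "b < 0" and zb: "0 < zb" and eb: "0 < eb" and c12: "0 < c1" "c1 < c2"
    and neg: "\<And>x. a \<le> x \<Longrightarrow> x < 0 \<Longrightarrow> h (x, 0, 0) < 0"
    and pos: "\<And>x. 0 < x \<Longrightarrow> x \<le> c2 \<Longrightarrow> 0 < h (x, 0, 0)"
    and I1: "\<And>x0. x0 \<in> {a..b} \<Longrightarrow> integral {x0..c1} (\<lambda>s. h (s, 0, 0)) < 0"
    and I2: "\<And>x0. x0 \<in> {a..b} \<Longrightarrow> 0 < integral {x0..c2} (\<lambda>s. h (s, 0, 0))"
  obtains Z c where "0 < Z" "0 < c"
    "\<And>z0. 0 < z0 \<Longrightarrow> z0 \<le> Z \<Longrightarrow> \<exists>e \<xi>. 0 < e \<and> e \<le> eb \<and> C_k_on r \<xi> ({a..b} \<times> {0..e}) \<and>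
      (\<forall>x0\<in>{a..b}. \<xi> (x0, 0) \<in> {c1..c2} \<and> integral {x0..\<xi> (x0, 0)} (\<lambda>s. h (s, 0, 0)) = 0) \<and>
      (\<forall>x0\<in>{a..b}. \<forall>\<epsilon>\<in>{0<..e}. \<xi> (x0, \<epsilon>) \<in> {c1..c2} \<and> (\<exists>\<zeta>. connecting_orbit h z0 c x0 (\<xi> (x0, \<epsilon>)) \<epsilon> \<zeta>))"
proof -
  define hp where "hp y = - h (- fst y, snd y)" for y
  have hm: "C_k_on (Suc r) h ({a..0} \<times> {0..zb} \<times> {0..eb})"
    by (rule C_k_on_subset[OF h]) (use c12 in auto)
  have hpC: "C_k_on (Suc r) hp ({- c2..0} \<times> {0..zb} \<times> {0..eb})"
    unfolding hp_def[abs_def]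
  proof (rule C_k_on_minus[OF C_k_on_compose[OF h]])
    show "comp_C_k (Suc r) UNIV (\<lambda>y. (- fst y, snd y)) ({- c2..0} \<times> {0..zb} \<times> {0..eb})"
      by (intro comp_C_k_Pair comp_C_k_linear bounded_linear_minus bounded_linear_fst bounded_linear_snd)
  qed (use ab in auto)
  obtain cm em Zm where M: "0 < cm" "0 < em" "em \<le> eb" "0 < Zm"
    "\<And>z0. 0 < z0 \<Longrightarrow> z0 \<le> Zm \<Longrightarrow> \<exists>\<eta>. C_k_on r \<eta> ({a..b} \<times> {0..em}) \<and>
      (\<forall>x0\<in>{a..b}. \<forall>\<epsilon>\<in>{0<..em}. \<exists>\<zeta>. half_orbit h z0 cm x0 \<epsilon> (\<eta> (x0, \<epsilon>)) \<zeta>)"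
    by (rule half_problem[OF hm ab zb eb neg]) (assumption+, rule that)
  have negp: "hp (x, 0, 0) < 0" if "- c2 \<le> x" "x < 0" for x using pos[of "- x"] that by (simp add: hp_def)
  obtain cp ep Zp where P: "0 < cp" "0 < ep" "ep \<le> eb" "0 < Zp"
    "\<And>z0. 0 < z0 \<Longrightarrow> z0 \<le> Zp \<Longrightarrow> \<exists>\<eta>. C_k_on r \<eta> ({- c2..- c1} \<times> {0..ep}) \<and>
      (\<forall>x0\<in>{- c2..- c1}. \<forall>\<epsilon>\<in>{0<..ep}. \<exists>\<zeta>. half_orbit hp z0 cp x0 \<epsilon> (\<eta> (x0, \<epsilon>)) \<zeta>)"
    by (rule half_problem[OF hpC _ _ zb eb negp, of "- c1"]) (use c12 in auto)
  define c where "c = min cm cp"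
  have c: "0 < c" "c \<le> cm" "c \<le> cp" using M P by (auto simp: c_def)
  define Z where "Z = min Zm Zp"
  have Z: "0 < Z" "Z \<le> Zm" "Z \<le> Zp" using M P by (auto simp: Z_def)
  define e1 where "e1 = min em ep"
  have e1: "0 < e1" "e1 \<le> em" "e1 \<le> ep" "e1 \<le> eb" using M P by (auto simp: e1_def)
  let ?J = "{c1..c2}"
  have h0_cont: "continuous_on {a..c2} (\<lambda>s. h (s, 0, \<epsilon>))" if "\<epsilon> \<in> {0..eb}" for \<epsilon>
    by (rule continuous_on_compose2[OF C_k_on_continuous[OF h]]) (use zb that in \<open>auto intro!: continuous_intros\<close>)
  \<comment> \<open>Length times mean, so that smoothness in both end points and in \<epsilon>
    follows from the rule for integrals over \<open>{0..1}\<close>.\<close>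
  define I where "I y = (snd y - fst (fst y)) * segment_mean (\<lambda>s. h (s, 0, snd (fst y))) (fst (fst y)) (snd y)" for y
  have I_eq: "I ((x0, \<epsilon>), y) = integral {x0..y} (\<lambda>s. h (s, 0, \<epsilon>))" if "x0 \<in> {a..b}" "\<epsilon> \<in> {0..eb}" "y \<in> ?J" for x0 \<epsilon> y
    unfolding I_def fst_conv snd_conv
    by (rule integral_eq_segment_mean[symmetric]) (use that ab c12 in \<open>auto intro: continuous_on_subset[OF h0_cont]\<close>)
  let ?S1 = "{a..b} \<times> {0..e1}"
  have I_C: "C_k_on r I (?S1 \<times> ?J)"
  proof -
    have "C_k_on r (\<lambda>y. h (fst (fst (snd y)) + fst y * (snd (snd y) - fst (fst (snd y))), 0, snd (fst (snd y)))) ({0..1} \<times> (?S1 \<times> ?J))"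
    proof (rule C_k_on_compose[OF C_k_on_Suc_imp[OF h]])
      show "comp_C_k r UNIV (\<lambda>y. (fst (fst (snd y)) + fst y * (snd (snd y) - fst (fst (snd y))), 0::real, snd (fst (snd y)))) ({0..1::real} \<times> (?S1 \<times> ?J))"
        by (intro comp_C_k_Pair; unfold comp_C_k_UNIV_real; (intro C_k_on_add C_k_on_mult C_k_on_diff C_k_on_const)?)
           (intro C_k_on_linear bounded_linear_fst bounded_linear_fst_comp bounded_linear_snd_comp bounded_linear_snd)+
      fix y assume y: "y \<in> {0..1::real} \<times> (?S1 \<times> ?J)"
      have "fst (fst (snd y)) + fst y *\<^sub>R (snd (snd y) - fst (fst (snd y))) \<in> {a..c2}"
        by (rule convex_segment_mem) (use y ab c12 in auto)
      then show "(fst (fst (snd y)) + fst y * (snd (snd y) - fst (fst (snd y))), 0, snd (fst (snd y))) \<in> {a..c2} \<times> {0..zb} \<times> {0..eb}"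
        using y zb e1 by auto
    qed
    from C_k_on_integral_param[OF _ this]
    have sm: "C_k_on r (\<lambda>y. segment_mean (\<lambda>s. h (s, 0, snd (fst y))) (fst (fst y)) (snd y)) (?S1 \<times> ?J)"
      unfolding segment_mean_def by (simp add: convex_Times del: C_k_on.simps)
    have "C_k_on r snd (?S1 \<times> ?J)" "C_k_on r (\<lambda>y. fst (fst y)) (?S1 \<times> ?J)"
      by (intro C_k_on_linear bounded_linear_fst bounded_linear_fst_comp bounded_linear_snd)+
    from C_k_on_mult[OF C_k_on_diff[OF this] sm] show ?thesis unfolding I_def[abs_def] .
  qed
  have "continuous_on (?J \<times> {0..e1}) (\<lambda>y. h (fst y, 0, snd y))"
    by (rule continuous_on_compose2[OF C_k_on_continuous[OF h]]) (use ab c12 zb e1 in \<open>auto intro!: continuous_intros\<close>)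
  then obtain m2 \<delta>2 where m2: "0 < m2" "0 < \<delta>2" "\<And>s \<epsilon>. s \<in> ?J \<Longrightarrow> \<epsilon> \<in> {0..e1} \<Longrightarrow> dist \<epsilon> 0 < \<delta>2 \<Longrightarrow> m2 \<le> h (s, 0, \<epsilon>)"
    by (rule compact_uniform_lower_bound[where ?m0.0=0]) (use pos c12 e1 in auto)
  show ?thesis
  proof (rule that[OF Z(1) c(1)])
    fix z0 assume z0: "0 < z0" "z0 \<le> Z"
    obtain \<eta>m where \<eta>m: "C_k_on r \<eta>m ({a..b} \<times> {0..em})"
      "\<forall>x0\<in>{a..b}. \<forall>\<epsilon>\<in>{0<..em}. \<exists>\<zeta>. half_orbit h z0 cm x0 \<epsilon> (\<eta>m (x0, \<epsilon>)) \<zeta>"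
      using M(5)[OF z0(1)] z0 Z by auto
    obtain \<eta>p where \<eta>p: "C_k_on r \<eta>p ({- c2..- c1} \<times> {0..ep})"
      "\<forall>x0\<in>{- c2..- c1}. \<forall>\<epsilon>\<in>{0<..ep}. \<exists>\<zeta>. half_orbit hp z0 cp x0 \<epsilon> (\<eta>p (x0, \<epsilon>)) \<zeta>"
      using P(5)[OF z0(1)] z0 Z by auto
    define G where "G y = I y + snd (fst y) * (\<eta>m (fst y) - \<eta>p (- snd y, snd (fst y)))" for y
    have GC: "C_k_on r G (?S1 \<times> ?J)" unfolding G_def[abs_def]
    proof (intro C_k_on_add I_C C_k_on_mult C_k_on_diff)
      show "C_k_on r (\<lambda>y. snd (fst y)) (?S1 \<times> ?J)"
        by (intro C_k_on_linear bounded_linear_fst bounded_linear_snd_comp)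
      show "C_k_on r (\<lambda>y. \<eta>m (fst y)) (?S1 \<times> ?J)"
        by (rule C_k_on_compose[OF \<eta>m(1) comp_C_k_linear[OF bounded_linear_fst]]) (use e1 in auto)
      show "C_k_on r (\<lambda>y. \<eta>p (- snd y, snd (fst y))) (?S1 \<times> ?J)"
        by (rule C_k_on_compose[OF \<eta>p(1) comp_C_k_Pair[OF comp_C_k_linear[OF bounded_linear_minus[OF bounded_linear_snd]]
              comp_C_k_linear[OF bounded_linear_snd_comp[OF bounded_linear_fst]]]]) (use e1 in auto)
    qed
    have Gcont: "continuous_on (?S1 \<times> ?J) G" by (rule C_k_on_continuous[OF GC])
    obtain r' where r': "r = Suc r'" using r by (cases r) auto
    have Q: "convex ({- c2..- c1} \<times> {0..e1})" "compact ({- c2..- c1} \<times> {0..e1})"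
      by (intro convex_Times convex_real_interval, intro compact_Times compact_Icc)
    have "C_k_on (Suc r') \<eta>p ({- c2..- c1} \<times> {0..e1})"
      by (rule C_k_on_subset[OF \<eta>p(1)[unfolded r']]) (use e1 in auto)
    then obtain L where L: "0 < L" "\<And>p q. p \<in> {- c2..- c1} \<times> {0..e1} \<Longrightarrow> q \<in> {- c2..- c1} \<times> {0..e1} \<Longrightarrow> \<bar>\<eta>p q - \<eta>p p\<bar> \<le> L * norm (q - p)"
      by (rule C_1_lipschitz[OF Q]) (rule that)
    have G0: "G ((x0, 0), y) = integral {x0..y} (\<lambda>s. h (s, 0, 0))" if "x0 \<in> {a..b}" "y \<in> ?J" for x0 y
      using I_eq[of x0 0 y] that eb by (simp add: G_def)
    have cont1: "continuous_on ({a..b} \<times> {0..e1}) (\<lambda>p. - G (p, c1))" and cont2: "continuous_on ({a..b} \<times> {0..e1}) (\<lambda>p. G (p, c2))"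
      using c12 by (auto intro!: continuous_on_minus continuous_on_slice1[OF Gcont])
    obtain k3 \<delta>3 where d3: "0 < k3" "0 < \<delta>3" "\<And>x \<epsilon>. x \<in> {a..b} \<Longrightarrow> \<epsilon> \<in> {0..e1} \<Longrightarrow> dist \<epsilon> 0 < \<delta>3 \<Longrightarrow> k3 \<le> - G ((x, \<epsilon>), c1)"
      by (rule compact_uniform_lower_bound[OF cont1, where ?m0.0=0]) (use I1 G0 c12 e1 in auto)
    obtain k4 \<delta>4 where d4: "0 < k4" "0 < \<delta>4" "\<And>x \<epsilon>. x \<in> {a..b} \<Longrightarrow> \<epsilon> \<in> {0..e1} \<Longrightarrow> dist \<epsilon> 0 < \<delta>4 \<Longrightarrow> k4 \<le> G ((x, \<epsilon>), c2)"
      by (rule compact_uniform_lower_bound[OF cont2, where ?m0.0=0]) (use I2 G0 c12 e1 in auto)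
    \<comment> \<open>\<delta>2 preserves the lower bound m2 of h, \<delta>3 and \<delta>4 the signs
      of \<open>G\<close> at the two ends, and the last term lets the perturbation \<epsilon>
      \<eta>p consume at most half of the slope m2.\<close>
    define e where "e = Min {e1, \<delta>2 / 2, \<delta>3 / 2, \<delta>4 / 2, m2 / (2 * L)}"
    have e: "0 < e" "e \<le> e1" "e < \<delta>2" "e < \<delta>3" "e < \<delta>4" "e \<le> m2 / (2 * L)"
    proof -
      have "e \<le> \<delta>2 / 2" "e \<le> \<delta>3 / 2" "e \<le> \<delta>4 / 2" by (simp_all add: e_def)
      then show "e < \<delta>2" "e < \<delta>3" "e < \<delta>4" using m2 d3 d4 by linarith+
    qed (use e1 m2 d3 d4 L in \<open>auto simp: e_def\<close>)
    have eL: "e * L \<le> m2 / 2" using e(6) L(1) by (simp add: field_simps)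
    let ?S = "{a..b} \<times> {0..e}"
    have S: "convex ?S" "compact ?S" by (intro convex_Times convex_real_interval, intro compact_Times compact_Icc)
    have SS: "?S \<times> ?J \<subseteq> ?S1 \<times> ?J" using e by auto
    have mono: "m2 / 2 * (y' - y) \<le> G (p, y') - G (p, y)" if p: "p \<in> ?S" and y: "y \<in> ?J" "y' \<in> ?J" "y \<le> y'" for p y y'
    proof -
      obtain x0 \<epsilon> where p_eq: "p = (x0, \<epsilon>)" and x0: "x0 \<in> {a..b}" and \<epsilon>: "\<epsilon> \<in> {0..e}" using p by auto
      have \<epsilon>': "\<epsilon> \<in> {0..e1}" "\<epsilon> \<in> {0..eb}" "dist \<epsilon> 0 < \<delta>2" using \<epsilon> e e1 by auto
      have ic: "(\<lambda>s. h (s, 0, \<epsilon>)) integrable_on {u..v}" if "a \<le> u" "v \<le> c2" for u v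
        by (rule integrable_continuous_real, rule continuous_on_subset[OF h0_cont[OF \<epsilon>'(2)]]) (use that in auto)
      have "integral {x0..y} (\<lambda>s. h (s, 0, \<epsilon>)) + integral {y..y'} (\<lambda>s. h (s, 0, \<epsilon>)) = integral {x0..y'} (\<lambda>s. h (s, 0, \<epsilon>))"
        by (rule Henstock_Kurzweil_Integration.integral_combine[OF _ _ ic]) (use x0 y ab c12 in auto)
      moreover have "integral {y..y'} (\<lambda>s. m2) \<le> integral {y..y'} (\<lambda>s. h (s, 0, \<epsilon>))"
        by (rule integral_le[OF _ ic]) (use y x0 ab c12 m2(3)[OF _ \<epsilon>'(1,3)] in auto)
      ultimately have 1: "m2 * (y' - y) \<le> I (p, y') - I (p, y)"
        using I_eq[OF x0 \<epsilon>'(2)] y by (simp add: p_eq mult.commute)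
      have "\<bar>\<eta>p (- y', \<epsilon>) - \<eta>p (- y, \<epsilon>)\<bar> \<le> L * norm ((- y', \<epsilon>) - (- y, \<epsilon>))"
        by (rule L(2)) (use y \<epsilon>' in auto)
      also have "norm ((- y', \<epsilon>) - (- y, \<epsilon>)) = y' - y" using y by simp
      finally have "\<epsilon> * \<bar>\<eta>p (- y', \<epsilon>) - \<eta>p (- y, \<epsilon>)\<bar> \<le> e * (L * (y' - y))"
        using \<epsilon> e L y by (intro mult_mono) auto
      also have "\<dots> = (e * L) * (y' - y)" by simp
      also have "\<dots> \<le> m2 / 2 * (y' - y)" using eL y by (intro mult_right_mono) auto
      finally have 2: "\<epsilon> * \<bar>\<eta>p (- y', \<epsilon>) - \<eta>p (- y, \<epsilon>)\<bar> \<le> m2 / 2 * (y' - y)" .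
      have "\<epsilon> * (\<eta>p (- y', \<epsilon>) - \<eta>p (- y, \<epsilon>)) \<le> \<epsilon> * \<bar>\<eta>p (- y', \<epsilon>) - \<eta>p (- y, \<epsilon>)\<bar>"
        using \<epsilon> by (intro mult_left_mono) auto
      moreover have "G (p, y') - G (p, y) = I (p, y') - I (p, y) - \<epsilon> * (\<eta>p (- y', \<epsilon>) - \<eta>p (- y, \<epsilon>))"
        by (simp add: G_def p_eq algebra_simps)
      ultimately show ?thesis using 1 2 by linarith
    qed
    have "\<exists>y\<in>?J. G (p, y) = 0" if p: "p \<in> ?S" for p
    proof -
      obtain x0 \<epsilon> where p_eq: "p = (x0, \<epsilon>)" and x0: "x0 \<in> {a..b}" and \<epsilon>: "\<epsilon> \<in> {0..e}" using p by auto
      have \<epsilon>': "\<epsilon> \<in> {0..e1}" "dist \<epsilon> 0 < \<delta>3" "dist \<epsilon> 0 < \<delta>4" using \<epsilon> e e1 by auto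
      have "G (p, c1) \<le> 0" "0 \<le> G (p, c2)" using d3(1) d3(3)[OF x0 \<epsilon>'(1,2)] d4(1) d4(3)[OF x0 \<epsilon>'(1,3)] by (auto simp: p_eq)
      moreover have "continuous_on ?J (\<lambda>y. G (p, y))" by (rule continuous_on_slice2[OF Gcont]) (use p e in auto)
      ultimately show ?thesis using IVT'[of "\<lambda>y. G (p, y)" c1 0 c2] c12 by auto
    qed
    then have "\<forall>p\<in>?S. \<exists>y. y \<in> ?J \<and> G (p, y) = 0" by blast
    from bchoice[OF this] obtain \<xi> where \<xi>0: "\<forall>p\<in>?S. \<xi> p \<in> ?J \<and> G (p, \<xi> p) = 0" by (elim exE)
    then have \<xi>: "\<And>p. p \<in> ?S \<Longrightarrow> \<xi> p \<in> ?J" "\<And>p. p \<in> ?S \<Longrightarrow> G (p, \<xi> p) = 0" by auto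
    have \<xi>C: "C_k_on r \<xi> ?S"
      by (rule C_k_on_implicit_function[OF S c12(2) _ continuous_on_subset[OF Gcont SS] mono \<xi> C_k_on_subset[OF GC SS]])
         (use m2 in auto)
    have at0: "\<xi> (x0, 0) \<in> ?J \<and> integral {x0..\<xi> (x0, 0)} (\<lambda>s. h (s, 0, 0)) = 0" if x0: "x0 \<in> {a..b}" for x0
    proof -
      have p: "(x0, 0) \<in> ?S" using x0 e by auto
      show ?thesis using \<xi>(1)[OF p] \<xi>(2)[OF p] G0[OF x0 \<xi>(1)[OF p]] by simp
    qed
    have orb: "\<xi> (x0, \<epsilon>) \<in> ?J \<and> (\<exists>\<zeta>. connecting_orbit h z0 c x0 (\<xi> (x0, \<epsilon>)) \<epsilon> \<zeta>)" if x0: "x0 \<in> {a..b}" and \<epsilon>: "\<epsilon> \<in> {0<..e}" for x0 \<epsilon>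
    proof -
      have p: "(x0, \<epsilon>) \<in> ?S" using x0 \<epsilon> e by auto
      have em: "\<epsilon> \<in> {0<..em}" "\<epsilon> \<in> {0<..ep}" "\<epsilon> \<in> {0..eb}" using \<epsilon> e e1 by auto
      obtain \<zeta>m where \<zeta>m: "half_orbit h z0 cm x0 \<epsilon> (\<eta>m (x0, \<epsilon>)) \<zeta>m" using \<eta>m(2) x0 em by blast
      have "- \<xi> (x0, \<epsilon>) \<in> {- c2..- c1}" using \<xi>(1)[OF p] by auto
      then obtain \<zeta>p where \<zeta>p: "half_orbit hp z0 cp (- \<xi> (x0, \<epsilon>)) \<epsilon> (\<eta>p (- \<xi> (x0, \<epsilon>), \<epsilon>)) \<zeta>p" using \<eta>p(2) em by blast
      have "integral {x0..\<xi> (x0, \<epsilon>)} (\<lambda>s. h (s, 0, \<epsilon>)) + \<epsilon> * (\<eta>m (x0, \<epsilon>) - \<eta>p (- \<xi> (x0, \<epsilon>), \<epsilon>)) = 0"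
        using \<xi>(2)[OF p] I_eq[OF x0 em(3) \<xi>(1)[OF p]] by (simp add: G_def)
      moreover have "continuous_on {x0..\<xi> (x0, \<epsilon>)} (\<lambda>s. h (s, 0, \<epsilon>))"
        by (rule continuous_on_subset[OF h0_cont[OF em(3)]]) (use x0 \<xi>(1)[OF p] in auto)
      ultimately have "connecting_orbit h z0 c x0 (\<xi> (x0, \<epsilon>)) \<epsilon> (\<lambda>x. if x \<le> 0 then \<zeta>m x else \<zeta>p (- x))"
        using \<zeta>p \<xi>(1)[OF p] x0 ab \<epsilon> z0 c12 unfolding hp_def[abs_def]
        by (intro half_orbits_connect[OF _ _ _ _ c(2,3) \<zeta>m]) auto
      then show ?thesis using \<xi>(1)[OF p] by blast
    qed
    show "\<exists>e \<xi>. 0 < e \<and> e \<le> eb \<and> C_k_on r \<xi> ({a..b} \<times> {0..e}) \<and>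
      (\<forall>x0\<in>{a..b}. \<xi> (x0, 0) \<in> {c1..c2} \<and> integral {x0..\<xi> (x0, 0)} (\<lambda>s. h (s, 0, 0)) = 0) \<and>
      (\<forall>x0\<in>{a..b}. \<forall>\<epsilon>\<in>{0<..e}. \<xi> (x0, \<epsilon>) \<in> {c1..c2} \<and> (\<exists>\<zeta>. connecting_orbit h z0 c x0 (\<xi> (x0, \<epsilon>)) \<epsilon> \<zeta>))"
      using e e1 \<xi>C at0 orb by (intro exI[where x=e] exI[where x=\<xi>]) auto
  qed
qed

section \<open>Trajectories as graphs\<close>

lemma connecting_orbitD:
  assumes "connecting_orbit h z0 c x0 x1 \<epsilon> \<zeta>"
  shows "0 < x1" "\<zeta> x0 = z0" "\<zeta> x1 = z0"
    "\<And>x. x \<in> {x0..x1} \<Longrightarrow> 0 < \<zeta> x" "\<And>x. x \<in> {x0..x1} \<Longrightarrow> \<zeta> x \<le> z0"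
    "\<And>x. x \<in> {x0..x1} \<Longrightarrow> (\<zeta> has_real_derivative h (x, \<zeta> x, \<epsilon>) * \<zeta> x / \<epsilon>) (at x within {x0..x1})"
    "\<And>x. 0 < x \<Longrightarrow> x < x1 \<Longrightarrow> \<zeta> x < z0"
    "\<And>x. x \<in> {x0..0} \<Longrightarrow> \<bar>\<epsilon> * ln (\<zeta> x / z0) - integral {x0..x} (\<lambda>s. h (s, 0, \<epsilon>))\<bar> \<le> \<epsilon>"
    "\<And>x. x \<in> {x0..0} \<Longrightarrow> \<zeta> x \<le> z0 * exp 1 * exp (- (c * (x - x0) / \<epsilon>))"
    "\<And>x. x \<in> {0..x1} \<Longrightarrow> \<bar>\<epsilon> * ln (\<zeta> x / z0) + integral {x..x1} (\<lambda>s. h (s, 0, \<epsilon>))\<bar> \<le> \<epsilon>"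
    "\<And>x. x \<in> {0..x1} \<Longrightarrow> \<zeta> x \<le> z0 * exp 1 * exp (- (c * (x1 - x) / \<epsilon>))"
  using assms unfolding connecting_orbit_def by auto

text \<open>Positivity of f is assumed along the graph, where it allows x and time to be exchanged;
  a trajectory with the same initial point turns out to stay on the graph.\<close>

locale orbit_graph =
  fixes f g :: "real \<Rightarrow> real \<Rightarrow> real \<Rightarrow> real" and E x0 x1 z0 \<epsilon> c :: real and \<zeta> :: "real \<Rightarrow> real"
  assumes f_C1: "C_k_on (Suc 0) (\<lambda>(x, z, \<epsilon>). f x z \<epsilon>) (UNIV \<times> UNIV \<times> {0..<E})"
    and g_C1: "C_k_on (Suc 0) (\<lambda>(x, z, \<epsilon>). g x z \<epsilon>) (UNIV \<times> UNIV \<times> {0..<E})"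
    and \<epsilon>: "0 < \<epsilon>" "\<epsilon> < E" and x0: "x0 < 0"
    and orbit: "connecting_orbit (\<lambda>(x, z, \<epsilon>). g x z \<epsilon> / f x z \<epsilon>) z0 c x0 x1 \<epsilon> \<zeta>"
    and f_pos: "\<And>x. x \<in> {x0..x1} \<Longrightarrow> 0 < f x (\<zeta> x) \<epsilon>"
begin

abbreviation U :: "(real \<times> real \<times> real) set" where "U \<equiv> UNIV \<times> UNIV \<times> {0..<E}"

lemmas orbit_facts = connecting_orbitD[OF orbit]

lemma x1_pos: "0 < x1" by (rule orbit_facts)

lemma \<zeta>_der: "x \<in> {x0..x1} \<Longrightarrow> (\<zeta> has_real_derivative g x (\<zeta> x) \<epsilon> / f x (\<zeta> x) \<epsilon> * \<zeta> x / \<epsilon>) (at x within {x0..x1})"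
  using orbit_facts(6)[of x] by simp

lemma \<zeta>_cont: "continuous_on {x0..x1} \<zeta>"
  by (rule DERIV_continuous_on[OF \<zeta>_der])

lemma f_cont: "continuous_on S X \<Longrightarrow> continuous_on S Z \<Longrightarrow> continuous_on S (\<lambda>t. f (X t) (Z t) \<epsilon>)"
  using continuous_on_compose2[OF C_k_on_continuous[OF f_C1] continuous_on_Pair[OF _ continuous_on_Pair[OF _ continuous_on_const[of _ \<epsilon>]]], of S X Z] \<epsilon>
  by (simp add: image_subset_iff)

lemma g_cont: "continuous_on S X \<Longrightarrow> continuous_on S Z \<Longrightarrow> continuous_on S (\<lambda>t. g (X t) (Z t) \<epsilon>)"
  using continuous_on_compose2[OF C_k_on_continuous[OF g_C1] continuous_on_Pair[OF _ continuous_on_Pair[OF _ continuous_on_const[of _ \<epsilon>]]], of S X Z] \<epsilon>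
  by (simp add: image_subset_iff)

text \<open>A continuous difference factor in z takes the place of a Lipschitz constant, so that
  comparing two curves leads to a linear equation.\<close>

lemma difference_quotient:
  assumes "C_k_on (Suc 0) (\<lambda>(x, z, \<epsilon>). \<phi> x z \<epsilon>) U"
  obtains K where "\<And>x z w. \<phi> x z \<epsilon> - \<phi> x w \<epsilon> = (z - w) * K x z w"
    "\<And>(S :: real set) X Z W. continuous_on S X \<Longrightarrow> continuous_on S Z \<Longrightarrow> continuous_on S W \<Longrightarrow> continuous_on S (\<lambda>t. K (X t) (Z t) (W t))"
proof -
  have U: "convex U" by (intro convex_Times convex_UNIV convex_real_interval)
  obtain A where A: "\<And>p. p \<in> U \<Longrightarrow> ((\<lambda>(x, z, \<epsilon>). \<phi> x z \<epsilon>) has_derivative (\<lambda>d. \<Sum>b\<in>Basis. (d \<bullet> b) * A b p)) (at p within U)"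
    "\<And>b. b \<in> Basis \<Longrightarrow> C_k_on 0 (A b) U" by (rule C_k_on_SucE[OF assms], rule that)
  have contA: "\<And>b. b \<in> Basis \<Longrightarrow> continuous_on U (A b)" by (rule C_k_on_continuous[OF A(2)])
  have basis: "(0, 1, 0) \<in> (Basis :: (real \<times> real \<times> real) set)" by (simp add: Basis_prod_def)
  define K where "K x z w = segment_mean (A (0, 1, 0)) (x, w, \<epsilon>) (x, z, \<epsilon>)" for x z w
  show ?thesis
  proof (rule that[of K])
    fix x z w
    have "(\<lambda>(x, z, \<epsilon>). \<phi> x z \<epsilon>) (x, z, \<epsilon>) - (\<lambda>(x, z, \<epsilon>). \<phi> x z \<epsilon>) (x, w, \<epsilon>)
       = (\<Sum>b\<in>Basis. (((x, z, \<epsilon>) - (x, w, \<epsilon>)) \<bullet> b) * segment_mean (A b) (x, w, \<epsilon>) (x, z, \<epsilon>))"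
      by (rule difference_eq_segment_mean[OF U _ _ A(1) contA]) (use \<epsilon> in auto)
    then show "\<phi> x z \<epsilon> - \<phi> x w \<epsilon> = (z - w) * K x z w" by (simp add: sum_Basis_prod K_def)
  next
    fix S :: "real set" and X Z W :: "real \<Rightarrow> real"
    assume c: "continuous_on S X" "continuous_on S Z" "continuous_on S W"
    have 1: "continuous_on S (\<lambda>t. ((X t, W t, \<epsilon>), (X t, Z t, \<epsilon>)))" by (intro continuous_intros c)
    have 2: "(\<lambda>t. ((X t, W t, \<epsilon>), (X t, Z t, \<epsilon>))) ` S \<subseteq> U \<times> U" using \<epsilon> by auto
    show "continuous_on S (\<lambda>t. K (X t) (Z t) (W t))"
      using continuous_on_compose2[OF continuous_on_segment_mean[OF contA[OF basis] U] 1 2] by (simp add: K_def)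
  qed
qed

text \<open>Uniqueness: \<open>Z t - \<zeta> (X t)\<close> solves a homogeneous linear equation and
  starts at 0. The sign of f at \<open>(X t, Z t)\<close> is unknown beforehand, so division is only
  by f on the graph.\<close>

lemma on_graph:
  assumes t1: "0 \<le> t1" and init: "X 0 = x0" "Z 0 = z0"
    and X: "\<And>t. t \<in> {0..t1} \<Longrightarrow> (X has_real_derivative \<epsilon> * f (X t) (Z t) \<epsilon>) (at t within {0..t1})"
    and Z: "\<And>t. t \<in> {0..t1} \<Longrightarrow> (Z has_real_derivative g (X t) (Z t) \<epsilon> * Z t) (at t within {0..t1})"
    and mem: "\<And>t. t \<in> {0..t1} \<Longrightarrow> X t \<in> {x0..x1}" and t: "t \<in> {0..t1}"
  shows "Z t = \<zeta> (X t)"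
proof -
  obtain Kf where Kf: "\<And>x z w. f x z \<epsilon> - f x w \<epsilon> = (z - w) * Kf x z w"
    "\<And>(S :: real set) X Z W. continuous_on S X \<Longrightarrow> continuous_on S Z \<Longrightarrow> continuous_on S W \<Longrightarrow> continuous_on S (\<lambda>t. Kf (X t) (Z t) (W t))"
    by (rule difference_quotient[OF f_C1], rule that)
  obtain Kg where Kg: "\<And>x z w. g x z \<epsilon> - g x w \<epsilon> = (z - w) * Kg x z w"
    "\<And>(S :: real set) X Z W. continuous_on S X \<Longrightarrow> continuous_on S Z \<Longrightarrow> continuous_on S W \<Longrightarrow> continuous_on S (\<lambda>t. Kg (X t) (Z t) (W t))"
    by (rule difference_quotient[OF g_C1], rule that)
  define W where "W s = \<zeta> (X s)" for s
  define H where "H s = g (X s) (W s) \<epsilon> / f (X s) (W s) \<epsilon>" for s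
  \<comment> \<open>Expanding f and g at \<open>(X s, Z s)\<close> around the graph point
    \<open>(X s, W s)\<close>, where \<open>H\<close> f = g, gives every term in the derivative of
    \<open>Z s - W s\<close> the factor \<open>Z s - W s\<close>.\<close>
  define \<alpha> where "\<alpha> s = Z s * Kg (X s) (Z s) (W s) + g (X s) (W s) \<epsilon> - H s * W s * Kf (X s) (Z s) (W s)" for s
  have Xc: "continuous_on {0..t1} X" by (rule DERIV_continuous_on[OF X])
  have Zc: "continuous_on {0..t1} Z" by (rule DERIV_continuous_on[OF Z])
  have Wc: "continuous_on {0..t1} W" unfolding W_def[abs_def]
    by (rule continuous_on_compose2[OF \<zeta>_cont Xc image_subsetI[OF mem]])
  have fp: "f (X s) (W s) \<epsilon> > 0" if "s \<in> {0..t1}" for s using f_pos[OF mem[OF that]] by (simp add: W_def)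
  have Hc: "continuous_on {0..t1} H" unfolding H_def[abs_def]
    by (intro continuous_on_divide g_cont f_cont Xc Wc) (use fp in force)
  have \<alpha>c: "continuous_on {0..t1} \<alpha>" unfolding \<alpha>_def[abs_def]
    by (intro continuous_intros Kg Kf g_cont Xc Zc Wc Hc)
  have "Z t - W t = exp (integral {0..t} \<alpha>) * integral {0..t} (\<lambda>s. exp (- integral {0..s} \<alpha>) * 0)"
  proof (rule linear_ode_solution[OF \<alpha>c _ _ t])
    show "Z 0 - W 0 = 0" using init orbit_facts(2) by (simp add: W_def)
    fix s assume s: "s \<in> {0..t1}"
    have "(\<zeta> has_real_derivative H s * W s / \<epsilon>) (at (X s) within X ` {0..t1})"
      unfolding H_def W_def by (rule DERIV_subset[OF \<zeta>_der[OF mem[OF s]] image_subsetI[OF mem]])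
    from DERIV_image_chain[OF this X[OF s]]
    have "(W has_real_derivative H s * W s / \<epsilon> * (\<epsilon> * f (X s) (Z s) \<epsilon>)) (at s within {0..t1})"
      by (simp add: W_def[abs_def] o_def)
    then have "((\<lambda>s. Z s - W s) has_real_derivative g (X s) (Z s) \<epsilon> * Z s - H s * W s / \<epsilon> * (\<epsilon> * f (X s) (Z s) \<epsilon>)) (at s within {0..t1})"
      by (intro DERIV_diff Z[OF s])
    moreover have "g (X s) (Z s) \<epsilon> * Z s - H s * W s / \<epsilon> * (\<epsilon> * f (X s) (Z s) \<epsilon>) = \<alpha> s * (Z s - W s) + 0"
    proof -
      have 1: "g (X s) (Z s) \<epsilon> = g (X s) (W s) \<epsilon> + (Z s - W s) * Kg (X s) (Z s) (W s)" using Kg(1)[of "X s" "Z s" "W s"] by linarith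
      have 2: "f (X s) (Z s) \<epsilon> = f (X s) (W s) \<epsilon> + (Z s - W s) * Kf (X s) (Z s) (W s)" using Kf(1)[of "X s" "Z s" "W s"] by linarith
      have 3: "H s * f (X s) (W s) \<epsilon> = g (X s) (W s) \<epsilon>" using fp[OF s] by (simp add: H_def)
      have 4: "H s * W s / \<epsilon> * (\<epsilon> * f (X s) (Z s) \<epsilon>) = H s * W s * f (X s) (Z s) \<epsilon>" using \<epsilon> by simp
      have "H s * W s * f (X s) (Z s) \<epsilon> = (H s * f (X s) (W s) \<epsilon>) * W s + H s * W s * ((Z s - W s) * Kf (X s) (Z s) (W s))"
        unfolding 2 by (simp add: algebra_simps)
      then show ?thesis unfolding 4 3 1 by (simp add: \<alpha>_def algebra_simps)
    qed
    ultimately show "((\<lambda>s. Z s - W s) has_real_derivative \<alpha> s * (Z s - W s) + 0) (at s within {0..t1})" by simp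
  qed simp
  then show ?thesis by (simp add: W_def)
qed

text \<open>As long as X stays in \<open>{x0..x1}\<close> the curve lies on the graph. It cannot
  leave: at the first possible exit time either X = x1, which is on the section before the final
  time, or X < x1 and f > 0 pushes X further into the interval.\<close>

lemma trajectory_imp_graph:
  assumes "is_trajectory f g x0 z0 \<epsilon> \<gamma>"
  shows "\<gamma> = (\<lambda>x. (x, \<zeta> x)) ` {x0..x1}"
proof -
  obtain X Z T where T: "0 < T" and init: "X 0 = x0" "Z 0 = z0"
    and X: "\<And>t. t \<in> {0..T} \<Longrightarrow> (X has_real_derivative \<epsilon> * f (X t) (Z t) \<epsilon>) (at t within {0..T})"
    and Z: "\<And>t. t \<in> {0..T} \<Longrightarrow> (Z has_real_derivative g (X t) (Z t) \<epsilon> * Z t) (at t within {0..T})"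
    and fin: "(X T, Z T) \<in> cross_section z0" and nc: "\<And>t. t \<in> {0..<T} \<Longrightarrow> (X t, Z t) \<notin> cross_section z0"
    and \<gamma>: "\<gamma> = (\<lambda>t. (X t, Z t)) ` {0..T}"
    using assms unfolding is_trajectory_def by blast
  have Xc: "continuous_on {0..T} X" by (rule DERIV_continuous_on[OF X])
  have graph: "Z t = \<zeta> (X t)" if "t1 \<in> {0..T}" "\<And>s. s \<in> {0..t1} \<Longrightarrow> X s \<in> {x0..x1}" "t \<in> {0..t1}" for t1 t
  proof (rule on_graph[where X=X and Z=Z, OF _ init _ _ that(2,3)])
    have sub: "{0..t1} \<subseteq> {0..T}" using that by auto
    show "(X has_real_derivative \<epsilon> * f (X t) (Z t) \<epsilon>) (at t within {0..t1})" if "t \<in> {0..t1}" for t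
      by (rule DERIV_subset[OF X sub]) (use that sub in auto)
    show "(Z has_real_derivative g (X t) (Z t) \<epsilon> * Z t) (at t within {0..t1})" if "t \<in> {0..t1}" for t
      by (rule DERIV_subset[OF Z sub]) (use that sub in auto)
  qed (use that in auto)
  have mem: "X t \<in> {x0..x1}" if "t \<in> {0..T}" for t
  proof (rule ccontr)
    assume bad: "X t \<notin> {x0..x1}"
    define B where "B = {t \<in> {0..T}. X t \<notin> {x0..x1}}"
    have B: "t \<in> B" "bdd_below B" using bad that by (auto simp: B_def intro: bdd_belowI[of _ 0])
    define s where "s = Inf B"
    have s_le: "s \<le> t'" if "t' \<in> B" for t' unfolding s_def by (rule cInf_lower[OF that B(2)])
    have s0: "0 \<le> s" unfolding s_def by (rule cInf_greatest) (use B in \<open>auto simp: B_def\<close>)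
    have sT: "s \<le> T" using s_le[OF B(1)] that by auto
    have below: "X t' \<in> {x0..x1}" if "t' \<in> {0..<s}" for t' using s_le[of t'] that sT by (auto simp: B_def)
    have at_s: "X s \<in> {x0..x1}"
    proof (cases "s = 0")
      case True then show ?thesis using init x0 x1_pos by simp
    next
      case False
      then have cl: "closure {0..<s} = {0..s}" using s0 by (intro closure_atLeastLessThan) auto
      have "continuous_on (closure {0..<s}) X" unfolding cl by (rule continuous_on_subset[OF Xc]) (use sT in auto)
      moreover have "s \<in> closure {0..<s}" unfolding cl using s0 by simp
      ultimately show ?thesis
        using continuous_le_on_closure[of "{0..<s}" X s x1] continuous_ge_on_closure[of "{0..<s}" X s x0] below by auto
    qed
    have upto: "X t' \<in> {x0..x1}" if "t' \<in> {0..s}" for t' using below[of t'] at_s that by (cases "t' = s") auto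
    have Zs: "Z s = \<zeta> (X s)" by (rule graph[of s s, OF _ upto]) (use s0 sT in auto)
    have sB: "s \<notin> B" using at_s by (simp add: B_def)
    have "s < T"
    proof (rule ccontr)
      assume "\<not> s < T"
      then have "s = T" using sT by simp
      then have "t = s" using s_le[OF B(1)] that by auto
      then show False using sB B(1) by simp
    qed
    show False
    proof (cases "X s = x1")
      case True
      then have "(X s, Z s) \<in> cross_section z0" using Zs orbit_facts(3) x1_pos by (simp add: cross_section_def)
      then show False using nc[of s] s0 \<open>s < T\<close> by auto
    next
      case False
      then have lt: "X s < x1" using at_s by auto
      have sI: "s \<in> {0..T}" using s0 sT by auto
      have "0 < \<epsilon> * f (X s) (Z s) \<epsilon>" using f_pos[OF at_s] Zs \<epsilon> by simp
      from has_real_derivative_pos_inc_right[OF X[OF sI] this]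
      obtain d where d: "d > 0" "\<And>k. 0 < k \<Longrightarrow> s + k \<in> {0..T} \<Longrightarrow> k < d \<Longrightarrow> X s < X (s + k)" by blast
      obtain d' where d': "d' > 0" "\<And>t'. t' \<in> {0..T} \<Longrightarrow> dist t' s < d' \<Longrightarrow> dist (X t') (X s) < x1 - X s"
        using Xc[unfolded continuous_on_iff, rule_format, OF sI, of "x1 - X s"] lt by auto
      \<comment> \<open>No bad time occurs shortly after s either, which contradicts the choice of s
        as the infimum of the bad times.\<close>
      have "s + min d d' \<le> t'" if t': "t' \<in> B" for t'
      proof (rule ccontr)
        assume "\<not> s + min d d' \<le> t'"
        then have less: "t' < s + d" "t' < s + d'" by auto
        have "s \<le> t'" "t' \<noteq> s" using s_le[OF t'] t' sB by auto
        then have gt: "s < t'" by simp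
        have tI: "t' \<in> {0..T}" using t' by (simp add: B_def)
        have "X s < X t'" using d(2)[of "t' - s"] gt less tI by simp
        moreover have "X t' < x1" using d'(2)[OF tI] less gt by (simp add: dist_real_def)
        ultimately show False using t' at_s by (auto simp: B_def)
      qed
      then have "s + min d d' \<le> s" unfolding s_def using B by (intro cInf_greatest) auto
      then show False using d d' by simp
    qed
  qed
  have Zeq: "Z t = \<zeta> (X t)" if "t \<in> {0..T}" for t by (rule graph[of T t, OF _ mem that]) (use T in auto)
  \<comment> \<open>On the graph over \<open>{0<..<x1}\<close> the height is below z0, so the
    section can be met only at x1.\<close>
  have XT: "X T = x1"
  proof -
    have "0 < X T" "\<zeta> (X T) = z0" using fin Zeq[of T] T by (auto simp: cross_section_def)
    then show ?thesis using orbit_facts(7)[of "X T"] mem[of T] T by (cases "X T < x1") auto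
  qed
  have "X ` {0..T} = {x0..x1}"
  proof
    show "X ` {0..T} \<subseteq> {x0..x1}" using mem by auto
    show "{x0..x1} \<subseteq> X ` {0..T}"
    proof
      fix x assume "x \<in> {x0..x1}"
      then obtain t where "0 \<le> t" "t \<le> T" "X t = x" using IVT'[of X 0 x T] init XT T Xc by auto
      then show "x \<in> X ` {0..T}" by auto
    qed
  qed
  moreover have "\<gamma> = (\<lambda>x. (x, \<zeta> x)) ` (X ` {0..T})"
    unfolding \<gamma> image_image by (rule image_cong) (use Zeq in auto)
  ultimately show ?thesis by simp
qed

text \<open>The time needed to reach x along the graph is \<tau>, the integral of 1 / (\<epsilon>
  f). It is strictly increasing, X is its inverse, and solving the Hadamard identity of \<tau> for
  the increment of X gives the derivative of X.\<close>

lemma graph_is_trajectory: "is_trajectory f g x0 z0 \<epsilon> ((\<lambda>x. (x, \<zeta> x)) ` {x0..x1})"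
proof -
  let ?J = "{x0..x1}"
  have J: "x0 < x1" using x0 x1_pos by simp
  define \<psi> where "\<psi> x = 1 / (\<epsilon> * f x (\<zeta> x) \<epsilon>)" for x
  have \<psi>p: "0 < \<psi> x" if "x \<in> ?J" for x using f_pos[OF that] \<epsilon> by (simp add: \<psi>_def)
  have \<psi>c: "continuous_on ?J \<psi>" unfolding \<psi>_def[abs_def]
    by (intro continuous_on_divide continuous_intros f_cont \<zeta>_cont) (use f_pos \<epsilon> in force)
  have "compact ?J" "?J \<noteq> {}" using J by auto
  from continuous_attains_inf[OF this \<psi>c] obtain xm where xm: "xm \<in> ?J" "\<And>y. y \<in> ?J \<Longrightarrow> \<psi> xm \<le> \<psi> y" by blast
  have sm: "0 < segment_mean \<psi> p q" if "p \<in> ?J" "q \<in> ?J" for p q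
    using segment_mean_ge[OF _ that \<psi>c xm(2)] \<psi>p[OF xm(1)] by (simp add: convex_real_interval)
  define \<tau> where "\<tau> x = integral {x0..x} \<psi>" for x
  have \<tau>_diff: "\<tau> q - \<tau> p = (q - p) * segment_mean \<psi> p q" if "p \<in> ?J" "q \<in> ?J" for p q
  proof -
    have "\<tau> q - \<tau> p = (\<Sum>b\<in>Basis. ((q - p) \<bullet> b) * segment_mean \<psi> p q)"
    proof (rule difference_eq_segment_mean[where A="\<lambda>_. \<psi>" and S="?J"])
      fix x assume "x \<in> ?J"
      from integral_has_vector_derivative[OF \<psi>c this]
      show "(\<tau> has_derivative (\<lambda>h. \<Sum>b\<in>Basis. h \<bullet> b * \<psi> x)) (at x within ?J)"
        by (simp add: has_vector_derivative_def \<tau>_def[abs_def])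
    qed (use that \<psi>c in auto)
    then show ?thesis by simp
  qed
  have \<tau>_less: "\<tau> p < \<tau> q" if "p \<in> ?J" "q \<in> ?J" "p < q" for p q
    using \<tau>_diff[OF that(1,2)] mult_pos_pos[OF _ sm[OF that(1,2)], of "q - p"] that(3) by simp
  have \<tau>c: "continuous_on ?J \<tau>" unfolding \<tau>_def[abs_def]
    by (rule indefinite_integral_continuous_1) (rule integrable_continuous_real[OF \<psi>c])
  have inj: "inj_on \<tau> ?J" by (rule linorder_inj_onI) (use \<tau>_less in force)+
  define T where "T = \<tau> x1"
  have \<tau>0: "\<tau> x0 = 0" by (simp add: \<tau>_def)
  have T: "0 < T" using \<tau>_less[of x0 x1] J by (simp add: T_def \<tau>0)
  have im: "\<tau> ` ?J = {0..T}"
  proof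
    show "\<tau> ` ?J \<subseteq> {0..T}"
    proof
      fix t assume "t \<in> \<tau> ` ?J"
      then obtain x where x: "x \<in> ?J" "t = \<tau> x" by auto
      show "t \<in> {0..T}" using \<tau>_less[of x0 x] \<tau>_less[of x x1] x J
        by (cases "x = x0"; cases "x = x1") (auto simp: T_def \<tau>0)
    qed
    show "{0..T} \<subseteq> \<tau> ` ?J"
    proof
      fix t assume "t \<in> {0..T}"
      then obtain x where "x0 \<le> x" "x \<le> x1" "\<tau> x = t" using IVT'[of \<tau> x0 t x1] J \<tau>c by (auto simp: T_def \<tau>0)
      then show "t \<in> \<tau> ` ?J" by auto
    qed
  qed
  define X where "X = inv_into ?J \<tau>"
  have X\<tau>: "X (\<tau> x) = x" if "x \<in> ?J" for x unfolding X_def by (rule inv_into_f_f[OF inj that])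
  have X_mem: "X t \<in> ?J" if "t \<in> {0..T}" for t unfolding X_def by (rule inv_into_into) (use that im in simp)
  have \<tau>X: "\<tau> (X t) = t" if "t \<in> {0..T}" for t unfolding X_def by (rule f_inv_into_f) (use that im in simp)
  have Xc: "continuous_on {0..T} X"
    using continuous_on_inv[OF \<tau>c, of X] X\<tau> by (simp add: im)
  have XT: "X T = x1" "X 0 = x0" using X\<tau>[of x1] X\<tau>[of x0] J by (auto simp: T_def \<tau>0)
  have X_der: "(X has_real_derivative \<epsilon> * f (X t) (\<zeta> (X t)) \<epsilon>) (at t within {0..T})" if t: "t \<in> {0..T}" for t
  proof -
    have "(X has_derivative (\<lambda>d. \<Sum>b\<in>Basis. (d \<bullet> b) * (1 / segment_mean \<psi> (X t) (X t)))) (at t within {0..T})"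
    proof (rule has_derivative_difference_form[where B="\<lambda>_ t'. 1 / segment_mean \<psi> (X t) (X t')", OF _ _ t])
      fix t' assume t': "t' \<in> {0..T}"
      have "t' - t = (X t' - X t) * segment_mean \<psi> (X t) (X t')"
        using \<tau>_diff[OF X_mem[OF t] X_mem[OF t']] unfolding \<tau>X[OF t] \<tau>X[OF t'] .
      then show "X t' - X t = (\<Sum>b\<in>Basis. ((t' - t) \<bullet> b) * (1 / segment_mean \<psi> (X t) (X t')))"
        using sm[OF X_mem[OF t] X_mem[OF t']] by (simp add: field_simps)
    next
      have nz: "segment_mean \<psi> (X t) (X t') \<noteq> 0" if "t' \<in> {0..T}" for t'
        using sm[OF X_mem[OF t] X_mem[OF that]] by simp
      have "continuous_on {0..T} (\<lambda>t'. segment_mean \<psi> (X t) (X t'))"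
        using continuous_on_compose2[OF continuous_on_slice2[OF continuous_on_segment_mean[OF \<psi>c] X_mem[OF t]] Xc image_subsetI[OF X_mem]]
        by (simp add: convex_real_interval)
      then have "continuous_on {0..T} (\<lambda>t'. 1 / segment_mean \<psi> (X t) (X t'))"
        by (intro continuous_on_divide continuous_on_const) (use nz in auto)
      then show "continuous (at t within {0..T}) (\<lambda>t'. 1 / segment_mean \<psi> (X t) (X t'))"
        using t unfolding continuous_on_eq_continuous_within by blast
    qed
    then show ?thesis unfolding has_field_derivative_def
      by (rule has_derivative_eq_rhs) (simp add: \<psi>_def fun_eq_iff)
  qed
  have Z_der: "((\<lambda>t. \<zeta> (X t)) has_real_derivative g (X t) (\<zeta> (X t)) \<epsilon> * \<zeta> (X t)) (at t within {0..T})" if t: "t \<in> {0..T}" for t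
  proof -
    have 1: "(\<zeta> has_real_derivative g (X t) (\<zeta> (X t)) \<epsilon> / f (X t) (\<zeta> (X t)) \<epsilon> * \<zeta> (X t) / \<epsilon>) (at (X t) within X ` {0..T})"
      by (rule DERIV_subset[OF \<zeta>_der[OF X_mem[OF t]] image_subsetI[OF X_mem]])
    show ?thesis using DERIV_image_chain[OF 1 X_der[OF t]] f_pos[OF X_mem[OF t]] \<epsilon> by (simp add: o_def)
  qed
  have nc: "(X t, \<zeta> (X t)) \<notin> cross_section z0" if t: "t \<in> {0..<T}" for t
  proof -
    have tI: "t \<in> {0..T}" using t by auto
    have "X t \<noteq> x1" using \<tau>X[OF tI] t by (auto simp: T_def)
    then have "X t < x1" using X_mem[OF tI] by auto
    then show ?thesis using orbit_facts(7)[of "X t"] by (auto simp: cross_section_def)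
  qed
  have XI: "X ` {0..T} = ?J"
  proof
    show "X ` {0..T} \<subseteq> ?J" using X_mem by auto
    show "?J \<subseteq> X ` {0..T}"
    proof
      fix x assume x: "x \<in> ?J"
      then have "\<tau> x \<in> {0..T}" using im by blast
      then show "x \<in> X ` {0..T}" using X\<tau>[OF x] by force
    qed
  qed
  have "(\<lambda>x. (x, \<zeta> x)) ` ?J = (\<lambda>t. (X t, \<zeta> (X t))) ` {0..T}"
    unfolding XI[symmetric] image_image ..
  moreover have "(X T, \<zeta> (X T)) \<in> cross_section z0" using XT orbit_facts(3) x1_pos by (simp add: cross_section_def)
  ultimately show ?thesis unfolding is_trajectory_def
    using T XT orbit_facts(2) X_der Z_der nc
    by (intro exI[where x=X] exI[where x="\<lambda>t. \<zeta> (X t)"] exI[where x=T]) auto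
qed

lemma trajectory_iff: "is_trajectory f g x0 z0 \<epsilon> \<gamma> \<longleftrightarrow> \<gamma> = (\<lambda>x. (x, \<zeta> x)) ` {x0..x1}"
  using trajectory_imp_graph graph_is_trajectory by blast

lemma trajectory_ex1: "\<exists>!\<gamma>. is_trajectory f g x0 z0 \<epsilon> \<gamma>"
  by (simp add: trajectory_iff)

lemma trajectory_eq: "trajectory f g x0 z0 \<epsilon> = (\<lambda>x. (x, \<zeta> x)) ` {x0..x1}"
  by (simp add: trajectory_def trajectory_iff)

lemma trajectory_cross_section: "trajectory f g x0 z0 \<epsilon> \<inter> cross_section z0 = {(x1, z0)}"
proof -
  have "x = x1" if "x \<in> {x0..x1}" "0 < x" "\<zeta> x = z0" for x
    using orbit_facts(7)[of x] that by (cases "x < x1") auto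
  then show ?thesis using orbit_facts(3) x1_pos x0 by (auto simp: trajectory_eq cross_section_def)
qed

end

section \<open>Asymptotics\<close>

lemma uniform_perturbation:
  fixes \<phi> :: "'a::metric_space \<times> real \<Rightarrow> real"
  assumes \<phi>: "continuous_on (K \<times> {0..e}) \<phi>" and K: "compact K" and d: "0 < d"
  obtains \<delta> where "0 < \<delta>" "\<And>s \<epsilon>. s \<in> K \<Longrightarrow> 0 \<le> \<epsilon> \<Longrightarrow> \<epsilon> \<le> e \<Longrightarrow> \<epsilon> < \<delta> \<Longrightarrow> \<bar>\<phi> (s, \<epsilon>) - \<phi> (s, 0)\<bar> \<le> d"
proof -
  have "uniformly_continuous_on (K \<times> {0..e}) \<phi>"
    by (rule compact_uniformly_continuous[OF \<phi> compact_Times[OF K compact_Icc]])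
  then obtain \<delta> where \<delta>: "\<delta> > 0" "\<And>x y. x \<in> K \<times> {0..e} \<Longrightarrow> y \<in> K \<times> {0..e} \<Longrightarrow> dist y x < \<delta> \<Longrightarrow> dist (\<phi> y) (\<phi> x) < d"
    unfolding uniformly_continuous_on_def using d by meson
  show ?thesis
  proof (rule that[OF \<delta>(1)])
    fix s \<epsilon> assume "s \<in> K" "0 \<le> \<epsilon>" "\<epsilon> \<le> e" "\<epsilon> < \<delta>"
    then have "dist (\<phi> (s, \<epsilon>)) (\<phi> (s, 0)) < d" by (intro \<delta>(2)) (auto simp: dist_Pair_Pair)
    then show "\<bar>\<phi> (s, \<epsilon>) - \<phi> (s, 0)\<bar> \<le> d" by (simp add: dist_real_def)
  qed
qed

lemma dist_Pair_le: "dist (a, b) (c, d) \<le> dist a c + dist b d"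
  using sqrt_sum_squares_le_sum_abs[of "dist a c" "dist b d"] by (simp add: dist_Pair_Pair)

text \<open>Nonnegativity is proved along with the upper bound because a supremum of reals is
  informative only for nonempty bounded sets.\<close>

lemma hausdorff_distance_bounds:
  assumes ne: "A \<noteq> {}" "B \<noteq> {}"
    and A: "\<And>a. a \<in> A \<Longrightarrow> \<exists>b\<in>B. dist a b \<le> K" and B: "\<And>b. b \<in> B \<Longrightarrow> \<exists>a\<in>A. dist b a \<le> K"
  shows "0 \<le> hausdorff_distance A B" "hausdorff_distance A B \<le> K"
proof -
  have a: "infdist a B \<le> K" if "a \<in> A" for a using A[OF that] infdist_le order_trans by blast
  have b: "infdist b A \<le> K" if "b \<in> B" for b using B[OF that] infdist_le order_trans by blast
  show "hausdorff_distance A B \<le> K" unfolding hausdorff_distance_def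
    by (intro max.boundedI cSUP_least ne a b)
  obtain a0 where "a0 \<in> A" using ne by auto
  then have "infdist a0 B \<le> (SUP a\<in>A. infdist a B)"
    using a by (intro cSUP_upper) (auto intro!: bdd_aboveI[of _ K])
  then have "0 \<le> (SUP a\<in>A. infdist a B)" using infdist_nonneg[of a0 B] by linarith
  then show "0 \<le> hausdorff_distance A B" unfolding hausdorff_distance_def by simp
qed

section \<open>Minimum of z and Hausdorff distance along one orbit\<close>

context orbit_graph
begin

text \<open>The height at \<open>x = 0\<close> bounds the minimum from above. For \<epsilon> > 0 the
  minimiser may lie on either side of 0; wherever it lies, the sign of \<open>h s 0\<close> shows
  that the integral from x0, or up to x1, is no more extreme than the one ending or starting at 0.
  Replacing h at \<epsilon> by h at 0 costs \<open>d * (x1 - x0)\<close>.\<close>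

lemma min_estimate:
  fixes h :: "real \<Rightarrow> real \<Rightarrow> real"
  assumes h_def: "\<And>s e. h s e = g s 0 e / f s 0 e" and z0: "0 < z0"
    and cont: "continuous_on {x0..x1} (\<lambda>s. h s \<epsilon>)" "continuous_on {x0..x1} (\<lambda>s. h s 0)"
    and d: "\<And>s. s \<in> {x0..x1} \<Longrightarrow> \<bar>h s \<epsilon> - h s 0\<bar> \<le> d" "0 \<le> d"
    and neg: "\<And>s. s \<in> {x0..0} \<Longrightarrow> h s 0 \<le> 0" and pos: "\<And>s. s \<in> {0..x1} \<Longrightarrow> 0 \<le> h s 0"
  obtains m where "0 < m" "m \<in> snd ` ((\<lambda>x. (x, \<zeta> x)) ` {x0..x1})"
    "\<And>z. z \<in> snd ` ((\<lambda>x. (x, \<zeta> x)) ` {x0..x1}) \<Longrightarrow> m \<le> z"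
    "\<epsilon> * ln m \<le> \<epsilon> * ln z0 + \<epsilon> + integral {x0..0} (\<lambda>s. h s 0) + d * (x1 - x0)"
    "\<epsilon> * ln z0 - \<epsilon> - d * (x1 - x0) + min (integral {x0..0} (\<lambda>s. h s 0)) (- integral {0..x1} (\<lambda>s. h s 0)) \<le> \<epsilon> * ln m"
proof -
  have J: "compact {x0..x1}" "{x0..x1} \<noteq> {}" using x0 x1_pos by auto
  from continuous_attains_inf[OF J \<zeta>_cont] obtain xm where xm: "xm \<in> {x0..x1}" "\<And>x. x \<in> {x0..x1} \<Longrightarrow> \<zeta> xm \<le> \<zeta> x" by blast
  have mp: "0 < \<zeta> xm" by (rule orbit_facts(4)[OF xm(1)])
  have int: "(\<lambda>s. h s e) integrable_on {u..v}" if "e = \<epsilon> \<or> e = 0" "x0 \<le> u" "v \<le> x1" for e u v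
    using that cont by (auto intro!: integrable_continuous_real intro: continuous_on_subset)
  have close: "\<bar>integral {u..v} (\<lambda>s. h s \<epsilon>) - integral {u..v} (\<lambda>s. h s 0)\<bar> \<le> d * (x1 - x0)" if "x0 \<le> u" "u \<le> v" "v \<le> x1" for u v
  proof -
    have "integral {u..v} (\<lambda>s. h s \<epsilon>) - integral {u..v} (\<lambda>s. h s 0) = integral {u..v} (\<lambda>s. h s \<epsilon> - h s 0)"
      using that by (intro integral_diff[symmetric] int) auto
    also have "norm \<dots> \<le> d * (v - u)"
      using that d(1) by (intro integral_bound continuous_on_diff continuous_on_subset[OF cont(1)] continuous_on_subset[OF cont(2)]) auto
    also have "\<dots> \<le> d * (x1 - x0)" using that d(2) by (intro mult_left_mono) auto
    finally show ?thesis by simp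
  qed
  have ln_div: "\<epsilon> * ln (\<zeta> x / z0) = \<epsilon> * ln (\<zeta> x) - \<epsilon> * ln z0" if "x \<in> {x0..x1}" for x
    using orbit_facts(4)[OF that] z0 by (simp add: ln_div right_diff_distrib)
  have 0: "0 \<in> {x0..x1}" "0 \<in> {x0..0}" using x0 x1_pos by auto
  show ?thesis
  proof (rule that[OF mp])
    show "\<zeta> xm \<in> snd ` ((\<lambda>x. (x, \<zeta> x)) ` {x0..x1})" using xm(1) by (force simp: image_image)
    show "\<And>z. z \<in> snd ` ((\<lambda>x. (x, \<zeta> x)) ` {x0..x1}) \<Longrightarrow> \<zeta> xm \<le> z" using xm(2) by auto
    have "\<epsilon> * ln (\<zeta> xm) \<le> \<epsilon> * ln (\<zeta> 0)" using xm(2)[OF 0(1)] mp \<epsilon> by (intro mult_left_mono) auto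
    also have "\<dots> \<le> \<epsilon> * ln z0 + \<epsilon> + integral {x0..0} (\<lambda>s. h s \<epsilon>)"
      using orbit_facts(8)[OF 0(2)] ln_div[OF 0(1)] by (simp add: h_def)
    also have "\<dots> \<le> \<epsilon> * ln z0 + \<epsilon> + integral {x0..0} (\<lambda>s. h s 0) + d * (x1 - x0)"
      using close[of x0 0] x0 x1_pos by simp
    finally show "\<epsilon> * ln (\<zeta> xm) \<le> \<epsilon> * ln z0 + \<epsilon> + integral {x0..0} (\<lambda>s. h s 0) + d * (x1 - x0)" .
    show "\<epsilon> * ln z0 - \<epsilon> - d * (x1 - x0) + min (integral {x0..0} (\<lambda>s. h s 0)) (- integral {0..x1} (\<lambda>s. h s 0)) \<le> \<epsilon> * ln (\<zeta> xm)"
    proof (cases "xm \<le> 0")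
      case True
      then have xI: "xm \<in> {x0..0}" using xm(1) by auto
      have "integral {x0..xm} (\<lambda>s. h s 0) + integral {xm..0} (\<lambda>s. h s 0) = integral {x0..0} (\<lambda>s. h s 0)"
        using xI x1_pos by (intro Henstock_Kurzweil_Integration.integral_combine int) auto
      moreover have "integral {xm..0} (\<lambda>s. h s 0) \<le> integral {xm..0} (\<lambda>s. 0)"
        using xI x1_pos neg by (intro integral_le int) auto
      ultimately have "integral {x0..0} (\<lambda>s. h s 0) \<le> integral {x0..xm} (\<lambda>s. h s 0)" by simp
      then show ?thesis
        using orbit_facts(8)[OF xI] ln_div[OF xm(1)] close[of x0 xm] xI xm(1) by (simp add: h_def)
    next
      case False
      then have xI: "xm \<in> {0..x1}" using xm(1) by auto
      have "integral {0..xm} (\<lambda>s. h s 0) + integral {xm..x1} (\<lambda>s. h s 0) = integral {0..x1} (\<lambda>s. h s 0)"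
        using xI x0 by (intro Henstock_Kurzweil_Integration.integral_combine int) auto
      moreover have "integral {0..xm} (\<lambda>s. 0) \<le> integral {0..xm} (\<lambda>s. h s 0)"
        using xI x0 pos by (intro integral_le int) auto
      ultimately have "integral {xm..x1} (\<lambda>s. h s 0) \<le> integral {0..x1} (\<lambda>s. h s 0)" by simp
      then show ?thesis
        using orbit_facts(10)[OF xI] ln_div[OF xm(1)] close[of xm x1] xI xm(1) by (simp add: h_def)
    qed
  qed
qed

text \<open>Outside strips of width d at both ends the orbit has height at most d. In the strips it
  takes, by the intermediate value theorem, all heights between its value at the inner edge and z0,
  so the vertical segments are approximated as well; d \<le> -x0 and d \<le> x1 keep the two strips
  on their own sides of 0.\<close>

lemma hausdorff_estimate:
  assumes d: "0 < d" "d \<le> - x0" "d \<le> x1" and X: "\<bar>x1 - X\<bar> \<le> d" "0 < X" and z0: "0 < z0" and c: "0 < c"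
    and small: "z0 * exp 1 * exp (- (c * d / \<epsilon>)) \<le> d"
  shows "0 \<le> hausdorff_distance ((\<lambda>x. (x, \<zeta> x)) ` {x0..x1}) (singular_orbit x0 X z0)"
    "hausdorff_distance ((\<lambda>x. (x, \<zeta> x)) ` {x0..x1}) (singular_orbit x0 X z0) \<le> 3 * d"
proof -
  let ?A = "(\<lambda>x. (x, \<zeta> x)) ` {x0..x1}" and ?B = "singular_orbit x0 X z0"
  have decay: "z0 * exp 1 * exp (- (c * t / \<epsilon>)) \<le> d" if "d \<le> t" for t
  proof -
    have "c * d / \<epsilon> \<le> c * t / \<epsilon>" using that c \<epsilon> by (intro divide_right_mono mult_left_mono) auto
    then have "z0 * exp 1 * exp (- (c * t / \<epsilon>)) \<le> z0 * exp 1 * exp (- (c * d / \<epsilon>))" using z0 by (intro mult_left_mono) auto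
    then show ?thesis using small by linarith
  qed
  have low: "\<zeta> x \<le> d" if "x \<in> {x0 + d..x1 - d}" for x
  proof (cases "x \<le> 0")
    case True
    then show ?thesis using orbit_facts(9)[of x] decay[of "x - x0"] that d by simp
  next
    case False
    then show ?thesis using orbit_facts(11)[of x] decay[of "x1 - x"] that d by simp
  qed
  have \<zeta>pos: "0 < \<zeta> x" "\<zeta> x \<le> z0" if "x \<in> {x0..x1}" for x using orbit_facts(4,5)[OF that] by auto
  have A: "\<exists>b\<in>?B. dist a b \<le> 3 * d" if aA: "a \<in> ?A" for a
  proof -
    obtain x where x: "x \<in> {x0..x1}" "a = (x, \<zeta> x)" using aA by blast
    consider "x \<le> x0 + d" | "x \<in> {x0 + d..x1 - d}" | "x1 - d \<le> x" by force
    then show ?thesis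
    proof cases
      case 1
      have "(x0, \<zeta> x) \<in> ?B" using \<zeta>pos[OF x(1)] by (auto simp: singular_orbit_def)
      moreover have "dist a (x0, \<zeta> x) \<le> 3 * d" using dist_Pair_le[of x "\<zeta> x" x0 "\<zeta> x"] 1 x d by (simp add: dist_real_def)
      ultimately show ?thesis by blast
    next
      case 2
      have "(x, 0) \<in> ?B" using 2 X d by (auto simp: singular_orbit_def)
      moreover have "dist a (x, 0) \<le> 3 * d" using dist_Pair_le[of x "\<zeta> x" x 0] low[OF 2] \<zeta>pos[OF x(1)] x d by (simp add: dist_real_def)
      ultimately show ?thesis by blast
    next
      case 3
      have "(X, \<zeta> x) \<in> ?B" using \<zeta>pos[OF x(1)] by (auto simp: singular_orbit_def)
      moreover have "dist a (X, \<zeta> x) \<le> 3 * d" using dist_Pair_le[of x "\<zeta> x" X "\<zeta> x"] 3 X x d by (simp add: dist_real_def)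
      ultimately show ?thesis by blast
    qed
  qed
  have B: "\<exists>a\<in>?A. dist b a \<le> 3 * d" if bB: "b \<in> ?B" for b
  proof -
    have *: ?thesis if "x \<in> {x0..x1}" "dist (fst b) x + dist (snd b) (\<zeta> x) \<le> 3 * d" for x
      using dist_Pair_le[of "fst b" "snd b" x "\<zeta> x"] that by (intro bexI[of _ "(x, \<zeta> x)"]) auto
    have mid: "x0 + d \<in> {x0 + d..x1 - d}" "x1 - d \<in> {x0 + d..x1 - d}" "x0 + d \<in> {x0..x1}" "x1 - d \<in> {x0..x1}"
      using d x0 x1_pos by auto
    consider z where "b = (x0, z)" "z \<in> {0..z0}" | x where "b = (x, 0)" "x \<in> {x0..X}" | z where "b = (X, z)" "z \<in> {0..z0}"
      using bB unfolding singular_orbit_def by auto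
    then show ?thesis
    proof cases
      case 1
      show ?thesis
      proof (cases "\<zeta> (x0 + d) \<le> z")
        case True
        have "continuous_on {x0..x0 + d} \<zeta>" by (rule continuous_on_subset[OF \<zeta>_cont]) (use mid in auto)
        then obtain x where "x0 \<le> x" "x \<le> x0 + d" "\<zeta> x = z"
          using IVT2'[of \<zeta> "x0 + d" z x0] True 1 d orbit_facts(2) by auto
        then show ?thesis using mid 1 d by (intro *[of x]) (auto simp: dist_real_def)
      next
        case False
        then show ?thesis using mid(3) low[OF mid(1)] \<zeta>pos[OF mid(3)] 1 d by (intro *[of "x0 + d"]) (auto simp: dist_real_def)
      qed
    next
      case 2
      \<comment> \<open>The abscissa is moved out of the end strips. Since \<open>X\<close> may
        exceed x1 by d, this shifts it by at most 2 d, and the height adds another d; this worst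
        case is the source of the factor 3.\<close>
      define y where "y = max (x0 + d) (min x (x1 - d))"
      have y: "y \<in> {x0 + d..x1 - d}" "y \<in> {x0..x1}" using mid d by (auto simp: y_def)
      have "dist x y \<le> 2 * d" using 2 X d mid by (auto simp: y_def dist_real_def max_def min_def abs_if split: if_splits)
      then show ?thesis using y(2) low[OF y(1)] \<zeta>pos[OF y(2)] 2 by (intro *[of y]) (auto simp: dist_real_def)
    next
      case 3
      show ?thesis
      proof (cases "\<zeta> (x1 - d) \<le> z")
        case True
        have "continuous_on {x1 - d..x1} \<zeta>" by (rule continuous_on_subset[OF \<zeta>_cont]) (use mid in auto)
        then obtain x where "x1 - d \<le> x" "x \<le> x1" "\<zeta> x = z"
          using IVT'[of \<zeta> "x1 - d" z x1] True 3 d orbit_facts(3) by auto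
        then show ?thesis using mid 3 d X by (intro *[of x]) (auto simp: dist_real_def)
      next
        case False
        then show ?thesis using mid(4) low[OF mid(2)] \<zeta>pos[OF mid(4)] 3 d X by (intro *[of "x1 - d"]) (auto simp: dist_real_def)
      qed
    qed
  qed
  have ne: "?A \<noteq> {}" "?B \<noteq> {}" using x0 x1_pos z0 by (auto simp: singular_orbit_def)
  show "0 \<le> hausdorff_distance ?A ?B" "hausdorff_distance ?A ?B \<le> 3 * d"
    using hausdorff_distance_bounds[OF ne A B] by auto
qed

end

section \<open>The slow-fast system and its entry-exit relation\<close>

locale slow_fast =
  fixes f g :: "real \<Rightarrow> real \<Rightarrow> real \<Rightarrow> real" and r :: nat and E :: real
  assumes r: "1 \<le> r"
    and E: "0 < E"
    and f_smooth: "C_k_on (r + 1) (\<lambda>(x, z, \<epsilon>). f x z \<epsilon>) (UNIV \<times> UNIV \<times> {0..<E})"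
    and g_smooth: "C_k_on (r + 1) (\<lambda>(x, z, \<epsilon>). g x z \<epsilon>) (UNIV \<times> UNIV \<times> {0..<E})"
    and f_pos: "\<And>x. 0 < f x 0 0"
    and g_neg: "\<And>x. x < 0 \<Longrightarrow> g x 0 0 < 0"
    and g_pos: "\<And>x. 0 < x \<Longrightarrow> 0 < g x 0 0"
begin

lemma C1: "C_k_on (Suc 0) (\<lambda>(x, z, \<epsilon>). f x z \<epsilon>) (UNIV \<times> UNIV \<times> {0..<E})"
  "C_k_on (Suc 0) (\<lambda>(x, z, \<epsilon>). g x z \<epsilon>) (UNIV \<times> UNIV \<times> {0..<E})"
  using C_k_on_le[OF f_smooth, of "Suc 0"] C_k_on_le[OF g_smooth, of "Suc 0"] by auto

abbreviation h0 where "h0 s \<equiv> g s 0 0 / f s 0 0"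

lemma slice_cont: "0 \<le> \<epsilon> \<Longrightarrow> \<epsilon> < E \<Longrightarrow> continuous_on S (\<lambda>s. f s 0 \<epsilon>)" "0 \<le> \<epsilon> \<Longrightarrow> \<epsilon> < E \<Longrightarrow> continuous_on S (\<lambda>s. g s 0 \<epsilon>)"
  using continuous_on_compose2[OF C_k_on_continuous[OF C1(1)] continuous_on_Pair[OF continuous_on_id continuous_on_const[of S "(0, \<epsilon>)"]]]
    continuous_on_compose2[OF C_k_on_continuous[OF C1(2)] continuous_on_Pair[OF continuous_on_id continuous_on_const[of S "(0, \<epsilon>)"]]]
  by (auto simp: image_subset_iff)

lemma h0_cont: "continuous_on S h0"
  by (intro continuous_on_divide slice_cont) (use E f_pos in \<open>auto simp: less_imp_neq[symmetric]\<close>)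

lemma h0_int: "h0 integrable_on {u..v}"
  by (rule integrable_continuous_real[OF h0_cont])

lemma h0_combine: "u \<le> v \<Longrightarrow> v \<le> w \<Longrightarrow> integral {u..v} h0 + integral {v..w} h0 = integral {u..w} h0"
  by (rule Henstock_Kurzweil_Integration.integral_combine[OF _ _ h0_int])

lemma h0_neg: "s < 0 \<Longrightarrow> h0 s < 0" using g_neg[of s] f_pos[of s] by (simp add: divide_neg_pos)
lemma h0_pos: "0 < s \<Longrightarrow> 0 < h0 s" using g_pos[of s] f_pos[of s] by simp

lemma h0_zero: "h0 0 = 0"
proof (rule antisym)
  have "closure {..<0::real} = {..0}" "closure {0::real<..} = {0..}" by auto
  then show "h0 0 \<le> 0" "0 \<le> h0 0"
    using continuous_le_on_closure[of "{..<0}" h0 0 0] continuous_ge_on_closure[of "{0<..}" h0 0 0] h0_cont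
      less_imp_le[OF h0_neg] less_imp_le[OF h0_pos] by auto
qed

lemma h0_nonpos: "s \<le> 0 \<Longrightarrow> h0 s \<le> 0" using h0_neg[of s] h0_zero by (cases "s = 0") auto
lemma h0_nonneg: "0 \<le> s \<Longrightarrow> 0 \<le> h0 s" using h0_pos[of s] h0_zero by (cases "s = 0") auto

lemma integral_h0_nonpos: "v \<le> 0 \<Longrightarrow> integral {u..v} h0 \<le> 0"
  using integral_le[OF h0_int[of u v], of "\<lambda>_. 0"] h0_nonpos by auto

lemma integral_h0_pos:
  assumes "0 < u" "u < v" shows "0 < integral {u..v} h0"
proof -
  have "h0 u \<noteq> 0" "u \<in> {u..v}" using h0_pos[of u] assms by auto
  then have "\<not> (\<forall>x\<in>{u..v}. h0 x = 0)" by blast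
  moreover have "integral {u..v} h0 = 0 \<longleftrightarrow> (\<forall>x\<in>{u..v}. h0 x = 0)"
    by (rule integral_eq_0_iff[OF h0_cont assms(2) h0_nonneg]) (use assms in auto)
  ultimately have "integral {u..v} h0 \<noteq> 0" by blast
  moreover have "0 \<le> integral {u..v} h0" by (rule integral_nonneg[OF h0_int]) (use h0_nonneg assms in auto)
  ultimately show ?thesis by simp
qed

text \<open>Beyond 0 the integral strictly increases with its upper limit. This identifies the exit
  point found at \<epsilon> = 0 with the given x1.\<close>

lemma exit_unique:
  assumes "x0 < 0" "0 < y" "0 < y'" "integral {x0..y} h0 = 0" "integral {x0..y'} h0 = 0"
  shows "y = y'"
proof -
  have "\<not> u < v" if "0 < u" "integral {x0..u} h0 = 0" "integral {x0..v} h0 = 0" for u v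
    using h0_combine[of x0 u v] integral_h0_pos[of u v] assms(1) that by auto
  then show ?thesis using assms by (meson linorder_neqE)
qed

text \<open>Chooses a box on which f > 0, so that h = g / f is of class C^(r+1), and a bracket for
  the exit points valid for all entry points in \<open>{a..b}\<close>.\<close>

theorem return_map_smooth:
  assumes ab: "a \<le> b" "b < 0" and ee: "\<And>x0. x0 \<in> {a..b} \<Longrightarrow> entry_exit f g x0 (x1 x0)"
  obtains Z c c2 where "0 < Z" "0 < c" "\<And>x0. x0 \<in> {a..b} \<Longrightarrow> x1 x0 \<le> c2"
    "\<And>z0. 0 < z0 \<Longrightarrow> z0 \<le> Z \<Longrightarrow> \<exists>e \<xi>. 0 < e \<and> e < E \<and> C_k_on r \<xi> ({a..b} \<times> {0..e}) \<and>
       (\<forall>x\<in>{a..c2}. \<forall>\<epsilon>\<in>{0..e}. 0 < f x 0 \<epsilon>) \<and>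
       (\<forall>x0\<in>{a..b}. \<xi> (x0, 0) = x1 x0) \<and>
       (\<forall>x0\<in>{a..b}. \<forall>\<epsilon>\<in>{0<..e}. \<xi> (x0, \<epsilon>) \<le> c2 \<and> (\<exists>\<zeta>. orbit_graph f g E x0 (\<xi> (x0, \<epsilon>)) z0 \<epsilon> c \<zeta>))"
proof -
  have x1: "0 < x1 x0" "integral {x0..x1 x0} h0 = 0" if "x0 \<in> {a..b}" for x0
    using ee[OF that] by (auto simp: entry_exit_def)
  have aI: "a \<in> {a..b}" "b \<in> {a..b}" using ab by auto
  \<comment> \<open>Exit points move left as entry points move right, so all of them lie between
    \<open>x1 b\<close> and \<open>x1 a\<close>; c1 and c2 leave a margin on both sides, which makes
    the signs in \<open>I1\<close> and \<open>I2\<close> strict.\<close>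
  define c1 where "c1 = x1 b / 2"
  define c2 where "c2 = x1 a + 1"
  have c1: "0 < c1" "c1 < x1 b" using x1(1)[OF aI(2)] by (auto simp: c1_def)
  have "x1 b \<le> x1 a"
  proof (rule ccontr)
    assume "\<not> x1 b \<le> x1 a"
    then have "0 < integral {x1 a..x1 b} h0" by (intro integral_h0_pos x1 aI) auto
    then show False
      using h0_combine[of b "x1 a" "x1 b"] h0_combine[of a b "x1 a"] integral_h0_nonpos[of b a] x1[OF aI(1)] x1[OF aI(2)] ab \<open>\<not> x1 b \<le> x1 a\<close> by auto
  qed
  then have c2: "c1 < c2" "x1 a < c2" using c1 by (auto simp: c2_def)
  have I1: "integral {x0..c1} h0 < 0" if "x0 \<in> {a..b}" for x0
    using h0_combine[of x0 b c1] h0_combine[of b c1 "x1 b"] integral_h0_nonpos[of b x0] integral_h0_pos[of c1 "x1 b"] x1[OF aI(2)] that ab c1 by auto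
  have I2: "0 < integral {x0..c2} h0" if "x0 \<in> {a..b}" for x0
    using h0_combine[of a x0 c2] h0_combine[of a "x1 a" c2] integral_h0_nonpos[of x0 a] integral_h0_pos[of "x1 a" c2] x1[OF aI(1)] that ab c1 c2 by auto
  have fc: "continuous_on ({a..c2} \<times> ({0..1} \<times> {0..E/2})) (\<lambda>y. f (fst y) (fst (snd y)) (snd (snd y)))"
  proof -
    have "{a..c2} \<times> ({0..1} \<times> {0..E/2}) \<subseteq> UNIV \<times> UNIV \<times> {0..<E}" using E by auto
    from continuous_on_subset[OF C_k_on_continuous[OF C1(1)] this] show ?thesis by (simp add: case_prod_beta')
  qed
  obtain k \<delta> where k: "0 < k" "0 < \<delta>" "\<And>x m. x \<in> {a..c2} \<Longrightarrow> m \<in> {0..1} \<times> {0..E/2} \<Longrightarrow> dist m (0, 0) < \<delta> \<Longrightarrow>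
      k \<le> f (fst (x, m)) (fst (snd (x, m))) (snd (snd (x, m)))"
    by (rule compact_uniform_lower_bound[OF fc, where ?m0.0="(0, 0)"]) (use E f_pos in \<open>auto intro: compact_Times\<close>)
  \<comment> \<open>The distance of \<open>(z, \<epsilon>)\<close> from the origin is at most z +
    \<epsilon>, hence the thirds of \<delta>. The bound E / 2 in \<open>eb\<close> keeps the closed
    box inside the half-open parameter range.\<close>
  define zb where "zb = min 1 (\<delta> / 3)"
  define eb where "eb = min (E / 2) (\<delta> / 3)"
  have zb: "0 < zb" "zb \<le> 1" "zb \<le> \<delta> / 3" using k by (auto simp: zb_def)
  have eb: "0 < eb" "eb \<le> E / 2" "eb \<le> \<delta> / 3" "eb < E" using k E by (auto simp: eb_def)
  have fp: "0 < f x z \<epsilon>" if "x \<in> {a..c2}" "z \<in> {0..zb}" "\<epsilon> \<in> {0..eb}" for x z \<epsilon>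
  proof -
    have "dist (z, \<epsilon>) (0, 0) \<le> z + \<epsilon>" using dist_Pair_le[of z \<epsilon> 0 0] that by (simp add: dist_real_def)
    then have "dist (z, \<epsilon>) (0, 0) < \<delta>" using that zb eb k by auto
    then show ?thesis using k(1) k(3)[of x "(z, \<epsilon>)"] that zb eb by auto
  qed
  define h where "h = (\<lambda>(x, z, \<epsilon>). g x z \<epsilon> / f x z \<epsilon>)"
  have sub: "{a..c2} \<times> {0..zb} \<times> {0..eb} \<subseteq> UNIV \<times> UNIV \<times> {0..<E}" using eb by auto
  have "C_k_on (Suc r) (\<lambda>p. (case p of (x, z, \<epsilon>) \<Rightarrow> g x z \<epsilon>) / (case p of (x, z, \<epsilon>) \<Rightarrow> f x z \<epsilon>)) ({a..c2} \<times> {0..zb} \<times> {0..eb})"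
    by (rule C_k_on_divide[OF C_k_on_subset[OF g_smooth[unfolded Suc_eq_plus1[symmetric]] sub] C_k_on_subset[OF f_smooth[unfolded Suc_eq_plus1[symmetric]] sub]])
       (use fp in force)
  then have hC: "C_k_on (Suc r) h ({a..c2} \<times> {0..zb} \<times> {0..eb})"
    by (rule C_k_on_cong) (auto simp: h_def)
  obtain Z c where Z: "0 < Z" "0 < c" "\<And>z0. 0 < z0 \<Longrightarrow> z0 \<le> Z \<Longrightarrow> \<exists>e \<xi>. 0 < e \<and> e \<le> eb \<and> C_k_on r \<xi> ({a..b} \<times> {0..e}) \<and>
      (\<forall>x0\<in>{a..b}. \<xi> (x0, 0) \<in> {c1..c2} \<and> integral {x0..\<xi> (x0, 0)} (\<lambda>s. h (s, 0, 0)) = 0) \<and>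
      (\<forall>x0\<in>{a..b}. \<forall>\<epsilon>\<in>{0<..e}. \<xi> (x0, \<epsilon>) \<in> {c1..c2} \<and> (\<exists>\<zeta>. connecting_orbit h z0 c x0 (\<xi> (x0, \<epsilon>)) \<epsilon> \<zeta>))"
    by (rule return_map[OF r hC ab zb(1) eb(1) c1(1) c2(1)])
       (use h0_neg h0_pos I1 I2 in \<open>auto simp: h_def\<close>)
  \<comment> \<open>Orbits satisfy z \<le> z0, so z0 \<le> zb keeps them where f is
    positive.\<close>
  have Z': "0 < min Z zb" using Z zb by simp
  have x1_le: "x1 x0 \<le> c2" if x0: "x0 \<in> {a..b}" for x0
  proof (rule ccontr)
    assume "\<not> x1 x0 \<le> c2"
    then have "0 < integral {c2..x1 x0} h0" "integral {x0..c2} h0 + integral {c2..x1 x0} h0 = integral {x0..x1 x0} h0"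
      using c1 c2 x0 ab by (auto intro!: integral_h0_pos h0_combine)
    then show False using I2[OF x0] x1(2)[OF x0] by simp
  qed
  show ?thesis
  proof (rule that[OF Z' Z(2) x1_le])
    fix z0 assume z0: "0 < z0" "z0 \<le> min Z zb"
    then obtain e \<xi> where e: "0 < e" "e \<le> eb" and \<xi>: "C_k_on r \<xi> ({a..b} \<times> {0..e})"
      "\<And>x0. x0\<in>{a..b} \<Longrightarrow> \<xi> (x0, 0) \<in> {c1..c2} \<and> integral {x0..\<xi> (x0, 0)} (\<lambda>s. h (s, 0, 0)) = 0"
      "\<And>x0 \<epsilon>. x0\<in>{a..b} \<Longrightarrow> \<epsilon>\<in>{0<..e} \<Longrightarrow> \<xi> (x0, \<epsilon>) \<in> {c1..c2} \<and> (\<exists>\<zeta>. connecting_orbit h z0 c x0 (\<xi> (x0, \<epsilon>)) \<epsilon> \<zeta>)"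
      using Z(3)[of z0] by auto
    have at0: "\<xi> (x0, 0) = x1 x0" if x0: "x0 \<in> {a..b}" for x0
    proof (rule exit_unique[of x0, OF _ _ x1(1)[OF x0] _ x1(2)[OF x0]])
      show "integral {x0..\<xi> (x0, 0)} h0 = 0" using conjunct2[OF \<xi>(2)[OF x0]] by (simp add: h_def)
      show "0 < \<xi> (x0, 0)" using conjunct1[OF \<xi>(2)[OF x0]] c1(1) by simp
      show "x0 < 0" using x0 ab by simp
    qed
    have orb: "\<xi> (x0, \<epsilon>) \<le> c2 \<and> (\<exists>\<zeta>. orbit_graph f g E x0 (\<xi> (x0, \<epsilon>)) z0 \<epsilon> c \<zeta>)" if x0: "x0 \<in> {a..b}" and \<epsilon>: "\<epsilon> \<in> {0<..e}" for x0 \<epsilon>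
    proof -
      obtain \<zeta> where \<zeta>: "connecting_orbit h z0 c x0 (\<xi> (x0, \<epsilon>)) \<epsilon> \<zeta>" using \<xi>(3)[OF x0 \<epsilon>] by blast
      have "0 < f x (\<zeta> x) \<epsilon>" if "x \<in> {x0..\<xi> (x0, \<epsilon>)}" for x
        using connecting_orbitD(4,5)[OF \<zeta> that] that conjunct1[OF \<xi>(3)[OF x0 \<epsilon>]] x0 \<epsilon> z0 e by (intro fp) auto
      then have "orbit_graph f g E x0 (\<xi> (x0, \<epsilon>)) z0 \<epsilon> c \<zeta>"
        using C1 \<zeta> x0 \<epsilon> ab e eb by unfold_locales (auto simp: h_def)
      then show ?thesis using conjunct1[OF \<xi>(3)[OF x0 \<epsilon>]] by auto
    qed
    show "\<exists>e \<xi>. 0 < e \<and> e < E \<and> C_k_on r \<xi> ({a..b} \<times> {0..e}) \<and>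
       (\<forall>x\<in>{a..c2}. \<forall>\<epsilon>\<in>{0..e}. 0 < f x 0 \<epsilon>) \<and>
       (\<forall>x0\<in>{a..b}. \<xi> (x0, 0) = x1 x0) \<and>
       (\<forall>x0\<in>{a..b}. \<forall>\<epsilon>\<in>{0<..e}. \<xi> (x0, \<epsilon>) \<le> c2 \<and> (\<exists>\<zeta>. orbit_graph f g E x0 (\<xi> (x0, \<epsilon>)) z0 \<epsilon> c \<zeta>))"
    proof (intro exI[where x=e] exI[where x=\<xi>] conjI ballI)
      show "0 < f x 0 \<epsilon>" if "x \<in> {a..c2}" "\<epsilon> \<in> {0..e}" for x \<epsilon>
        by (rule fp) (use that zb e in auto)
      show "\<xi> (x0, \<epsilon>) \<le> c2" "\<exists>\<zeta>. orbit_graph f g E x0 (\<xi> (x0, \<epsilon>)) z0 \<epsilon> c \<zeta>"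
        if "x0 \<in> {a..b}" "\<epsilon> \<in> {0<..e}" for x0 \<epsilon> using orb[OF that] by auto
    qed (use e eb \<xi>(1) at0 in auto)
  qed
qed

end

section \<open>Limits as \<epsilon> tends to 0 from the right\<close>

lemma eventually_at_right_0I: "0 < (b::real) \<Longrightarrow> (\<And>\<epsilon>. 0 < \<epsilon> \<Longrightarrow> \<epsilon> < b \<Longrightarrow> P \<epsilon>) \<Longrightarrow> \<forall>\<^sub>F \<epsilon> in at_right 0. P \<epsilon>"
  unfolding eventually_at_right_field by blast

context slow_fast
begin

text \<open>The smooth return map is applied to the one-point interval \<open>{x0..x0}\<close>; from
  its conclusion, continuity in \<epsilon> at 0 gives convergence of the exit point to x1.\<close>

theorem entry_exit_asymptotics:
  assumes ee: "entry_exit f g x0 x1"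
  defines "\<zeta>0 \<equiv> integral {x0..0} (\<lambda>x. \<bar>g x 0 0\<bar> / f x 0 0)"
  shows "\<exists>Z>0. \<forall>z0. 0 < z0 \<and> z0 \<le> Z \<longrightarrow>
          (\<forall>\<^sub>F \<epsilon> in at_right 0. \<exists>!\<gamma>. is_trajectory f g x0 z0 \<epsilon> \<gamma>) \<and>
          ((\<lambda>\<epsilon>. hausdorff_distance (trajectory f g x0 z0 \<epsilon>) (singular_orbit x0 x1 z0)) \<longlongrightarrow> 0)
            (at_right 0) \<and>
          (\<exists>h. (h \<longlongrightarrow> 0) (at_right 0) \<and>
               (\<forall>\<^sub>F \<epsilon> in at_right 0.
                  exp ((- \<zeta>0 + h \<epsilon>) / \<epsilon>) \<in> snd ` trajectory f g x0 z0 \<epsilon> \<and>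
                  (\<forall>z \<in> snd ` trajectory f g x0 z0 \<epsilon>. exp ((- \<zeta>0 + h \<epsilon>) / \<epsilon>) \<le> z)))"
proof -
  have x: "x0 < 0" "0 < x1" "integral {x0..x1} h0 = 0" using ee by (auto simp: entry_exit_def)
  obtain Z c c2 where Z: "0 < Z" and c: "0 < c" and c2: "\<And>y. y \<in> {x0..x0} \<Longrightarrow> x1 \<le> c2"
    and ret: "\<And>z0. 0 < z0 \<Longrightarrow> z0 \<le> Z \<Longrightarrow> \<exists>e \<xi>. 0 < e \<and> e < E \<and> C_k_on r \<xi> ({x0..x0} \<times> {0..e}) \<and>
       (\<forall>x\<in>{x0..c2}. \<forall>\<epsilon>\<in>{0..e}. 0 < f x 0 \<epsilon>) \<and>
       (\<forall>y\<in>{x0..x0}. \<xi> (y, 0) = x1) \<and>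
       (\<forall>y\<in>{x0..x0}. \<forall>\<epsilon>\<in>{0<..e}. \<xi> (y, \<epsilon>) \<le> c2 \<and> (\<exists>\<zeta>. orbit_graph f g E y (\<xi> (y, \<epsilon>)) z0 \<epsilon> c \<zeta>))"
    by (rule return_map_smooth[of x0 x0 "\<lambda>_. x1"]) (use x ee in auto)
  have x1c2: "x1 \<le> c2" using c2[of x0] by simp
  have J: "integral {x0..0} h0 = - \<zeta>0"
  proof -
    have "\<zeta>0 = integral {x0..0} (\<lambda>s. - h0 s)" unfolding \<zeta>0_def
    proof (rule integral_cong)
      fix s assume "s \<in> {x0..0}"
      then have "h0 s \<le> 0" by (intro h0_nonpos) simp
      then have "g s 0 0 \<le> 0" using f_pos[of s] by (simp add: divide_le_0_iff)
      then show "\<bar>g s 0 0\<bar> / f s 0 0 = - h0 s" by simp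
    qed
    then show ?thesis by simp
  qed
  \<comment> \<open>By the entry-exit relation the growth over \<open>{0..x1}\<close> equals the
    decay \<zeta>0, so both terms of the minimum in \<open>min_estimate\<close> tend to
    -\<zeta>0.\<close>
  have L: "integral {0..x1} h0 = \<zeta>0" using h0_combine[of x0 0 x1] J x by simp
  have "(\<forall>\<^sub>F \<epsilon> in at_right 0. \<exists>!\<gamma>. is_trajectory f g x0 z0 \<epsilon> \<gamma>) \<and>
      ((\<lambda>\<epsilon>. hausdorff_distance (trajectory f g x0 z0 \<epsilon>) (singular_orbit x0 x1 z0)) \<longlongrightarrow> 0) (at_right 0) \<and>
      (\<exists>h. (h \<longlongrightarrow> 0) (at_right 0) \<and>
         (\<forall>\<^sub>F \<epsilon> in at_right 0.
            exp ((- \<zeta>0 + h \<epsilon>) / \<epsilon>) \<in> snd ` trajectory f g x0 z0 \<epsilon> \<and>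
            (\<forall>z \<in> snd ` trajectory f g x0 z0 \<epsilon>. exp ((- \<zeta>0 + h \<epsilon>) / \<epsilon>) \<le> z)))"
    if z0: "0 < z0" "z0 \<le> Z" for z0
  proof -
    obtain e \<xi> where e: "0 < e" "e < E" and \<xi>: "C_k_on r \<xi> ({x0..x0} \<times> {0..e})"
      and fp: "\<And>x \<epsilon>. x\<in>{x0..c2} \<Longrightarrow> \<epsilon>\<in>{0..e} \<Longrightarrow> 0 < f x 0 \<epsilon>"
      and \<xi>0: "\<xi> (x0, 0) = x1"
      and orb: "\<And>\<epsilon>. \<epsilon>\<in>{0<..e} \<Longrightarrow> \<xi> (x0, \<epsilon>) \<le> c2 \<and> (\<exists>\<zeta>. orbit_graph f g E x0 (\<xi> (x0, \<epsilon>)) z0 \<epsilon> c \<zeta>)"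
      using ret[OF z0] by auto
    define X where "X \<epsilon> = \<xi> (x0, \<epsilon>)" for \<epsilon>
    define \<zeta> where "\<zeta> \<epsilon> = (SOME \<zeta>. orbit_graph f g E x0 (X \<epsilon>) z0 \<epsilon> c \<zeta>)" for \<epsilon>
    have og: "orbit_graph f g E x0 (X \<epsilon>) z0 \<epsilon> c (\<zeta> \<epsilon>)" if "\<epsilon> \<in> {0<..e}" for \<epsilon>
      using someI_ex[OF conjunct2[OF orb[OF that]]] by (simp add: \<zeta>_def X_def)
    have Xc2: "X \<epsilon> \<le> c2" if "\<epsilon> \<in> {0<..e}" for \<epsilon> using orb[OF that] by (simp add: X_def)
    have Xpos: "0 < X \<epsilon>" if "\<epsilon> \<in> {0<..e}" for \<epsilon> by (rule orbit_graph.x1_pos[OF og[OF that]])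
    have tr: "trajectory f g x0 z0 \<epsilon> = (\<lambda>x. (x, \<zeta> \<epsilon> x)) ` {x0..X \<epsilon>}" if "\<epsilon> \<in> {0<..e}" for \<epsilon>
      by (rule orbit_graph.trajectory_eq[OF og[OF that]])
    have ev: "\<forall>\<^sub>F \<epsilon> in at_right 0. \<epsilon> \<in> {0<..e}" by (rule eventually_at_right_0I[OF e(1)]) auto
    have X_lim: "(X \<longlongrightarrow> x1) (at_right 0)"
    proof -
      have "continuous_on {0..e} X"
        using continuous_on_slice2[OF C_k_on_continuous[OF \<xi>], of x0] by (simp add: X_def[abs_def])
      then have "(X \<longlongrightarrow> X 0) (at 0 within {0..e})" using e by (simp add: continuous_on_def)
      then show ?thesis using \<xi>0 e at_within_Icc_at_right[of 0 e] by (simp add: X_def)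
    qed
    define H where "H s \<epsilon> = g s 0 \<epsilon> / f s 0 \<epsilon>" for s \<epsilon>
    have H0: "H s 0 = h0 s" for s by (simp add: H_def)
    have H_cont: "continuous_on ({x0..c2} \<times> {0..e}) (\<lambda>y. H (fst y) (snd y))"
    proof -
      have *: "continuous_on ({x0..c2} \<times> {0..e}) (\<lambda>y. (fst y, 0::real, snd y))" by (intro continuous_intros)
      have **: "(\<lambda>y. (fst y, 0::real, snd y)) ` ({x0..c2} \<times> {0..e}) \<subseteq> UNIV \<times> UNIV \<times> {0..<E}" using e by auto
      have "continuous_on ({x0..c2} \<times> {0..e}) (\<lambda>y. g (fst y) 0 (snd y))" "continuous_on ({x0..c2} \<times> {0..e}) (\<lambda>y. f (fst y) 0 (snd y))"
        using continuous_on_compose2[OF C_k_on_continuous[OF C1(2)] * **] continuous_on_compose2[OF C_k_on_continuous[OF C1(1)] * **] by simp_all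
      then show ?thesis unfolding H_def by (rule continuous_on_divide) (use fp in force)
    qed
    have part1: "\<forall>\<^sub>F \<epsilon> in at_right 0. \<exists>!\<gamma>. is_trajectory f g x0 z0 \<epsilon> \<gamma>"
      using ev by eventually_elim (rule orbit_graph.trajectory_ex1[OF og])
    have part2: "((\<lambda>\<epsilon>. hausdorff_distance (trajectory f g x0 z0 \<epsilon>) (singular_orbit x0 x1 z0)) \<longlongrightarrow> 0) (at_right 0)"
    proof (rule tendstoI)
      fix k :: real assume k: "0 < k"
      \<comment> \<open>k / 4 makes 3 d < k, and x1 / 2 guarantees d \<le>
        \<open>X \<epsilon>\<close> once \<open>X \<epsilon>\<close> is within d of x1.\<close>
      define d where "d = Min {k / 4, - x0, x1 / 2}"
      have d: "0 < d" "d \<le> k / 4" "d \<le> - x0" "d \<le> x1 / 2" using k x by (auto simp: d_def)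
      have evX: "\<forall>\<^sub>F \<epsilon> in at_right 0. dist (X \<epsilon>) x1 < d" by (rule tendstoD[OF X_lim d(1)])
      have evs: "\<forall>\<^sub>F \<epsilon> in at_right 0. z0 * exp 1 * exp (- (c * d / \<epsilon>)) \<le> d"
      proof (rule eventually_at_right_0I)
        \<comment> \<open>Threshold from exp (-y) \<le> 2 / y at y = c d / \<epsilon>: the height is
          then at most 2 z0 e \<epsilon> / (c d), which must not exceed d.\<close>
        show "0 < c * d * d / (2 * (z0 * exp 1))" using c d z0 by simp
        fix \<epsilon> :: real assume \<epsilon>: "0 < \<epsilon>" "\<epsilon> < c * d * d / (2 * (z0 * exp 1))"
        have "exp (- (c * d / \<epsilon>)) \<le> ((real 1 + 1) * inverse (c * d / \<epsilon>)) ^ 1"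
          by (rule exp_minus_le_inverse_power) (use c d \<epsilon> in simp)
        then have "z0 * exp 1 * exp (- (c * d / \<epsilon>)) \<le> z0 * exp 1 * (2 * \<epsilon> / (c * d))"
          using z0 by (intro mult_left_mono) (auto simp: divide_inverse mult_ac)
        also have "\<dots> \<le> d"
        proof -
          have "0 < 2 * (z0 * exp 1)" using z0 by simp
          then have "\<epsilon> * (2 * (z0 * exp 1)) \<le> d * (c * d)" using \<epsilon>(2) by (simp add: pos_less_divide_eq mult_ac)
          then have "(\<epsilon> * (2 * (z0 * exp 1))) / (c * d) \<le> d" using c d by (simp add: pos_divide_le_eq)
          then show ?thesis by (simp add: mult_ac)
        qed
        finally show "z0 * exp 1 * exp (- (c * d / \<epsilon>)) \<le> d" .
      qed
      show "\<forall>\<^sub>F \<epsilon> in at_right 0. dist (hausdorff_distance (trajectory f g x0 z0 \<epsilon>) (singular_orbit x0 x1 z0)) 0 < k"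
        using ev evX evs
      proof eventually_elim
        case (elim \<epsilon>)
        have dX: "\<bar>X \<epsilon> - x1\<bar> \<le> d" "d \<le> X \<epsilon>" using elim(2) d by (auto simp: dist_real_def abs_le_iff abs_less_iff)
        have "0 \<le> hausdorff_distance (trajectory f g x0 z0 \<epsilon>) (singular_orbit x0 x1 z0)"
          "hausdorff_distance (trajectory f g x0 z0 \<epsilon>) (singular_orbit x0 x1 z0) \<le> 3 * d"
          unfolding tr[OF elim(1)]
          using orbit_graph.hausdorff_estimate[OF og[OF elim(1)] d(1) d(3) dX(2) dX(1) x(2) z0(1) c elim(3)] by auto
        then show ?case using d k by (simp add: dist_real_def)
      qed
    qed
    define m where "m \<epsilon> = Inf (snd ` trajectory f g x0 z0 \<epsilon>)" for \<epsilon>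
    \<comment> \<open>The o(1) term is read off from the minimum, so the exponential formula is
      exact for \<epsilon> in \<open>{0<..e}\<close> and only hh \<rightarrow> 0 has to be
      shown.\<close>
    define hh where "hh \<epsilon> = \<epsilon> * ln (m \<epsilon>) + \<zeta>0" for \<epsilon>
    have m_est: "0 < m \<epsilon> \<and> m \<epsilon> \<in> snd ` trajectory f g x0 z0 \<epsilon> \<and> (\<forall>z\<in>snd ` trajectory f g x0 z0 \<epsilon>. m \<epsilon> \<le> z) \<and>
        \<epsilon> * ln (m \<epsilon>) \<le> \<epsilon> * ln z0 + \<epsilon> + - \<zeta>0 + d * (X \<epsilon> - x0) \<and>
        \<epsilon> * ln z0 - \<epsilon> - d * (X \<epsilon> - x0) + min (- \<zeta>0) (- integral {0..X \<epsilon>} h0) \<le> \<epsilon> * ln (m \<epsilon>)"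
      if \<epsilon>: "\<epsilon> \<in> {0<..e}" and d: "0 \<le> d" "\<And>s. s \<in> {x0..X \<epsilon>} \<Longrightarrow> \<bar>H s \<epsilon> - H s 0\<bar> \<le> d" for \<epsilon> d
    proof -
      have Hs: "continuous_on {x0..X \<epsilon>} (\<lambda>s. H s t)" if "t \<in> {0..e}" for t
        using continuous_on_subset[OF continuous_on_slice1[OF H_cont that], of "{x0..X \<epsilon>}"] Xc2[OF \<epsilon>] by auto
      have s1: "H s 0 \<le> 0" if "s \<in> {x0..0}" for s unfolding H0 by (rule h0_nonpos) (use that in simp)
      have s2: "0 \<le> H s 0" if "s \<in> {0..X \<epsilon>}" for s unfolding H0 by (rule h0_nonneg) (use that in simp)
      obtain m' where m': "0 < m'" "m' \<in> snd ` ((\<lambda>x. (x, \<zeta> \<epsilon> x)) ` {x0..X \<epsilon>})"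
        "\<And>z. z \<in> snd ` ((\<lambda>x. (x, \<zeta> \<epsilon> x)) ` {x0..X \<epsilon>}) \<Longrightarrow> m' \<le> z"
        "\<epsilon> * ln m' \<le> \<epsilon> * ln z0 + \<epsilon> + integral {x0..0} (\<lambda>s. H s 0) + d * (X \<epsilon> - x0)"
        "\<epsilon> * ln z0 - \<epsilon> - d * (X \<epsilon> - x0) + min (integral {x0..0} (\<lambda>s. H s 0)) (- integral {0..X \<epsilon>} (\<lambda>s. H s 0)) \<le> \<epsilon> * ln m'"
        by (rule orbit_graph.min_estimate[OF og[OF \<epsilon>] H_def z0(1) Hs Hs d(2) d(1) s1 s2]) (use \<epsilon> e in auto)
      have "m \<epsilon> = m'" unfolding m_def tr[OF \<epsilon>] by (rule cInf_eq_minimum[OF m'(2,3)])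
      then show ?thesis using m' J unfolding tr[OF \<epsilon>] H0 by auto
    qed
    \<comment> \<open>A crude d from compactness is enough here, because only positivity and
      attainment of the minimum are kept.\<close>
    have m_basic: "0 < m \<epsilon> \<and> m \<epsilon> \<in> snd ` trajectory f g x0 z0 \<epsilon> \<and> (\<forall>z\<in>snd ` trajectory f g x0 z0 \<epsilon>. m \<epsilon> \<le> z)"
      if \<epsilon>: "\<epsilon> \<in> {0<..e}" for \<epsilon>
    proof -
      have "continuous_on {x0..X \<epsilon>} (\<lambda>s. H s \<epsilon> - H s 0)"
        using continuous_on_subset[OF continuous_on_slice1[OF H_cont, of \<epsilon>], of "{x0..X \<epsilon>}"]
          continuous_on_subset[OF continuous_on_slice1[OF H_cont, of 0], of "{x0..X \<epsilon>}"] Xc2[OF \<epsilon>] \<epsilon> e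
        by (intro continuous_on_diff) auto
      then have "bounded ((\<lambda>s. H s \<epsilon> - H s 0) ` {x0..X \<epsilon>})"
        by (intro compact_imp_bounded compact_continuous_image compact_Icc)
      then obtain d where "0 < d" "\<And>s. s \<in> {x0..X \<epsilon>} \<Longrightarrow> \<bar>H s \<epsilon> - H s 0\<bar> \<le> d" unfolding bounded_pos by auto
      then show ?thesis using m_est[OF \<epsilon>, of d] by auto
    qed
    have hh_lim: "(hh \<longlongrightarrow> 0) (at_right 0)"
    proof (rule tendstoI)
      fix k :: real assume k: "0 < k"
      have D: "0 < c2 - x0" using x x1c2 by simp
      \<comment> \<open>Three errors share the margin k, a quarter each: the terms \<epsilon> ln z0
        and \<epsilon>, the change of h over \<open>{x0..X \<epsilon>}\<close>, and the shift of the
        exit point from x1 to \<open>X \<epsilon>\<close>.\<close>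
      define d where "d = k / (4 * (c2 - x0))"
      have "k / (4 * t) * t = k / 4" if "0 < t" for t using that by simp
      from this[OF D] have d2: "d * (c2 - x0) = k / 4" unfolding d_def .
      have d1: "0 < d" unfolding d_def using k D by simp
      note d = d1 d2
      obtain \<delta> where \<delta>: "0 < \<delta>" "\<And>s \<epsilon>. s \<in> {x0..c2} \<Longrightarrow> 0 \<le> \<epsilon> \<Longrightarrow> \<epsilon> \<le> e \<Longrightarrow> \<epsilon> < \<delta> \<Longrightarrow>
          \<bar>H (fst (s, \<epsilon>)) (snd (s, \<epsilon>)) - H (fst (s, 0::real)) (snd (s, 0))\<bar> \<le> d"
        by (rule uniform_perturbation[OF H_cont compact_Icc d(1)], rule that)
      have ev\<delta>: "\<forall>\<^sub>F \<epsilon> in at_right 0. \<epsilon> < \<delta>" by (rule eventually_at_right_0I[OF \<delta>(1)])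
      have evL: "\<forall>\<^sub>F \<epsilon> in at_right 0. dist (integral {0..X \<epsilon>} h0) \<zeta>0 < k / 4"
      proof (rule tendstoD)
        have "continuous_on {0..c2} (\<lambda>y. integral {0..y} h0)"
          by (rule indefinite_integral_continuous_1[OF h0_int])
        moreover have "\<forall>\<^sub>F \<epsilon> in at_right 0. X \<epsilon> \<in> {0..c2}"
          using ev by eventually_elim (use Xc2 Xpos in \<open>auto intro: less_imp_le\<close>)
        ultimately have "((\<lambda>\<epsilon>. integral {0..X \<epsilon>} h0) \<longlongrightarrow> integral {0..x1} h0) (at_right 0)"
          using x x1c2 by (intro continuous_on_tendsto_compose[OF _ X_lim, of "{0..c2}"]) auto
        then show "((\<lambda>\<epsilon>. integral {0..X \<epsilon>} h0) \<longlongrightarrow> \<zeta>0) (at_right 0)" unfolding L .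
      qed (use k in simp)
      have "((\<lambda>\<epsilon>. \<epsilon> * (\<bar>ln z0\<bar> + 1)) \<longlongrightarrow> 0 * (\<bar>ln z0\<bar> + 1)) (at_right 0)" by (intro tendsto_intros)
      then have "\<forall>\<^sub>F \<epsilon> in at_right 0. dist (\<epsilon> * (\<bar>ln z0\<bar> + 1)) 0 < k / 4" using k by (intro tendstoD) auto
      with ev ev\<delta> evL show "\<forall>\<^sub>F \<epsilon> in at_right 0. dist (hh \<epsilon>) 0 < k"
      proof eventually_elim
        case (elim \<epsilon>)
        have "\<bar>H s \<epsilon> - H s 0\<bar> \<le> d" if "s \<in> {x0..X \<epsilon>}" for s
          using \<delta>(2)[of s \<epsilon>] elim that Xc2[OF elim(1)] by auto
        note est = m_est[OF elim(1) less_imp_le[OF d(1)] this]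
        have "d * (X \<epsilon> - x0) \<le> d * (c2 - x0)" using d(1) Xc2[OF elim(1)] by (intro mult_left_mono) auto
        then have dk: "d * (X \<epsilon> - x0) \<le> k / 4" using d(2) by simp
        have "\<bar>\<epsilon> * ln z0\<bar> + \<epsilon> = \<epsilon> * (\<bar>ln z0\<bar> + 1)" using elim(1) by (simp add: abs_mult distrib_left)
        also have "\<dots> < k / 4" using elim(4) elim(1) by (simp add: dist_real_def abs_mult)
        finally have ek: "\<bar>\<epsilon> * ln z0\<bar> + \<epsilon> < k / 4" .
        have Lk: "\<bar>integral {0..X \<epsilon>} h0 - \<zeta>0\<bar> < k / 4" using elim(3) by (simp add: dist_real_def)
        have up: "\<epsilon> * ln (m \<epsilon>) \<le> \<epsilon> * ln z0 + \<epsilon> + - \<zeta>0 + d * (X \<epsilon> - x0)"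
          and lo: "\<epsilon> * ln z0 - \<epsilon> - d * (X \<epsilon> - x0) + min (- \<zeta>0) (- integral {0..X \<epsilon>} h0) \<le> \<epsilon> * ln (m \<epsilon>)"
          using est by auto
        have low: "- \<zeta>0 - k / 4 \<le> min (- \<zeta>0) (- integral {0..X \<epsilon>} h0)"
        proof (rule min.boundedI)
          show "- \<zeta>0 - k / 4 \<le> - integral {0..X \<epsilon>} h0" using Lk by linarith
        qed (use k in simp)
        have "hh \<epsilon> < k" using up dk ek k unfolding hh_def by linarith
        moreover have "- k < hh \<epsilon>" using low lo dk ek k unfolding hh_def by linarith
        ultimately have "\<bar>hh \<epsilon>\<bar> < k" by linarith
        then show ?case by (simp add: dist_real_def)
      qed
    qed
    have "\<forall>\<^sub>F \<epsilon> in at_right 0. exp ((- \<zeta>0 + hh \<epsilon>) / \<epsilon>) \<in> snd ` trajectory f g x0 z0 \<epsilon> \<and>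
        (\<forall>z \<in> snd ` trajectory f g x0 z0 \<epsilon>. exp ((- \<zeta>0 + hh \<epsilon>) / \<epsilon>) \<le> z)"
      using ev
    proof eventually_elim
      case (elim \<epsilon>)
      have "exp ((- \<zeta>0 + hh \<epsilon>) / \<epsilon>) = m \<epsilon>" using m_basic[OF elim] elim by (simp add: hh_def)
      then show ?case using m_basic[OF elim] by simp
    qed
    with part1 part2 hh_lim show ?thesis by blast
  qed
  then show ?thesis using Z by blast
qed

theorem exit_point_smooth:
  assumes A: "a \<le> b \<and> b < 0 \<and> (\<forall>x0\<in>{a..b}. entry_exit f g x0 (x1 x0))"
  shows "\<exists>Z>0. \<forall>z0. 0 < z0 \<and> z0 \<le> Z \<longrightarrow>
          (\<exists>\<epsilon>0. 0 < \<epsilon>0 \<and> \<epsilon>0 < E \<and>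
             (\<exists>\<xi> :: real \<times> real \<Rightarrow> real.
                (\<forall>x0\<in>{a..b}. \<xi> (x0, 0) = x1 x0) \<and>
                (\<forall>x0\<in>{a..b}. \<forall>\<epsilon>\<in>{0<..\<epsilon>0}.
                   (\<exists>!\<gamma>. is_trajectory f g x0 z0 \<epsilon> \<gamma>) \<and>
                   trajectory f g x0 z0 \<epsilon> \<inter> cross_section z0 = {(\<xi> (x0, \<epsilon>), z0)}) \<and>
                C_k_on r \<xi> ({a..b} \<times> {0..\<epsilon>0})))"
proof -
  obtain Z c c2 where Z: "0 < Z"
    and ret: "\<And>z0. 0 < z0 \<Longrightarrow> z0 \<le> Z \<Longrightarrow> \<exists>e \<xi>. 0 < e \<and> e < E \<and> C_k_on r \<xi> ({a..b} \<times> {0..e}) \<and>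
       (\<forall>x\<in>{a..c2}. \<forall>\<epsilon>\<in>{0..e}. 0 < f x 0 \<epsilon>) \<and>
       (\<forall>x0\<in>{a..b}. \<xi> (x0, 0) = x1 x0) \<and>
       (\<forall>x0\<in>{a..b}. \<forall>\<epsilon>\<in>{0<..e}. \<xi> (x0, \<epsilon>) \<le> c2 \<and> (\<exists>\<zeta>. orbit_graph f g E x0 (\<xi> (x0, \<epsilon>)) z0 \<epsilon> c \<zeta>))"
    by (rule return_map_smooth[of a b x1]) (use A in auto)
  have "\<exists>\<epsilon>0. 0 < \<epsilon>0 \<and> \<epsilon>0 < E \<and>
             (\<exists>\<xi> :: real \<times> real \<Rightarrow> real.
                (\<forall>x0\<in>{a..b}. \<xi> (x0, 0) = x1 x0) \<and>
                (\<forall>x0\<in>{a..b}. \<forall>\<epsilon>\<in>{0<..\<epsilon>0}.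
                   (\<exists>!\<gamma>. is_trajectory f g x0 z0 \<epsilon> \<gamma>) \<and>
                   trajectory f g x0 z0 \<epsilon> \<inter> cross_section z0 = {(\<xi> (x0, \<epsilon>), z0)}) \<and>
                C_k_on r \<xi> ({a..b} \<times> {0..\<epsilon>0}))" if z0: "0 < z0" "z0 \<le> Z" for z0
  proof -
    obtain e \<xi> where e: "0 < e" "e < E" and \<xi>: "C_k_on r \<xi> ({a..b} \<times> {0..e})"
      "\<forall>x0\<in>{a..b}. \<xi> (x0, 0) = x1 x0"
      "\<And>x0 \<epsilon>. x0\<in>{a..b} \<Longrightarrow> \<epsilon>\<in>{0<..e} \<Longrightarrow> \<exists>\<zeta>. orbit_graph f g E x0 (\<xi> (x0, \<epsilon>)) z0 \<epsilon> c \<zeta>"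
      using ret[OF z0] by blast
    have traj: "(\<exists>!\<gamma>. is_trajectory f g x0 z0 \<epsilon> \<gamma>) \<and> trajectory f g x0 z0 \<epsilon> \<inter> cross_section z0 = {(\<xi> (x0, \<epsilon>), z0)}"
      if mem: "x0 \<in> {a..b}" "\<epsilon> \<in> {0<..e}" for x0 \<epsilon>
    proof -
      obtain \<zeta> where og: "orbit_graph f g E x0 (\<xi> (x0, \<epsilon>)) z0 \<epsilon> c \<zeta>" using \<xi>(3)[OF mem] by blast
      show ?thesis by (intro conjI orbit_graph.trajectory_ex1[OF og] orbit_graph.trajectory_cross_section[OF og])
    qed
    show ?thesis
      by (intro exI[where x=e] exI[where x=\<xi>] conjI ballI e \<xi>(1) bspec[OF \<xi>(2)] conjunct1[OF traj] conjunct2[OF traj])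
  qed
  then show ?thesis using Z by blast
qed

end

theorem mainTheorem1:
  fixes f g :: "real \<Rightarrow> real \<Rightarrow> real \<Rightarrow> real" and r :: nat and E :: real
  assumes r: "1 \<le> r"
    and E: "0 < E"
    and f_smooth: "C_k_on (r + 1) (\<lambda>(x, z, \<epsilon>). f x z \<epsilon>) (UNIV \<times> UNIV \<times> {0..<E})"
    and g_smooth: "C_k_on (r + 1) (\<lambda>(x, z, \<epsilon>). g x z \<epsilon>) (UNIV \<times> UNIV \<times> {0..<E})"
    and f_pos: "\<And>x. 0 < f x 0 0"
    and g_neg: "\<And>x. x < 0 \<Longrightarrow> g x 0 0 < 0"
    and g_pos: "\<And>x. 0 < x \<Longrightarrow> 0 < g x 0 0"
  shows
    "(\<forall>x0 x1. entry_exit f g x0 x1 \<longrightarrow>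
       (\<exists>Z>0. \<forall>z0. 0 < z0 \<and> z0 \<le> Z \<longrightarrow>
          (\<forall>\<^sub>F \<epsilon> in at_right 0. \<exists>!\<gamma>. is_trajectory f g x0 z0 \<epsilon> \<gamma>) \<and>
          ((\<lambda>\<epsilon>. hausdorff_distance (trajectory f g x0 z0 \<epsilon>) (singular_orbit x0 x1 z0)) \<longlongrightarrow> 0)
            (at_right 0) \<and>
          (let \<zeta>0 = integral {x0..0} (\<lambda>x. \<bar>g x 0 0\<bar> / f x 0 0) in
             \<exists>h. (h \<longlongrightarrow> 0) (at_right 0) \<and>
               (\<forall>\<^sub>F \<epsilon> in at_right 0.
                  exp ((- \<zeta>0 + h \<epsilon>) / \<epsilon>) \<in> snd ` trajectory f g x0 z0 \<epsilon> \<and>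
                  (\<forall>z \<in> snd ` trajectory f g x0 z0 \<epsilon>. exp ((- \<zeta>0 + h \<epsilon>) / \<epsilon>) \<le> z))))) \<and>
     (\<forall>a b x1. a \<le> b \<and> b < 0 \<and> (\<forall>x0\<in>{a..b}. entry_exit f g x0 (x1 x0)) \<longrightarrow>
       (\<exists>Z>0. \<forall>z0. 0 < z0 \<and> z0 \<le> Z \<longrightarrow>
          (\<exists>\<epsilon>0. 0 < \<epsilon>0 \<and> \<epsilon>0 < E \<and>
             (\<exists>\<xi> :: real \<times> real \<Rightarrow> real.
                (\<forall>x0\<in>{a..b}. \<xi> (x0, 0) = x1 x0) \<and>
                (\<forall>x0\<in>{a..b}. \<forall>\<epsilon>\<in>{0<..\<epsilon>0}.
                   (\<exists>!\<gamma>. is_trajectory f g x0 z0 \<epsilon> \<gamma>) \<and>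
                   trajectory f g x0 z0 \<epsilon> \<inter> cross_section z0 = {(\<xi> (x0, \<epsilon>), z0)}) \<and>
                C_k_on r \<xi> ({a..b} \<times> {0..\<epsilon>0})))))"
proof (intro conjI allI impI, goal_cases)
  case (1 x0 x1)
  interpret slow_fast f g r E
    using assms by unfold_locales
  show ?case unfolding Let_def by (rule entry_exit_asymptotics[OF 1])
next
  case (2 a b x1)
  interpret slow_fast f g r E
    using assms by unfold_locales
  show ?case by (rule exit_point_smooth[OF 2])
qed

end
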